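(* Let $\Bbbk$ be an integral domain of characteristic $0$, let $\ell\in\mathbb{Z}_+$, let $\varepsilon^{1/2}$ be a primitive $\ell$-th root of unity in the algebraic closure of the fraction field of $\Bbbk$, and let $\Sigma=(M_\varepsilon,\tilde B)$ be a root of unity quantum seed with frame matrix $\Lambda$. (1) For every monomial subalgebra $\mathbb{A}_\Sigma(\Phi)$ of $\mathcal{T}_\varepsilon(M_\varepsilon)$, the triple $$\big(\mathbb{A}_\Sigma(\Phi),\ \mathbb{A}_\Sigma(\Phi)\cap\mathcal{Z}(\mathcal{T}_\varepsilon(M_\varepsilon)),\ \mathrm{tr}_{\mathrm{red}}^{\mathcal{T}_\varepsilon(M_\varepsilon)}\big)$$ is a Cayley--Hamilton algebra of degree $d(\Lambda)=\sqrt{[\mathbb{Z}^N:\mathrm{Ker}(\Lambda)]}$. (2) A monomial subalgebra $\mathbb{A}_\Sigma(\Phi)$ is a maximal order if and only if the submonoid $\Phi$ of $\mathbb{Z}^N$ is integrally convex and integrally closed. For the remaining parts, let $\Theta$ be a nonempty subset of the set of seeds mutation-equivalent to $(M_\varepsilon,\tilde B)$, let $\mathbb{A}_{\Sigma}(\Phi_{\Sigma})$ be a monomial subalgebra of $\mathcal{T}_\varepsilon(M'_\varepsilon)$ for each seed $\Sigma=(M'_\varepsilon,\tilde B')\in\Theta$ (for some submonoids $\Phi_\Sigma\subseteq\mathbb{Z}^N$), and put $\mathbb{A}:=\bigcap_{\Sigma\in\Theta}\mathbb{A}_\Sigma(\Phi_\Sigma)$. The following hold: (3) For every pair of seeds $(M'_\varepsilon,\tilde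 B'),(M''_\varepsilon,\tilde B'')\in\Theta$, $\mathrm{tr}_{\mathrm{red}}^{\mathcal{T}_\varepsilon(M'_\varepsilon)}|_{\mathbb{A}}=\mathrm{tr}_{\mathrm{red}}^{\mathcal{T}_\varepsilon(M''_\varepsilon)}|_{\mathbb{A}}$. Denote by $\mathrm{tr}_{\mathrm{red}}$ this common restriction. (4) $\mathrm{tr}_{\mathrm{red}}(\mathbb{A})\subseteq\bigcap_{\Sigma\in\Theta}\mathcal{Z}(\mathbb{A}_\Sigma(\Phi_\Sigma))$. (5) The triple $\big(\mathbb{A},\ \bigcap_{\Sigma\in\Theta}\mathcal{Z}(\mathbb{A}_\Sigma(\Phi_\Sigma)),\ \mathrm{tr}_{\mathrm{red}}\big)$ is a Cayley--Hamilton algebra of degree $d(M_\varepsilon,\tilde B)$, where $d(M_\varepsilon,\tilde B)=d(\Lambda_{M'_\varepsilon})$ for any seed $(M'_\varepsilon,\tilde B')$ mutation-equivalent to $(M_\varepsilon,\tilde B)$.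
   Context: $\mathcal{Z}(R)$ denotes the center of $R$. **Quantum cluster setting.** $\mathcal{A}_\varepsilon^{1/2}:=\Bbbk[\varepsilon^{1/2}]$. Fix $N\in\mathbb{Z}_+$ and a set $\mathbf{ex}\subseteq[1,N]$ of exchangeable indices. An exchange matrix is $\tilde B=(b_{ij})\in M_{N\times\mathbf{ex}}(\mathbb{Z})$ whose $\mathbf{ex}\times\mathbf{ex}$ submatrix $B$ (principal part) is such that $DB$ is skew-symmetric for some $D=\mathrm{diag}(d_j,j\in\mathbf{ex})$, $d_j\in\mathbb{Z}_+$. For $k\in\mathbf{ex}$, $\mu_k(\tilde B)=(b'_{ij})$ with $b'_{ij}=-b_{ij}$ if $i=k$ or $j=k$, and $b'_{ij}=b_{ij}+\frac{|b_{ik}|b_{kj}+b_{ik}|b_{kj}|}{2}$ otherwise. For a skew-symmetric bicharacter $\Lambda:\mathbb{Z}^N\times\mathbb{Z}^N\to\mathbb{Z}/\ell$ (identified with its matrix), the quantum torus $\mathcal{T}_\varepsilon(\Lambda)$ is the $\mathcal{A}_\varepsilon^{1/2}$-algebra with basis $\{X^f\mid f\in\mathbb{Z}^N\}$ and product $X^fX^g=\varepsilon^{\Lambda(f,g)/2}X^{f+g}$. $\mathrm{Ker}(\Lambda):=\{f\in\mathbb{Z}^N\mid\Lambda(f,g)=0\ \forall g\in\mathbb{Z}^N\}$ and $d(\Lambda):=\sqrt{[\mathbb{Z}^N:\mathrm{Ker}(\Lambda)]}$. A root of unity toric frame of a division algebra $\mathcal{F}_\varepsilon$ over $\mathbb{Q}(\varepsilon^{1/2})$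 is a map $M_\varepsilon:\mathbb{Z}^N\to\mathcal{F}_\varepsilon$ for which there is such a $\Lambda$ (the matrix of the frame, $\Lambda_{M_\varepsilon}$) so that $X^f\mapsto M_\varepsilon(f)$ is an $\mathcal{A}_\varepsilon^{1/2}$-algebra embedding $\phi:\mathcal{T}_\varepsilon(\Lambda)\hookrightarrow\mathcal{F}_\varepsilon$ and $\mathcal{F}_\varepsilon$ is the division ring of fractions of the image. Put $\mathcal{T}_\varepsilon(M_\varepsilon):=\phi(\mathcal{T}_\varepsilon(\Lambda))$. A root of unity quantum seed is a pair $(M_\varepsilon,\tilde B)$ such that, for some diagonal matrix $D=\mathrm{diag}(d_j,j\in\mathbf{ex})$ with $d_j\in\mathbb{Z}_+$ and $DB$ skew-symmetric ($B$ being the principal part of $\tilde B$), the $(i,j)$ entry of $\Lambda_{M_\varepsilon}^\top\tilde B$ modulo $\ell$ equals $d_j$ if $i=j$ and $0$ otherwise ($i\in[1,N]$, $j\in\mathbf{ex}$). Its mutation at $k\in\mathbf{ex}$ is $(\mu_k(M_\varepsilon),\mu_k(\tilde B))$, where $\mu_k(M_\varepsilon)$ is the toric frame with $\mu_k(M_\varepsilon)(e_i)=M_\varepsilon(e_i)$ for $i\ne k$ and $\mu_k(M_\varepsilon)(e_k)=M_\varepsilon(-e_k+[b^k]_+)+M_\varepsilon(-e_k-[b^k]_-)$; here $b^k$ is the $k$-th column of $\tilde B$, and $[c]_+$, $[c]_-$ are the parts of $c\in\mathbb{Z}^N$ with nonnegative, resp. nonpositive, coordinates. (Its matrix $\Lambda'$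 satisfies $\Lambda'(e_i,e_j)=\Lambda(e_i,e_j)$ and $\Lambda'(e_i,e_k)=\Lambda(e_i,-e_k+[b^k]_+)$ for $i,j\neq k$.) Seeds are mutation-equivalent if connected by a sequence of mutations. **Monomial subalgebras.** For a seed $\Sigma=(M_\varepsilon,\tilde B)$ and a submonoid $\Phi$ of $\mathbb{Z}^N$, $\mathbb{A}_\Sigma(\Phi)$ is the $\mathcal{A}_\varepsilon^{1/2}$-span of $\{M_\varepsilon(f)\mid f\in\Phi\}$, a subalgebra of $\mathcal{T}_\varepsilon(M_\varepsilon)$. Let $\underline{\Phi}=\Phi-\Phi$ be the group generated by $\Phi$. $\Phi$ is integrally convex if for all $f,g\in\Phi$ every point of $\underline{\Phi}$ on the segment $[f,g]\subset\mathbb{R}^N$ lies in $\Phi$ (equivalently, in the paper: $f\in\underline\Phi$ and $kf\in\Phi$ for some $k\in\mathbb{Z}_+$ imply $f\in\Phi$). For $0\ne f\in\mathbb{R}^N$ put $\mathrm{Ray}(f)=\{tf\mid t>0\}$ and for $V\subseteq\mathbb{R}^N$ let $\mathrm{Ray}(V)$ be the set of rays through nonzero elements of $V$; $\mathrm{Ray}(\mathbb{R}^N)$ is topologized through its bijection with the unit sphere. $\Phi$ is integrally closed if $\mathrm{Ray}(\Phi)$ is closed in $\mathrm{Ray}(\underline{\Phi})$. **Maximal orders.** A central simple algebra over a field $Q$ is a finite dimensional simple $Q$-algebra with center $Q$. An order in a central simple algebra $S$ is a subring $R\subseteq S$ such that every $x\in S$ can be written $x=ab^{-1}=c^{-1}d$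 with $a,b,c,d\in R$. Orders $R,R'$ are equivalent if $aRb\subseteq R'$ and $a'R'b'\subseteq R$ for some units $a,b,a',b'\in S$. A maximal order is an order maximal under inclusion in its equivalence class. **Reduced trace.** For a prime PI algebra $R$ of PI degree $d$, with $Q$ the quotient field of $\mathcal{Z}(R)$ and $K$ a finite extension of $Q$ splitting the central simple algebra $R\otimes_{\mathcal{Z}(R)}Q$, $\mathrm{tr}_{\mathrm{red}}^R$ is the composition $R\to R\otimes_{\mathcal{Z}(R)}K\cong M_d(K)\xrightarrow{\mathrm{Tr}}K$. For $R=\mathcal{T}_\varepsilon(M_\varepsilon)$ with matrix $\Lambda$ it sends $M_\varepsilon(f)$ to $d(\Lambda)M_\varepsilon(f)$ if $f\in\mathrm{Ker}(\Lambda)$ and to $0$ otherwise. **Cayley--Hamilton algebras.** An algebra with trace is a triple $(R,C,\mathrm{tr})$: $R$ an algebra over a commutative ring, $C$ a central subalgebra, $\mathrm{tr}:R\to C$ a $C$-linear map with $\mathrm{tr}(ab)=\mathrm{tr}(ba)$. Let $p_i\in\mathbb{Z}[(i!)^{-1}][x_1,\dots,x_i]$ be the polynomials with $\sigma_i=p_i(\psi_1,\dots,\psi_i)$, $\sigma_i$ and $\psi_i$ the elementary symmetric and power sum functions in $d$ indeterminates. For $a\in R$ put $\chi_{d,a}(t)=t^d-c_1(a)t^{d-1}+\dots+(-1)^dc_d(a)$, $c_i(a)=p_i(\mathrm{tr}(a),\dots,\mathrm{tr}(a^i))$. The triple is a Cayley--Hamilton algebra of degree $d$ if $1,\dots,d$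 are not zero divisors in $R$, $\chi_{d,a}(a)=0$ for all $a\in R$, and $\mathrm{tr}(1)=d$.
   Formalization: Skew-symmetry includes Λ(f,f)=0; (1),(5) assume Ker(2Λ)=Ker(Λ) (automatic for odd ℓ); "if" in (2) assumes 𝕜[ε^{1/2}] completely integrally closed; (5) assumes the intersected centers lie in the torus center, or uses the intersection of A_Σ(Φ_Σ)∩Z(T_Σ) instead. *)

theory Defs
  imports
    "HOL-Analysis.Analysis"
    "HOL-Number_Theory.Cong"
    "HOL-Algebra.Algebraic_Closure_Type"
begin

section \<open>Subrings of a division ring\<close>

text \<open>
  All algebras below are subrings of one division ring, given by a type of class
  \<^class>\<open>division_ring\<close>, so they are treated as sets.
\<close>

definition unital_subring :: "'a::ring_1 set \<Rightarrow> bool" where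
  "unital_subring R \<longleftrightarrow> 1 \<in> R \<and> (\<forall>x\<in>R. \<forall>y\<in>R. x - y \<in> R \<and> x * y \<in> R)"

definition center_of :: "'a::ring_1 set \<Rightarrow> 'a set" where
  "center_of R = {z \<in> R. \<forall>r\<in>R. z * r = r * z}"

definition units_in :: "'a::division_ring set \<Rightarrow> 'a set" where
  "units_in S = {u \<in> S. u \<noteq> 0 \<and> inverse u \<in> S}"

definition has_fractions :: "'a::division_ring set \<Rightarrow> 'a set \<Rightarrow> bool" where
  "has_fractions R S \<longleftrightarrow>
     (\<forall>x\<in>S. (\<exists>a\<in>R. \<exists>b \<in> R \<inter> units_in S. x = a * inverse b) \<and>
            (\<exists>c \<in> R \<inter> units_in S. \<exists>d\<in>R. x = inverse c * d))"

definition central_simple :: "'a::division_ring set \<Rightarrow> bool" where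
  "central_simple S \<longleftrightarrow> unital_subring S \<and>
     (\<forall>z \<in> center_of S. z \<noteq> 0 \<longrightarrow> inverse z \<in> center_of S) \<and>
     (\<exists>E. finite E \<and> E \<subseteq> S \<and>
        (\<forall>x\<in>S. \<exists>c. c ` E \<subseteq> center_of S \<and> x = (\<Sum>e\<in>E. c e * e))) \<and>
     (\<forall>I. I \<subseteq> S \<and> 0 \<in> I \<and> (\<forall>x\<in>I. \<forall>y\<in>I. x - y \<in> I) \<and>
          (\<forall>x\<in>I. \<forall>s\<in>S. s * x \<in> I \<and> x * s \<in> I) \<longrightarrow> I = {0} \<or> I = S)"

definition order_in :: "'a::division_ring set \<Rightarrow> 'a set \<Rightarrow> bool" where
  "order_in R S \<longleftrightarrow> unital_subring R \<and> R \<subseteq> S \<and> has_fractions R S"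

definition equivalent_orders :: "'a::division_ring set \<Rightarrow> 'a set \<Rightarrow> 'a set \<Rightarrow> bool" where
  "equivalent_orders S R R' \<longleftrightarrow>
     (\<exists>a\<in>units_in S. \<exists>b\<in>units_in S. \<forall>r\<in>R. a * r * b \<in> R') \<and>
     (\<exists>a\<in>units_in S. \<exists>b\<in>units_in S. \<forall>r\<in>R'. a * r * b \<in> R)"

text \<open>The algebra \<open>S\<close> is determined by \<open>R\<close>: it is the set of all fractions of \<open>R\<close>.\<close>

definition maximal_order :: "'a::division_ring set \<Rightarrow> bool" where
  "maximal_order R \<longleftrightarrow> (\<exists>S. central_simple S \<and> order_in R S \<and>
     (\<forall>R'. order_in R' S \<and> equivalent_orders S R R' \<and> R \<subseteq> R' \<longrightarrow> R' = R))"

text \<open>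
  A commutative domain is a maximal order iff it is completely integrally closed.
  The zero monoid is integrally convex and integrally closed, and its monomial subalgebra is the
  coefficient ring \<open>\<A>\<close>; so \<open>\<A>\<close> has to be completely integrally closed if every integrally
  convex and integrally closed monoid is to give a maximal order.  An integral domain need not be
  (for example \<open>\<int>[\<surd>5]\<close>).
\<close>

definition completely_integrally_closed :: "'a::field set \<Rightarrow> bool" where
  "completely_integrally_closed A \<longleftrightarrow>
     (\<forall>x. (\<exists>a\<in>A. \<exists>b\<in>A - {0}. x = a / b) \<and> (\<exists>c\<in>A - {0}. \<forall>n. c * x ^ n \<in> A) \<longrightarrow> x \<in> A)"


section \<open>Reduced trace\<close>

definition central_fractions :: "'a::division_ring set \<Rightarrow> 'a set" where
  "central_fractions R = {a * inverse b | a b. a \<in> center_of R \<and> b \<in> center_of R \<and> b \<noteq> 0}"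

definition finite_extension :: "'a::division_ring set \<Rightarrow> 'a set \<Rightarrow> bool" where
  "finite_extension Q K \<longleftrightarrow> Q \<subseteq> K \<and> unital_subring K \<and>
     (\<forall>x\<in>K. \<forall>y\<in>K. x * y = y * x) \<and> (\<forall>x\<in>K. x \<noteq> 0 \<longrightarrow> inverse x \<in> K) \<and>
     (\<exists>E. finite E \<and> E \<subseteq> K \<and> (\<forall>x\<in>K. \<exists>c. c ` E \<subseteq> Q \<and> x = (\<Sum>e\<in>E. c e * e)))"

text \<open>
  Let \<open>Z\<close> be the center of \<open>R\<close>, and \<open>Q\<close> its field of fractions.  \<open>splitting R K d \<rho>\<close> says that
  \<open>\<rho>\<close> is the restriction to \<open>R\<close> of an isomorphism of \<open>K\<close>-algebras from \<open>R \<otimes> K\<close> (tensor product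
  over \<open>Z\<close>) to the \<open>d \<times> d\<close> matrices over \<open>K\<close>: \<open>\<rho>\<close> is a homomorphism of \<open>Z\<close>-algebras, and it
  takes a \<open>Q\<close>-basis \<open>E \<subseteq> R\<close> of \<open>R \<otimes> Q\<close> to a \<open>K\<close>-basis of the matrix algebra.
  Only the entries of \<open>\<rho> r\<close> with both indices below \<open>d\<close> are relevant.
\<close>

definition splitting ::
    "'a::division_ring set \<Rightarrow> 'a set \<Rightarrow> nat \<Rightarrow> ('a \<Rightarrow> nat \<Rightarrow> nat \<Rightarrow> 'a) \<Rightarrow> bool" where
  "splitting R K d \<rho> \<longleftrightarrow>
     finite_extension (central_fractions R) K \<and>
     (\<forall>i<d. \<forall>j<d.
        (\<forall>r\<in>R. \<rho> r i j \<in> K) \<and>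
        (\<forall>r\<in>R. \<forall>s\<in>R. \<rho> (r + s) i j = \<rho> r i j + \<rho> s i j) \<and>
        (\<forall>r\<in>R. \<forall>s\<in>R. \<rho> (r * s) i j = (\<Sum>k<d. \<rho> r i k * \<rho> s k j)) \<and>
        (\<forall>z\<in>center_of R. \<forall>r\<in>R. \<rho> (z * r) i j = z * \<rho> r i j) \<and>
        \<rho> 1 i j = (if i = j then 1 else 0)) \<and>
     (\<exists>E. finite E \<and> E \<subseteq> R \<and>
        (\<forall>r\<in>R. \<exists>!c. c \<in> E \<rightarrow>\<^sub>E central_fractions R \<and> r = (\<Sum>e\<in>E. c e * e)) \<and>
        (\<forall>A. (\<forall>i<d. \<forall>j<d. A i j \<in> K) \<longrightarrow>
           (\<exists>!c. c \<in> E \<rightarrow>\<^sub>E K \<and> (\<forall>i<d. \<forall>j<d. A i j = (\<Sum>e\<in>E. c e * \<rho> e i j)))))"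

text \<open>
  The reduced trace does not depend on the splitting field, so it may be looked for among the
  commutative subfields of the ambient division ring: if the fractions of \<open>R\<close> form a division
  ring of finite dimension over \<open>Q\<close>, its maximal subfields are finite extensions of \<open>Q\<close> that
  split it.
\<close>

definition reduced_trace :: "'a::division_ring set \<Rightarrow> 'a \<Rightarrow> 'a" where
  "reduced_trace R x = (THE t. \<exists>K d \<rho>. splitting R K d \<rho> \<and> t = (\<Sum>i<d. \<rho> x i i))"


section \<open>Cayley--Hamilton algebras\<close>

text \<open>
  \<open>newton_poly x i\<close> is the value \<open>p\<^sub>i(x\<^sub>1, \<dots>, x\<^sub>i)\<close> of the polynomial that expresses the
  elementary symmetric function \<open>\<sigma>\<^sub>i\<close> through the power sums, in the form of Newton's
  recursion; the lemma \<open>newton_poly_power_sums\<close> is its defining property.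
\<close>

fun newton_poly :: "(nat \<Rightarrow> 'a::division_ring) \<Rightarrow> nat \<Rightarrow> 'a" where
  "newton_poly x 0 = 1"
| "newton_poly x (Suc i) =
     (\<Sum>j\<le>i. (-1) ^ j * newton_poly x (i - j) * x (Suc j)) / of_nat (Suc i)"

definition elem_sym :: "nat \<Rightarrow> (nat \<Rightarrow> 'a::comm_semiring_1) \<Rightarrow> nat \<Rightarrow> 'a" where
  "elem_sym d y i = (\<Sum>S | S \<subseteq> {..<d} \<and> card S = i. \<Prod>s\<in>S. y s)"

lemma elem_sym_0 [simp]: "elem_sym d y 0 = 1"
proof -
  have "{S. S \<subseteq> {..<d} \<and> card S = 0} = {{}}"
    by (auto dest: finite_subset[OF _ finite_lessThan])
  then show ?thesis
    unfolding elem_sym_def by simp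
qed

lemma elem_sym_no_vars [simp]: "elem_sym 0 y (Suc i) = 0"
  unfolding elem_sym_def by (rule sum.neutral) auto

lemma elem_sym_Suc:
  "elem_sym (Suc d) y (Suc i) = elem_sym d y (Suc i) + y d * elem_sym d y i"
proof -
  let ?P = "\<lambda>(d::nat) i. {S. S \<subseteq> {..<d} \<and> card S = i}"
  have fin: "finite (?P d i)" for d i
    by (rule finite_subset[of _ "Pow {..<d}"]) auto
  have split: "?P (Suc d) (Suc i) = ?P d (Suc i) \<union> insert d ` ?P d i"
  proof (intro equalityI subsetI)
    fix S assume S: "S \<in> ?P (Suc d) (Suc i)"
    then have finS: "finite S" by (auto intro: finite_subset[OF _ finite_lessThan])
    show "S \<in> ?P d (Suc i) \<union> insert d ` ?P d i"
    proof (cases "d \<in> S")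
      case True
      then have "S = insert d (S - {d})" "S - {d} \<in> ?P d i"
        using S finS by (auto simp: less_Suc_eq)
      then show ?thesis by blast
    qed (use S in \<open>auto simp: less_Suc_eq\<close>)
  next
    fix S assume "S \<in> ?P d (Suc i) \<union> insert d ` ?P d i"
    then consider "S \<in> ?P d (Suc i)" | T where "T \<in> ?P d i" "S = insert d T" by blast
    then show "S \<in> ?P (Suc d) (Suc i)"
    proof cases
      case 2
      then have "finite T" "d \<notin> T" by (auto intro: finite_subset[OF _ finite_lessThan])
      with 2 show ?thesis by auto
    qed (auto intro: less_SucI)
  qed
  have disj: "?P d (Suc i) \<inter> insert d ` ?P d i = {}" by auto
  have inj: "inj_on (insert d) (?P d i)"
    by (rule inj_onI) (metis (no_types, lifting) insert_ident lessThan_iff less_irrefl mem_Collect_eq subsetD)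
  have "(\<Sum>S\<in>insert d ` ?P d i. \<Prod>s\<in>S. y s) = (\<Sum>S\<in>?P d i. y d * (\<Prod>s\<in>S. y s))"
  proof (subst sum.reindex[OF inj], rule sum.cong)
    fix S assume "S \<in> ?P d i"
    then have "finite S" "d \<notin> S" by (auto intro: finite_subset[OF _ finite_lessThan])
    then show "((\<lambda>S. \<Prod>s\<in>S. y s) \<circ> insert d) S = y d * (\<Prod>s\<in>S. y s)" by simp
  qed simp
  then show ?thesis
    unfolding elem_sym_def split
    by (subst sum.union_disjoint) (use fin disj in \<open>auto simp: sum_distrib_left\<close>)
qed

lemma newton_identity:
  fixes y :: "nat \<Rightarrow> 'a::comm_ring_1"
  shows "of_nat (Suc i) * elem_sym d y (Suc i) =
    (\<Sum>j\<le>i. (-1) ^ j * elem_sym d y (i - j) * (\<Sum>s<d. y s ^ Suc j))"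
proof (induction d arbitrary: i)
  case 0
  then show ?case by simp
next
  case (Suc d)
  let ?e = "elem_sym d y" and ?E = "elem_sym (Suc d) y" and ?p = "\<lambda>j. \<Sum>s<d. y s ^ Suc j"
  show ?case
  proof (cases i)
    case 0
    then show ?thesis
      using Suc.IH[of 0] by (simp add: elem_sym_Suc)
  next
    case (Suc m)
    have E: "?E (i - j) = ?e (i - j) + y d * ?e (m - j)" if "j \<le> m" for j
      using that Suc by (simp add: Suc_diff_le elem_sym_Suc)
    have top: "(\<Sum>j\<le>i. F j) = (\<Sum>j\<le>m. F j) + F i" for F :: "nat \<Rightarrow> 'a"
      using Suc by simp
    have bot: "(\<Sum>j\<le>i. F j) = F 0 + (\<Sum>j\<le>m. F (Suc j))" for F :: "nat \<Rightarrow> 'a"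
      using Suc by (simp only: sum.atMost_Suc_shift)
    have "(\<Sum>j\<le>i. (-1) ^ j * ?E (i - j) * (\<Sum>s<Suc d. y s ^ Suc j)) =
        (\<Sum>j\<le>m. (-1) ^ j * (?e (i - j) + y d * ?e (m - j)) * (?p j + y d ^ Suc j))
          + (-1) ^ i * (?p i + y d ^ Suc i)"
      by (subst top) (simp add: E)
    also have "\<dots> = ((\<Sum>j\<le>m. (-1) ^ j * ?e (i - j) * ?p j) + (-1) ^ i * ?p i)
        + y d * (\<Sum>j\<le>m. (-1) ^ j * ?e (m - j) * ?p j)
        + ((\<Sum>j\<le>m. (-1) ^ j * ?e (i - j) * y d ^ Suc j) + (-1) ^ i * y d ^ Suc i)
        + (\<Sum>j\<le>m. (-1) ^ j * ?e (m - j) * y d ^ Suc (Suc j))"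
      by (simp add: algebra_simps sum.distrib sum_distrib_left)
    also have "(\<Sum>j\<le>m. (-1) ^ j * ?e (i - j) * ?p j) + (-1) ^ i * ?p i
        = of_nat (Suc i) * ?e (Suc i)"
      by (subst Suc.IH[of i], subst top) simp
    also have "(\<Sum>j\<le>m. (-1) ^ j * ?e (m - j) * ?p j) = of_nat i * ?e i"
      using Suc.IH[of m] Suc by simp
    also have "(\<Sum>j\<le>m. (-1) ^ j * ?e (i - j) * y d ^ Suc j) + (-1) ^ i * y d ^ Suc i
        = (\<Sum>j\<le>i. (-1) ^ j * ?e (i - j) * y d ^ Suc j)"
      by (subst top) simp
    also have "\<dots> = ?e i * y d - (\<Sum>j\<le>m. (-1) ^ j * ?e (m - j) * y d ^ Suc (Suc j))"
      by (subst bot) (simp add: Suc sum_negf)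
    finally show ?thesis
      by (simp add: elem_sym_Suc algebra_simps)
  qed
qed

lemma newton_poly_power_sums:
  fixes y :: "nat \<Rightarrow> 'a::field_char_0"
  shows "newton_poly (\<lambda>j. \<Sum>s<d. y s ^ j) i = elem_sym d y i"
proof (induction i rule: less_induct)
  case (less i)
  show ?case
  proof (cases i)
    case (Suc m)
    have "newton_poly (\<lambda>j. \<Sum>s<d. y s ^ j) i =
        (\<Sum>j\<le>m. (-1) ^ j * elem_sym d y (m - j) * (\<Sum>s<d. y s ^ Suc j)) / of_nat (Suc m)"
      using less Suc by (simp del: of_nat_Suc)
    also have "\<dots> = elem_sym d y (Suc m)"
      unfolding newton_identity[symmetric] by (simp del: of_nat_Suc)
    finally show ?thesis by (simp add: Suc)
  qed simp
qed

definition subalgebra_over :: "'a::ring_1 set \<Rightarrow> 'a set \<Rightarrow> bool" where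
  "subalgebra_over k R \<longleftrightarrow> unital_subring R \<and> k \<subseteq> R"

definition algebra_with_trace ::
    "'a::ring_1 set \<Rightarrow> 'a set \<Rightarrow> 'a set \<Rightarrow> ('a \<Rightarrow> 'a) \<Rightarrow> bool" where
  "algebra_with_trace k R C tr \<longleftrightarrow>
     unital_subring k \<and> k \<subseteq> center_of R \<and>
     subalgebra_over k R \<and> subalgebra_over k C \<and> C \<subseteq> center_of R \<and>
     (\<forall>a\<in>R. tr a \<in> C) \<and>
     (\<forall>a\<in>R. \<forall>b\<in>R. tr (a + b) = tr a + tr b \<and> tr (a * b) = tr (b * a)) \<and>
     (\<forall>c\<in>C. \<forall>a\<in>R. tr (c * a) = c * tr a)"

text \<open>
  The coefficients of the characteristic polynomial lie in \<open>R[1/d!]\<close>, of which \<open>R\<close> is a subring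
  because \<open>1, \<dots>, d\<close> are not zero divisors.
\<close>

definition cayley_hamilton ::
    "nat \<Rightarrow> 'a::division_ring set \<Rightarrow> 'a set \<Rightarrow> 'a set \<Rightarrow> ('a \<Rightarrow> 'a) \<Rightarrow> bool" where
  "cayley_hamilton d k R C tr \<longleftrightarrow>
     algebra_with_trace k R C tr \<and>
     (\<forall>m\<in>{1..d}. \<forall>a\<in>R. of_nat m * a = 0 \<longrightarrow> a = 0) \<and>
     (\<forall>a\<in>R. (\<Sum>i\<le>d. (-1) ^ i * newton_poly (\<lambda>j. tr (a ^ j)) i * a ^ (d - i)) = 0) \<and>
     tr 1 = of_nat d"


section \<open>Toric frames\<close>

definition primitive_root_of_unity :: "nat \<Rightarrow> 'a::monoid_mult \<Rightarrow> bool" where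
  "primitive_root_of_unity l q \<longleftrightarrow> q ^ l = 1 \<and> (\<forall>m. 0 < m \<and> m < l \<longrightarrow> q ^ m \<noteq> 1)"

text \<open>
  In what follows \<open>q\<close> stands for \<open>\<epsilon>\<close> to the power \<open>1/2\<close>, and \<open>base_ring q\<close> is the ring
  obtained from the integral domain \<open>'k\<close> by adjoining \<open>q\<close>.
\<close>

definition base_ring :: "'k::idom fract alg_closure \<Rightarrow> 'k fract alg_closure set" where
  "base_ring q = range (\<lambda>p::'k poly. poly (map_poly (\<lambda>a. to_ac (to_fract a)) p) q)"

text \<open>The structure of an \<open>A\<close>-algebra on a ring; \<open>\<iota>\<close> is relevant on \<open>A\<close> only.\<close>

definition algebra_structure :: "'c::comm_ring_1 set \<Rightarrow> ('c \<Rightarrow> 'a::ring_1) \<Rightarrow> bool" where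
  "algebra_structure A \<iota> \<longleftrightarrow> \<iota> 1 = 1 \<and>
     (\<forall>a\<in>A. \<forall>b\<in>A. \<iota> (a + b) = \<iota> a + \<iota> b \<and> \<iota> (a * b) = \<iota> a * \<iota> b) \<and>
     (\<forall>a\<in>A. \<forall>x. \<iota> a * x = x * \<iota> a)"

text \<open>
  A bicharacter with values in \<open>\<int>/l\<close> is represented by an integer matrix \<open>L\<close>, taken modulo \<open>l\<close>.
  Skew-symmetry includes \<open>\<Lambda>(f,f) = 0\<close>, which is automatic for odd \<open>l\<close> only; without it the index
  of the kernel need not be a square.
\<close>

definition form :: "int ^ 'n ^ 'n \<Rightarrow> int ^ 'n \<Rightarrow> int ^ 'n \<Rightarrow> int" where
  "form L f g = (\<Sum>i\<in>UNIV. \<Sum>j\<in>UNIV. f $ i * L $ i $ j * g $ j)"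

definition skew_symmetric_mod :: "nat \<Rightarrow> int ^ 'n ^ 'n \<Rightarrow> bool" where
  "skew_symmetric_mod l L \<longleftrightarrow>
     (\<forall>i j. [L $ i $ j = - L $ j $ i] (mod int l)) \<and> (\<forall>i. [L $ i $ i = 0] (mod int l))"

definition frame_kernel :: "nat \<Rightarrow> int ^ 'n ^ 'n \<Rightarrow> (int ^ 'n) set" where
  "frame_kernel l L = {f. \<forall>g. [form L f g = 0] (mod int l)}"

definition frame_degree :: "nat \<Rightarrow> int ^ 'n ^ 'n \<Rightarrow> real" where
  "frame_degree l L =
     sqrt (real (card ((UNIV :: (int ^ 'n) set) // {(f, g). f - g \<in> frame_kernel l L})))"

text \<open>
  As \<open>X\<^sup>f\<close> and \<open>X\<^sup>g\<close> commute up to the factor \<open>q\<^sup>2\<close> to the power \<open>\<Lambda>(f,g)\<close>, the center of the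
  quantum torus is spanned by the \<open>X\<^sup>f\<close> with \<open>f\<close> in the kernel of \<open>2\<Lambda>\<close>.  This is the kernel of
  \<open>\<Lambda>\<close> if \<open>l\<close> is odd, but may be larger if \<open>l\<close> is even; then the PI degree of the torus, which is
  the reduced trace of 1, is smaller than \<open>frame_degree l L\<close>.  So the equality of the two
  kernels is necessary for the torus to be a Cayley--Hamilton algebra of that degree.
\<close>

lemma frame_kernel_double:
  assumes "odd l"
  shows "frame_kernel l (L + L) = frame_kernel l L"
proof -
  have "form (L + L) f g = 2 * form L f g" for f g
    unfolding form_def
    by (simp add: sum_distrib_left algebra_simps sum.distrib)
  moreover have "[2 * x = 0] (mod int l) \<longleftrightarrow> [x = 0] (mod int l)" for x
    using assms by (simp add: cong_0_iff coprime_dvd_mult_right_iff)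
  ultimately show ?thesis
    unfolding frame_kernel_def by simp
qed

text \<open>The span over \<open>base_ring q\<close> of the \<open>M f\<close>, for \<open>f \<in> \<Phi>\<close>.\<close>

definition monomial_span ::
    "'k::idom fract alg_closure \<Rightarrow> ('k fract alg_closure \<Rightarrow> 'a::division_ring) \<Rightarrow>
     (int ^ 'n \<Rightarrow> 'a) \<Rightarrow> (int ^ 'n) set \<Rightarrow> 'a set" where
  "monomial_span q \<iota> M \<Phi> =
     {\<Sum>f\<in>S. \<iota> (c f) * M f | S c. finite S \<and> S \<subseteq> \<Phi> \<and> c ` S \<subseteq> base_ring q}"

text \<open>
  The second and third lines say that \<open>X\<^sup>f \<mapsto> M f\<close> is a homomorphism from the quantum torus of \<open>L\<close>,
  the fourth that it is injective, and the last that the division ring \<open>'a\<close> is the ring of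
  fractions of its image.
\<close>

definition toric_frame ::
    "'k::idom fract alg_closure \<Rightarrow> ('k fract alg_closure \<Rightarrow> 'a::division_ring) \<Rightarrow> nat \<Rightarrow>
     (int ^ 'n \<Rightarrow> 'a) \<Rightarrow> int ^ 'n ^ 'n \<Rightarrow> bool" where
  "toric_frame q \<iota> l M L \<longleftrightarrow> skew_symmetric_mod l L \<and>
     M 0 = 1 \<and>
     (\<forall>f g. M f * M g = \<iota> (q powi form L f g) * M (f + g)) \<and>
     (\<forall>S c. finite S \<and> c ` S \<subseteq> base_ring q \<and> (\<Sum>f\<in>S. \<iota> (c f) * M f) = 0 \<longrightarrow> (\<forall>f\<in>S. c f = 0)) \<and>
     has_fractions (monomial_span q \<iota> M UNIV) UNIV"


section \<open>Seeds and mutations\<close>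

type_synonym ('a, 'n) seed = "(int ^ 'n \<Rightarrow> 'a) \<times> (int ^ 'n ^ 'n)"

text \<open>
  The exchange matrix \<open>b\<^sub>i\<^sub>j\<close> with columns indexed by \<open>ex\<close> is represented by a square matrix
  whose other columns vanish.
\<close>

definition exchange_matrix :: "'n set \<Rightarrow> ('n \<Rightarrow> int) \<Rightarrow> int ^ 'n ^ 'n \<Rightarrow> bool" where
  "exchange_matrix ex d B \<longleftrightarrow> (\<forall>i. \<forall>j. j \<notin> ex \<longrightarrow> B $ i $ j = 0) \<and>
     (\<forall>j\<in>ex. d j > 0) \<and> (\<forall>i\<in>ex. \<forall>j\<in>ex. d i * B $ i $ j = - (d j * B $ j $ i))"

definition quantum_seed ::
    "'k::idom fract alg_closure \<Rightarrow> ('k fract alg_closure \<Rightarrow> 'a::division_ring) \<Rightarrow> nat \<Rightarrow>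
     'n set \<Rightarrow> ('a, 'n::finite) seed \<Rightarrow> bool" where
  "quantum_seed q \<iota> l ex \<Sigma> \<longleftrightarrow> (\<exists>L d. toric_frame q \<iota> l (fst \<Sigma>) L \<and> exchange_matrix ex d (snd \<Sigma>) \<and>
     (\<forall>i. \<forall>j\<in>ex. [(transpose L ** snd \<Sigma>) $ i $ j = (if i = j then d j else 0)] (mod int l)))"

definition mutate_matrix :: "'n \<Rightarrow> int ^ 'n ^ 'n \<Rightarrow> int ^ 'n ^ 'n" where
  "mutate_matrix k B = (\<chi> i j. if i = k \<or> j = k then - B $ i $ j
     else B $ i $ j + (\<bar>B $ i $ k\<bar> * B $ k $ j + B $ i $ k * \<bar>B $ k $ j\<bar>) div 2)"

definition pos_part :: "int ^ 'n \<Rightarrow> int ^ 'n" where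
  "pos_part c = (\<chi> i. max (c $ i) 0)"

definition neg_part :: "int ^ 'n \<Rightarrow> int ^ 'n" where
  "neg_part c = (\<chi> i. min (c $ i) 0)"

text \<open>
  The values on the standard basis and the matrix \<open>L'\<close> modulo \<open>l\<close> determine the mutated frame.
  For even \<open>l\<close> the values alone do so only up to signs.
\<close>

definition frame_mutation ::
    "'k::idom fract alg_closure \<Rightarrow> ('k fract alg_closure \<Rightarrow> 'a::division_ring) \<Rightarrow> nat \<Rightarrow>
     'n \<Rightarrow> int ^ 'n \<Rightarrow> (int ^ 'n \<Rightarrow> 'a) \<Rightarrow> (int ^ 'n \<Rightarrow> 'a) \<Rightarrow> bool" where
  "frame_mutation q \<iota> l k b M M' \<longleftrightarrow> (\<exists>L L'. toric_frame q \<iota> l M L \<and> toric_frame q \<iota> l M' L' \<and>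
     (\<forall>i. i \<noteq> k \<longrightarrow> M' (axis i 1) = M (axis i 1)) \<and>
     M' (axis k 1) = M (- axis k 1 + pos_part b) + M (- axis k 1 - neg_part b) \<and>
     (\<forall>i j. i \<noteq> k \<and> j \<noteq> k \<longrightarrow> [L' $ i $ j = L $ i $ j] (mod int l)) \<and>
     (\<forall>i. i \<noteq> k \<longrightarrow> [L' $ i $ k = form L (axis i 1) (- axis k 1 + pos_part b)] (mod int l)))"

definition seed_mutation ::
    "'k::idom fract alg_closure \<Rightarrow> ('k fract alg_closure \<Rightarrow> 'a::division_ring) \<Rightarrow> nat \<Rightarrow>
     'n \<Rightarrow> ('a, 'n::finite) seed \<Rightarrow> ('a, 'n::finite) seed \<Rightarrow> bool" where
  "seed_mutation q \<iota> l k \<Sigma> \<Sigma>' \<longleftrightarrow>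
     frame_mutation q \<iota> l k (column k (snd \<Sigma>)) (fst \<Sigma>) (fst \<Sigma>') \<and>
     snd \<Sigma>' = mutate_matrix k (snd \<Sigma>)"

definition mutation_equivalent ::
    "'k::idom fract alg_closure \<Rightarrow> ('k fract alg_closure \<Rightarrow> 'a::division_ring) \<Rightarrow> nat \<Rightarrow>
     'n set \<Rightarrow> ('a, 'n::finite) seed \<Rightarrow> ('a, 'n::finite) seed \<Rightarrow> bool" where
  "mutation_equivalent q \<iota> l ex = (\<lambda>\<Sigma> \<Sigma>'. \<exists>k\<in>ex. seed_mutation q \<iota> l k \<Sigma> \<Sigma>')\<^sup>*\<^sup>*"


section \<open>Monomial subalgebras\<close>

definition additive_submonoid :: "'a::comm_monoid_add set \<Rightarrow> bool" where
  "additive_submonoid \<Phi> \<longleftrightarrow> 0 \<in> \<Phi> \<and> (\<forall>f\<in>\<Phi>. \<forall>g\<in>\<Phi>. f + g \<in> \<Phi>)"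

definition monomial_algebra ::
    "'k::idom fract alg_closure \<Rightarrow> ('k fract alg_closure \<Rightarrow> 'a::division_ring) \<Rightarrow>
     ('a, 'n::finite) seed \<Rightarrow> (int ^ 'n) set \<Rightarrow> 'a set" where
  "monomial_algebra q \<iota> \<Sigma> \<Phi> = monomial_span q \<iota> (fst \<Sigma>) \<Phi>"

definition seed_torus ::
    "'k::idom fract alg_closure \<Rightarrow> ('k fract alg_closure \<Rightarrow> 'a::division_ring) \<Rightarrow>
     ('a, 'n::finite) seed \<Rightarrow> 'a set" where
  "seed_torus q \<iota> \<Sigma> = monomial_span q \<iota> (fst \<Sigma>) UNIV"

text \<open>
  In an algebra with trace of degree \<open>d\<close>, linearity over \<open>C\<close> forces \<open>tr c = d * c\<close> for \<open>c \<in> C\<close>.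
  With the reduced trace of a seed torus this is possible only if \<open>C\<close> is contained in the center
  of that torus.  The center of a monomial subalgebra need not be: if \<open>\<Phi>\<close> is generated by
  one basis vector, the subalgebra is commutative.
\<close>

definition group_of :: "'a::ab_group_add set \<Rightarrow> 'a set" where
  "group_of \<Phi> = {f - g | f g. f \<in> \<Phi> \<and> g \<in> \<Phi>}"

definition real_vec :: "int ^ 'n \<Rightarrow> real ^ 'n" where
  "real_vec f = (\<chi> i. real_of_int (f $ i))"

definition integrally_convex :: "(int ^ 'n) set \<Rightarrow> bool" where
  "integrally_convex \<Phi> \<longleftrightarrow> (\<forall>f\<in>\<Phi>. \<forall>g\<in>\<Phi>. \<forall>h\<in>group_of \<Phi>.
     real_vec h \<in> closed_segment (real_vec f) (real_vec g) \<longrightarrow> h \<in> \<Phi>)"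

text \<open>A ray is represented by the point in which it meets the unit sphere.\<close>

definition rays :: "(real ^ 'n) set \<Rightarrow> (real ^ 'n) set" where
  "rays V = sgn ` (V - {0})"

definition integrally_closed :: "(int ^ 'n) set \<Rightarrow> bool" where
  "integrally_closed \<Phi> \<longleftrightarrow>
     closedin (top_of_set (rays (real_vec ` group_of \<Phi>))) (rays (real_vec ` \<Phi>))"

end

theory Submission
  imports Defs "Jordan_Normal_Form.Char_Poly"
begin

text \<open>
  Let \<open>P\<close> be a subgroup that equals its own orthogonal for the form \<open>2\<Lambda>\<close>, whose kernel is \<open>K\<close>.  The
  monomials with exponents in \<open>P\<close> span a commutative subring of the torus \<open>T\<close>, over which \<open>T\<close> is free
  of rank \<open>d = [\<int>\<^sup>N : P]\<close>, and \<open>d\<^sup>2 = [\<int>\<^sup>N : K]\<close>.  Left multiplication gives matrices of size \<open>d\<close> over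
  this subring, and by independence of characters they split \<open>T\<close>.  A trace that is linear over the
  center is a multiple of the projection onto the span of the monomials with exponents in \<open>K\<close>, so
  the reduced trace is \<open>d\<close> times this projection, and the Cayley--Hamilton identity is that of
  matrices.  The projection extends to the division ring of fractions as the unique normalized
  trace that is linear over the center, hence does not depend on the frame; this makes
  the traces of two seeds agree.  A mutation changes the form by an automorphism of the lattice
  only, so it keeps the degree.

  A monomial subalgebra has a division ring of fractions, obtained by inverting central
  elements.  If an equivalent larger order \<open>R\<close> contains \<open>x\<close>, then \<open>v x\<^sup>n v'\<close> lies in the subalgebra for all
  \<open>n\<close>; its leading term shows that the leading term of \<open>x\<close> is in the subalgebra and can be subtracted.
  Subtraction ends, since the degrees in all the coordinate directions stay bounded.  Conversely, if
  \<open>u + n h \<in> \<Phi>\<close> for all \<open>n\<close>, then adjoining \<open>h\<close> to \<open>\<Phi>\<close> gives an equivalent order; this applies to each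
  \<open>h\<close> with a positive multiple in \<open>\<Phi>\<close>, and to each \<open>h\<close> whose ray is a limit of rays of \<open>\<Phi>\<close>.
\<close>

text \<open>Multiplication is twisted by \<Lambda>, while commutation, and with it the center and
  the reduced trace, depends only on 2\<Lambda>. For even \<open>l\<close> a subgroup isotropic for
  2\<Lambda> spans a commutative ring whose product may still carry signs, so it cannot be evaluated
  at points like a ring of Laurent polynomials. Hence two self-orthogonal subgroups are used: one
  for 2\<Lambda>, which splits the torus and fixes the trace, and one for \<Lambda>, whose matrices
  can be evaluated over a field. Their indices agree once the two kernels agree. The reduced trace
  is defined through any splitting by a subfield of the division ring. So besides exhibiting one,
  every splitting must be shown to have the same degree, by counting a basis, and the same trace, by
  uniqueness of traces linear over the center. The splitting field is a centralizer inside the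
  division ring, which avoids building a field of fractions. Newton polynomials divide by integers,
  which the coefficient ring may not allow; factorials are therefore cleared before
  evaluation.\<close>

text \<open>
  The coefficients \<open>e m\<close> of \<open>t adj(t - A)\<close> are polynomials in \<open>A\<close>, by the recursion that
  \<open>(t - A) adj(t - A) = \<phi>\<close> gives.  The one of index 0 vanishes, which is the Cayley--Hamilton
  theorem; the traces of the others are the coefficients of \<open>t \<phi>'\<close>, which are Newton's identities.
  Working with a matrix over a field and not with its eigenvalues avoids splitting \<open>\<phi>\<close>.
\<close>

lemma cayley_hamilton_newton:
  fixes A :: "'c::field mat"
  assumes A: "A \<in> carrier_mat n n" and char: "\<And>m. of_nat (Suc m) \<noteq> (0::'c)"
    and ij: "i < n" "j < n"
  shows "(\<Sum>m\<le>n. (-1) ^ m * newton_poly (\<lambda>s. \<Sum>a<n. (A ^\<^sub>m s) $$ (a, a)) m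
            * (A ^\<^sub>m (n - m)) $$ (i, j)) = 0"
proof -
  define CM where "CM = char_poly_matrix A"
  define \<phi> where "\<phi> = char_poly A"
  define P where "P s i j = (A ^\<^sub>m s) $$ (i, j)" for s i j
  define e where "e m i j = poly.coeff (pCons 0 (adj_mat CM $$ (i, j))) m" for m i j
  have CM: "CM \<in> carrier_mat n n" using A by (simp add: CM_def)
  have adjCM: "adj_mat CM \<in> carrier_mat n n" and prod: "CM * adj_mat CM = \<phi> \<cdot>\<^sub>m 1\<^sub>m n"
    using adj_mat[OF CM] by (simp_all add: \<phi>_def char_poly_def CM_def)
  have CMij: "CM $$ (i, k) = (if i = k then [:0, 1:] else 0) + [:- A $$ (i, k):]" if "i < n" "k < n" for i k
    using that A by (auto simp: CM_def char_poly_matrix_def)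
  have deg: "Polynomial.degree \<phi> = n" "poly.coeff \<phi> n = 1"
    using degree_monic_char_poly[OF A] by (simp_all add: \<phi>_def)
  have Psuc: "P (Suc s) i j = (\<Sum>k<n. P s i k * A $$ (k, j))" if "i < n" "j < n" for s i j
    using that A by (simp add: P_def scalar_prod_def lessThan_atLeast0 carrier_matD)
  have P0: "P 0 i j = (if i = j then 1 else 0)" if "i < n" "j < n" for i j
    using that A by (auto simp: P_def)
  have rec: "e m i j = (if i = j then poly.coeff \<phi> m else 0) + (\<Sum>k<n. A $$ (i, k) * e (Suc m) k j)"
    if ij: "i < n" "j < n" for m i j
  proof -
    have "(if i = j then \<phi> else 0) = (CM * adj_mat CM) $$ (i, j)"
      using ij by (simp add: prod)
    also have "\<dots> = (\<Sum>k<n. CM $$ (i, k) * adj_mat CM $$ (k, j))"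
      using ij CM adjCM by (simp add: scalar_prod_def lessThan_atLeast0)
    also have "\<dots> = (\<Sum>k<n. (if i = k then pCons 0 (adj_mat CM $$ (i, j)) else 0)
        - Polynomial.smult (A $$ (i, k)) (adj_mat CM $$ (k, j)))"
      using ij by (intro sum.cong refl) (auto simp: CMij algebra_simps)
    also have "\<dots> = pCons 0 (adj_mat CM $$ (i, j)) - (\<Sum>k<n. Polynomial.smult (A $$ (i, k)) (adj_mat CM $$ (k, j)))"
      using ij by (simp add: sum_subtractf)
    finally have "pCons 0 (adj_mat CM $$ (i, j)) =
        (if i = j then \<phi> else 0) + (\<Sum>k<n. Polynomial.smult (A $$ (i, k)) (adj_mat CM $$ (k, j)))"
      by simp
    then have "e m i j = poly.coeff (if i = j then \<phi> else 0) m
        + (\<Sum>k<n. A $$ (i, k) * poly.coeff (adj_mat CM $$ (k, j)) m)"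
      unfolding e_def by (simp add: coeff_sum)
    then show ?thesis by (simp add: e_def)
  qed
  have iter: "e m i j = (\<Sum>t<r. poly.coeff \<phi> (m + t) * P t i j) + (\<Sum>k<n. P r i k * e (m + r) k j)"
    if ij: "i < n" "j < n" for m i j r
  proof (induction r)
    case 0
    have "(\<Sum>k<n. P 0 i k * e (m + 0) k j) = (\<Sum>k<n. if i = k then e m i j else 0)"
      using ij by (intro sum.cong) (auto simp: P0)
    then show ?case using ij by simp
  next
    case (Suc r)
    have "(\<Sum>k<n. P r i k * e (m + r) k j)
        = (\<Sum>k<n. (if k = j then poly.coeff \<phi> (m + r) * P r i j else 0)
            + (\<Sum>s<n. P r i k * A $$ (k, s) * e (Suc (m + r)) s j))"
      using ij by (intro sum.cong refl, subst rec) (auto simp: algebra_simps sum_distrib_left)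
    also have "\<dots> = poly.coeff \<phi> (m + r) * P r i j
        + (\<Sum>k<n. \<Sum>s<n. P r i k * A $$ (k, s) * e (Suc (m + r)) s j)"
      using ij by (simp add: sum.distrib)
    also have "(\<Sum>k<n. \<Sum>s<n. P r i k * A $$ (k, s) * e (Suc (m + r)) s j)
        = (\<Sum>s<n. P (Suc r) i s * e (Suc (m + r)) s j)"
      using ij by (subst sum.swap) (simp add: Psuc sum_distrib_right)
    finally show ?case using Suc.IH by (simp add: algebra_simps)
  qed
  \<comment> \<open>\<open>R\<close> exceeds n, the degree of \<phi>, and the degree of every entry
    of the adjugate. After \<open>R\<close> unrollings of \<open>rec\<close> the remainder is 0, and
    \<open>e\<close> is a polynomial in \<open>A\<close>.\<close>
  define R where "R = Suc n + (\<Sum>(i, j)\<in>{..<n} \<times> {..<n}. Suc (Polynomial.degree (adj_mat CM $$ (i, j))))"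
  have e0: "e (m + R) k j = 0" if "k < n" "j < n" for m k j
  proof -
    have "Suc (Polynomial.degree (adj_mat CM $$ (k, j))) \<le> (\<Sum>(i, j)\<in>{..<n} \<times> {..<n}. Suc (Polynomial.degree (adj_mat CM $$ (i, j))))"
      using that by (intro order.trans[OF _ member_le_sum[of "(k, j)"]]) auto
    then have "Polynomial.degree (adj_mat CM $$ (k, j)) < m + R - 1" "m + R = Suc (m + R - 1)"
      by (auto simp: R_def)
    then show ?thesis unfolding e_def by (metis coeff_eq_0 coeff_pCons_Suc)
  qed
  have eform: "e m i j = (\<Sum>t\<le>n - m. poly.coeff \<phi> (m + t) * P t i j)" if "i < n" "j < n" "m \<le> n" for m i j
  proof -
    have "e m i j = (\<Sum>t<R. poly.coeff \<phi> (m + t) * P t i j)"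
      using iter[OF that(1,2), of m R] e0 that by simp
    also have "\<dots> = (\<Sum>t\<le>n - m. poly.coeff \<phi> (m + t) * P t i j)"
      by (rule sum.mono_neutral_right) (auto simp: R_def deg intro!: coeff_eq_0)
    finally show ?thesis .
  qed
  have tr: "of_nat m * poly.coeff \<phi> m = (\<Sum>t\<le>n - m. poly.coeff \<phi> (m + t) * (\<Sum>a<n. P t a a))" if "m \<le> n" for m
  proof -
    have "(\<Sum>a<n. e m a a) = (\<Sum>t\<le>n - m. poly.coeff \<phi> (m + t) * (\<Sum>a<n. P t a a))"
      using that by (simp add: eform sum_distrib_left) (subst sum.swap, rule refl)
    \<comment> \<open>The diagonal entries of the adjugate are the characteristic polynomials of
      principal submatrices of \<open>A\<close>, and these sum to the derivative of \<phi>.\<close>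
    moreover have "(\<Sum>a<n. e m a a) = poly.coeff (pCons 0 (pderiv \<phi>)) m"
    proof -
      have "adj_mat CM $$ (a, a) = char_poly (mat_delete A a a)" if "a < n" for a
      proof -
        have "mat_delete CM a a = char_poly_matrix (mat_delete A a a)"
          using that A unfolding CM_def char_poly_matrix_def
          by (intro eq_matI) (auto simp: mat_delete_def)
        then show ?thesis
          using that CM by (simp add: adj_mat_def cofactor_def char_poly_def)
      qed
      then have "pderiv \<phi> = (\<Sum>a<n. adj_mat CM $$ (a, a))"
        by (simp add: \<phi>_def pderiv_char_poly[OF A])
      then show ?thesis
        by (cases m) (simp_all add: e_def coeff_sum)
    qed
    ultimately show ?thesis
      by (cases m) (simp_all add: coeff_pderiv)
  qed
  have trP: "(\<Sum>a<n. P 0 a a) = of_nat n"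
    by (simp add: P0)
  define T where "T s = (\<Sum>a<n. (A ^\<^sub>m s) $$ (a, a))" for s
  have newton: "newton_poly T m = (-1) ^ m * poly.coeff \<phi> (n - m)" if "m \<le> n" for m
    using that
  proof (induction m rule: less_induct)
    case (less m)
    show ?case
    proof (cases m)
      case 0 then show ?thesis by (simp add: deg)
    next
      case (Suc i)
      have "n - (n - m) = Suc i" using less.prems Suc by simp
      then have "of_nat (n - m) * poly.coeff \<phi> (n - m) = (\<Sum>t\<le>Suc i. poly.coeff \<phi> (n - m + t) * T t)"
        using tr[of "n - m"] by (simp only: T_def P_def diff_le_self)
      also have "\<dots> = poly.coeff \<phi> (n - m + 0) * T 0 + (\<Sum>t\<le>i. poly.coeff \<phi> (n - m + Suc t) * T (Suc t))"
        by (simp only: sum.atMost_Suc_shift)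
      also have "T 0 = of_nat n" using trP by (simp only: P_def T_def)
      finally have "of_nat (n - m) * poly.coeff \<phi> (n - m)
          = of_nat n * poly.coeff \<phi> (n - m) + (\<Sum>t\<le>i. poly.coeff \<phi> (n - m + Suc t) * T (Suc t))"
        by simp
      \<comment> \<open>The summand for t = 0 brings n copies of the coefficient and the left side
        has n - m of them; the surplus m is the denominator in Newton's recursion.\<close>
      moreover have "of_nat n = of_nat (n - m) + (of_nat m :: 'c)"
        using less.prems by (simp add: of_nat_diff)
      ultimately have "of_nat m * poly.coeff \<phi> (n - m) + (\<Sum>t\<le>i. poly.coeff \<phi> (n - m + Suc t) * T (Suc t)) = 0"
        by (simp only: distrib_right add.assoc add_cancel_right_right)
      then have "- of_nat (Suc i) * poly.coeff \<phi> (n - m) = (\<Sum>t\<le>i. poly.coeff \<phi> (n - m + Suc t) * T (Suc t))"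
        by (simp only: Suc mult_minus_left neg_eq_iff_add_eq_0)
      moreover have "newton_poly T m = (\<Sum>t\<le>i. (-1) ^ i * (poly.coeff \<phi> (n - m + Suc t) * T (Suc t))) / of_nat (Suc i)"
      proof -
        have "(-1) ^ t * newton_poly T (i - t) * T (Suc t)
           = (-1) ^ i * (poly.coeff \<phi> (n - m + Suc t) * T (Suc t))" if "t \<le> i" for t
        proof -
          have "n - (i - t) = n - m + Suc t" using that less.prems Suc by auto
          then have "newton_poly T (i - t) = (-1) ^ (i - t) * poly.coeff \<phi> (n - m + Suc t)"
            using less.IH[of "i - t"] less.prems that Suc by simp
          moreover have "(-1 :: 'c) ^ t * (-1) ^ (i - t) = (-1) ^ i"
            using that by (simp flip: power_add)
          ultimately show ?thesis by (simp add: algebra_simps)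
        qed
        note st = this
        have "(\<Sum>t\<le>i. (-1) ^ t * newton_poly T (i - t) * T (Suc t))
            = (\<Sum>t\<le>i. (-1) ^ i * (poly.coeff \<phi> (n - m + Suc t) * T (Suc t)))"
          by (intro sum.cong refl st) simp
        then show ?thesis by (simp only: Suc newton_poly.simps)
      qed
      ultimately have "newton_poly T m = (-1) ^ i * (- of_nat (Suc i) * poly.coeff \<phi> (n - m)) / of_nat (Suc i)"
        by (simp add: sum_distrib_left)
      then show ?thesis using char[of i] unfolding Suc by (simp del: of_nat_Suc)
    qed
  qed
  have "(\<Sum>m\<le>n. (-1) ^ m * newton_poly T m * P (n - m) i j) = (\<Sum>m\<le>n. poly.coeff \<phi> (n - m) * P (n - m) i j)"
    by (intro sum.cong refl) (simp add: newton flip: power_add mult.assoc)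
  also have "\<dots> = (\<Sum>m\<le>n. poly.coeff \<phi> m * P m i j)"
    by (rule sum.reindex_bij_witness[of _ "\<lambda>m. n - m" "\<lambda>m. n - m"]) auto
  \<comment> \<open>The sum is the coefficient of index 0 of t adj(t - A), which has no constant
    term.\<close>
  also have "\<dots> = 0"
    using eform[OF ij, of 0] by (simp add: e_def)
  finally show ?thesis by (simp add: T_def[abs_def] P_def)
qed

no_notation vec_index (infixl "$" 100)

section \<open>Subrings and linear algebra over a sub-division ring\<close>

context
  fixes R :: "'a::ring_1 set"
  assumes R: "unital_subring R"
begin

lemma unital_subring_1: "1 \<in> R" and unital_subring_diff: "x \<in> R \<Longrightarrow> y \<in> R \<Longrightarrow> x - y \<in> R"
  and unital_subring_mult: "x \<in> R \<Longrightarrow> y \<in> R \<Longrightarrow> x * y \<in> R"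
  using R by (auto simp: unital_subring_def)

lemma unital_subring_0: "0 \<in> R"
  using unital_subring_diff[OF unital_subring_1 unital_subring_1] by simp

lemma unital_subring_uminus: "x \<in> R \<Longrightarrow> - x \<in> R"
  using unital_subring_diff[OF unital_subring_0] by simp

lemma unital_subring_add: "x \<in> R \<Longrightarrow> y \<in> R \<Longrightarrow> x + y \<in> R"
  using unital_subring_diff[OF _ unital_subring_uminus] by fastforce

lemma unital_subring_sum: "(\<And>i. i \<in> I \<Longrightarrow> f i \<in> R) \<Longrightarrow> sum f I \<in> R"
  by (induction I rule: infinite_finite_induct) (auto intro: unital_subring_0 unital_subring_add)

lemma unital_subring_power: "x \<in> R \<Longrightarrow> x ^ n \<in> R"
  by (induction n) (auto intro: unital_subring_1 unital_subring_mult)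

lemma unital_subring_of_nat: "of_nat n \<in> R"
  by (induction n) (auto intro: unital_subring_0 unital_subring_1 unital_subring_add)

end

text \<open>Gaussian elimination, by induction on the equations. Coefficients may fail to commute
  and the unknowns multiply from the left, so the multiple of the pivot row \<open>g\<close>
  subtracted from row \<open>f\<close> has the left factor
  \<open>a f e * inverse (a g e)\<close>.\<close>

lemma underdetermined_system:
  fixes a :: "'f \<Rightarrow> 'e \<Rightarrow> 'a::division_ring"
  assumes D: "unital_subring D" "\<And>x. x \<in> D \<Longrightarrow> inverse x \<in> D"
    and "finite E" "finite F" "card E < card F" "\<And>f e. f \<in> F \<Longrightarrow> e \<in> E \<Longrightarrow> a f e \<in> D"
  shows "\<exists>c. c ` F \<subseteq> D \<and> (\<exists>f\<in>F. c f \<noteq> 0) \<and> (\<forall>e\<in>E. (\<Sum>f\<in>F. c f * a f e) = 0)"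
  using assms(3-)
proof (induction E arbitrary: F a rule: finite_induct)
  case empty
  then obtain f where "f \<in> F" by fastforce
  then show ?case
    by (intro exI[of _ "\<lambda>_. 1"]) (auto intro: unital_subring_1[OF D(1)])
next
  case (insert e E)
  show ?case
  proof (cases "\<forall>f\<in>F. a f e = 0")
    case True
    have "card E < card F" using insert.prems insert.hyps by simp
    then obtain c where "c ` F \<subseteq> D" "\<exists>f\<in>F. c f \<noteq> 0" "\<forall>e\<in>E. (\<Sum>f\<in>F. c f * a f e) = 0"
      using insert.IH[of F a] insert.prems by auto
    then show ?thesis using True by (intro exI[of _ c]) auto
  next
    case False
    then obtain g where g: "g \<in> F" "a g e \<noteq> 0" by blast
    define F' where "F' = F - {g}"
    define a' where "a' f e' = a f e' - a f e * inverse (a g e) * a g e'" for f e'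
    have F': "finite F'" "F = insert g F'" "g \<notin> F'" using g insert.prems by (auto simp: F'_def)
    have "card E < card F'" using insert.prems insert.hyps F' by auto
    moreover have "a' f e' \<in> D" if "f \<in> F'" "e' \<in> E" for f e'
      unfolding a'_def using that insert.prems F' D
      by (intro unital_subring_diff unital_subring_mult) auto
    ultimately obtain c where c: "c ` F' \<subseteq> D" "\<exists>f\<in>F'. c f \<noteq> 0" "\<forall>e'\<in>E. (\<Sum>f\<in>F'. c f * a' f e') = 0"
      using insert.IH[of F' a'] F' by blast
    \<comment> \<open>The value of the pivot unknown that solves equation \<open>e\<close>; with it
      the other equations reduce to those for \<open>a'\<close>.\<close>
    define cg where "cg = - (\<Sum>f\<in>F'. c f * a f e * inverse (a g e))"
    have "cg \<in> D" unfolding cg_def using c insert.prems F' D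
      by (intro unital_subring_uminus unital_subring_sum unital_subring_mult) auto
    moreover have "(\<Sum>f\<in>F. (c(g := cg)) f * a f e') = 0" if "e' \<in> insert e E" for e'
    proof -
      have s: "(\<Sum>f\<in>F. (c(g := cg)) f * a f e') = cg * a g e' + (\<Sum>f\<in>F'. c f * a f e')"
        unfolding F'(2) using F' by (subst sum.insert) (auto intro!: sum.cong)
      show ?thesis
      proof (cases "e' = e")
        case True
        then show ?thesis unfolding s unfolding cg_def using g
          by (simp add: sum_distrib_right mult.assoc)
      next
        case False
        then have "(\<Sum>f\<in>F'. c f * a' f e') = 0" using c that by auto
        then show ?thesis unfolding s unfolding cg_def a'_def
          by (simp add: sum_distrib_right algebra_simps sum_subtractf)
      qed
    qed
    moreover obtain f where "f \<in> F'" "c f \<noteq> 0" using c by blast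
    then have "\<exists>f\<in>F. (c(g := cg)) f \<noteq> 0" using F' by (intro bexI[of _ f]) auto
    moreover have "(c(g := cg)) ` F \<subseteq> D" using F' c(1) \<open>cg \<in> D\<close> by auto
    ultimately show ?thesis by (intro exI[of _ "c(g := cg)"] conjI ballI) blast+
  qed
qed

text \<open>A dimension bound without vector spaces: \<open>a f e\<close> are the coordinates of the
  vector \<open>f\<close> in a spanning family indexed by \<open>E\<close>, and more vectors than
  coordinates would be dependent.\<close>

lemma card_le_if_independent:
  fixes a :: "'f \<Rightarrow> 'e \<Rightarrow> 'a::division_ring"
  assumes D: "unital_subring D" "\<And>x. x \<in> D \<Longrightarrow> inverse x \<in> D"
    and fin: "finite E" "finite F" and a: "\<And>f e. f \<in> F \<Longrightarrow> e \<in> E \<Longrightarrow> a f e \<in> D"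
    and indep: "\<And>c f. c ` F \<subseteq> D \<Longrightarrow> (\<And>e. e \<in> E \<Longrightarrow> (\<Sum>f\<in>F. c f * a f e) = 0) \<Longrightarrow> f \<in> F \<Longrightarrow> c f = 0"
  shows "card F \<le> card E"
proof (rule ccontr)
  assume "\<not> ?thesis"
  then have "card E < card F" by simp
  then have "\<exists>c. c ` F \<subseteq> D \<and> (\<exists>f\<in>F. c f \<noteq> 0) \<and> (\<forall>e\<in>E. (\<Sum>f\<in>F. c f * a f e) = 0)"
    by (intro underdetermined_system D fin a)
  then obtain c f where "c ` F \<subseteq> D" "f \<in> F" "c f \<noteq> 0" "\<forall>e\<in>E. (\<Sum>f\<in>F. c f * a f e) = 0" by blast
  with indep[of c f] show False by blast
qed

text \<open>The two index sets let one argument serve both basis conditions in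
  \<open>splitting\<close>: with \<open>I\<close> and \<open>J\<close> singletons it is about
  elements of the torus, otherwise about matrices entry by entry. The set \<open>R\<close> is kept
  apart from the basis, its image under \<open>m\<close>, because independence is known for
  exponents.\<close>

lemma unique_coefficients:
  fixes h :: "'i \<Rightarrow> 'j \<Rightarrow> 'e \<Rightarrow> 'a::division_ring"
  assumes F: "unital_subring F" and m: "inj_on m R" and d: "\<And>r. r \<in> R \<Longrightarrow> d r \<in> F"
    and b: "\<And>i j. i \<in> I \<Longrightarrow> j \<in> J \<Longrightarrow> b i j = (\<Sum>r\<in>R. d r * h i j (m r))"
    and indep: "\<And>c r. c ` R \<subseteq> F \<Longrightarrow> (\<And>i j. i \<in> I \<Longrightarrow> j \<in> J \<Longrightarrow> (\<Sum>r\<in>R. c r * h i j (m r)) = 0) \<Longrightarrow>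
        r \<in> R \<Longrightarrow> c r = 0"
  shows "\<exists>!c. c \<in> m ` R \<rightarrow>\<^sub>E F \<and> (\<forall>i\<in>I. \<forall>j\<in>J. b i j = (\<Sum>e\<in>m ` R. c e * h i j e))"
proof (rule ex1I)
  let ?c = "restrict (\<lambda>e. d (inv_into R m e)) (m ` R)"
  have c: "?c \<in> m ` R \<rightarrow>\<^sub>E F" using d by (auto simp: inv_into_into)
  show "?c \<in> m ` R \<rightarrow>\<^sub>E F \<and> (\<forall>i\<in>I. \<forall>j\<in>J. b i j = (\<Sum>e\<in>m ` R. ?c e * h i j e))"
  proof (intro conjI[OF c] ballI)
    show "b i j = (\<Sum>e\<in>m ` R. ?c e * h i j e)" if "i \<in> I" "j \<in> J" for i j
      unfolding sum.reindex[OF m] b[OF that] using m by (intro sum.cong) simp_all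
  qed
  fix u assume "u \<in> m ` R \<rightarrow>\<^sub>E F \<and> (\<forall>i\<in>I. \<forall>j\<in>J. b i j = (\<Sum>e\<in>m ` R. u e * h i j e))"
  then have u: "u \<in> m ` R \<rightarrow>\<^sub>E F" "\<And>i j. i \<in> I \<Longrightarrow> j \<in> J \<Longrightarrow> b i j = (\<Sum>r\<in>R. u (m r) * h i j (m r))"
    by (simp_all add: sum.reindex[OF m])
  have "u (m r) - d r = 0" if r: "r \<in> R" for r
  proof (rule indep[OF _ _ r])
    show "(\<lambda>r. u (m r) - d r) ` R \<subseteq> F" using u(1) d by (auto intro!: unital_subring_diff[OF F])
    show "(\<Sum>r\<in>R. (u (m r) - d r) * h i j (m r)) = 0" if "i \<in> I" "j \<in> J" for i j
      using b[OF that] u(2)[OF that] by (simp add: left_diff_distrib sum_subtractf)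
  qed
  then have "u e = ?c e" if "e \<in> m ` R" for e using m that by auto
  then show "u = ?c" by (rule PiE_ext[OF u(1) c])
qed

text \<open>Dedekind's argument. Replacing x by \<open>mul y x\<close> and subtracting the relation
  times \<open>\<phi> k y\<close> removes the character \<open>k\<close>; a y that separates
  \<open>j\<close> from \<open>k\<close> then gives \<open>a j = 0\<close>. The values commute with
  each other but need not commute with the coefficients, which therefore stay on the left.\<close>

lemma characters_independent:
  fixes \<phi> :: "'i \<Rightarrow> 'g \<Rightarrow> 'a::division_ring"
  assumes "finite I"
    and G: "\<And>x y. x \<in> G \<Longrightarrow> y \<in> G \<Longrightarrow> mul x y \<in> G"
    and "\<And>i x y. i \<in> I \<Longrightarrow> x \<in> G \<Longrightarrow> y \<in> G \<Longrightarrow> \<phi> i (mul x y) = \<phi> i x * \<phi> i y"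
    and comm: "\<And>i j x y. i \<in> I \<Longrightarrow> j \<in> I \<Longrightarrow> x \<in> G \<Longrightarrow> y \<in> G \<Longrightarrow> \<phi> i x * \<phi> j y = \<phi> j y * \<phi> i x"
    and "\<And>i. i \<in> I \<Longrightarrow> \<exists>x\<in>G. \<phi> i x \<noteq> 0"
    and "\<And>i j. i \<in> I \<Longrightarrow> j \<in> I \<Longrightarrow> i \<noteq> j \<Longrightarrow> \<exists>x\<in>G. \<phi> i x \<noteq> \<phi> j x"
    and "\<And>x. x \<in> G \<Longrightarrow> (\<Sum>i\<in>I. a i * \<phi> i x) = 0"
    and "i \<in> I"
  shows "a i = 0"
  using assms(1,3-)
proof (induction I arbitrary: a i rule: finite_induct)
  case empty then show ?case by simp
next
  case (insert k I)
  have off: "a j = 0" if j: "j \<in> I" for j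
  proof -
    from j insert.hyps have "j \<noteq> k" by blast
    then obtain y where y: "y \<in> G" "\<phi> j y \<noteq> \<phi> k y" using insert.prems(4) j by blast
    define b where "b i = a i * (\<phi> i y - \<phi> k y)" for i
    have "(\<Sum>i\<in>I. b i * \<phi> i x) = 0" if x: "x \<in> G" for x
    proof -
      have "(\<Sum>i\<in>insert k I. b i * \<phi> i x) =
         (\<Sum>i\<in>insert k I. a i * \<phi> i (mul y x)) - (\<Sum>i\<in>insert k I. a i * \<phi> i x) * \<phi> k y"
        unfolding b_def sum_distrib_right sum_subtractf[symmetric]
      proof (rule sum.cong[OF refl])
        fix i assume i: "i \<in> insert k I"
        have "\<phi> i (mul y x) = \<phi> i y * \<phi> i x" "\<phi> k y * \<phi> i x = \<phi> i x * \<phi> k y"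
          using insert.prems(1)[OF i y(1) x] insert.prems(2)[of k i y x] i x y by auto
        then show "a i * (\<phi> i y - \<phi> k y) * \<phi> i x = a i * \<phi> i (mul y x) - a i * \<phi> i x * \<phi> k y"
          by (simp add: algebra_simps)
      qed
      also have "\<dots> = 0" using insert.prems(5) G x y by (simp del: sum.insert)
      finally show ?thesis using insert.hyps by (simp add: b_def)
    qed
    then have "b j = 0"
      by (intro insert.IH[of b j] insert.prems(1-4) j insertI2)
    then show ?thesis using y by (simp add: b_def)
  qed
  have "a k = 0"
  proof -
    obtain x where x: "x \<in> G" "\<phi> k x \<noteq> 0" using insert.prems(3) by blast
    have "a k * \<phi> k x = 0"
      using insert.prems(5)[OF x(1)] insert.hyps off by simp
    with x show ?thesis by simp
  qed
  with off insert.prems(6) show ?case by (elim insertE) simp_all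
qed

text \<open>If \<open>J\<close> meets every class of points that the characters cannot tell apart,
  the rows of values on \<open>J\<close> are independent. Applied with both roles exchanged, this is
  the duality of finite abelian groups in counting form.\<close>

lemma characters_card_le:
  fixes \<phi> :: "'i \<Rightarrow> 'g \<Rightarrow> 'a::division_ring"
  assumes fin: "finite I" "finite J"
    and G: "\<And>x y. x \<in> G \<Longrightarrow> y \<in> G \<Longrightarrow> mul x y \<in> G"
      "\<And>i x y. i \<in> I \<Longrightarrow> x \<in> G \<Longrightarrow> y \<in> G \<Longrightarrow> \<phi> i (mul x y) = \<phi> i x * \<phi> i y"
      "\<And>i j x y. i \<in> I \<Longrightarrow> j \<in> I \<Longrightarrow> x \<in> G \<Longrightarrow> y \<in> G \<Longrightarrow> \<phi> i x * \<phi> j y = \<phi> j y * \<phi> i x"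
      "\<And>i. i \<in> I \<Longrightarrow> \<exists>x\<in>G. \<phi> i x \<noteq> 0"
      "\<And>i j. i \<in> I \<Longrightarrow> j \<in> I \<Longrightarrow> i \<noteq> j \<Longrightarrow> \<exists>x\<in>G. \<phi> i x \<noteq> \<phi> j x"
    and J: "\<And>x. x \<in> G \<Longrightarrow> \<exists>y\<in>J. \<forall>i\<in>I. \<phi> i x = \<phi> i y"
  shows "card I \<le> card J"
proof (rule card_le_if_independent[of UNIV, OF _ _ fin(2,1)])
  fix c i assume c: "\<And>y. y \<in> J \<Longrightarrow> (\<Sum>i\<in>I. c i * \<phi> i y) = 0" and i: "i \<in> I"
  have sum: "(\<Sum>i\<in>I. c i * \<phi> i x) = 0" if x: "x \<in> G" for x
  proof -
    obtain y where "y \<in> J" "\<forall>i\<in>I. \<phi> i x = \<phi> i y" using J[OF x] by blast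
    then show ?thesis using c by simp
  qed
  show "c i = 0" by (rule characters_independent[where G = G and mul = mul and \<phi> = \<phi>]) (assumption | rule fin i sum G)+
qed (auto simp: unital_subring_def)

section \<open>The form and roots of unity\<close>

lemma form_add_left: "form L (f + f') g = form L f g + form L f' g"
  by (simp add: form_def algebra_simps sum.distrib)

lemma form_add_right: "form L f (g + g') = form L f g + form L f g'"
  by (simp add: form_def algebra_simps sum.distrib)

lemma form_0_left [simp]: "form L 0 g = 0" and form_0_right [simp]: "form L f 0 = 0"
  by (simp_all add: form_def)

lemma form_minus_left: "form L (- f) g = - form L f g" and form_minus_right: "form L f (- g) = - form L f g"
  by (simp_all add: form_def sum_negf)

lemma form_diff_left: "form L (f - f') g = form L f g - form L f' g"
  and form_diff_right: "form L f (g - g') = form L f g - form L f g'"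
  using form_add_left[of L f "- f'" g] form_add_right[of L f g "- g'"]
  by (simp_all add: form_minus_left form_minus_right)

lemma form_double: "form (L + L) f g = 2 * form L f g"
  by (simp add: form_def sum_distrib_left algebra_simps sum.distrib)

lemma form_axis: "form L (axis i 1) (axis j 1) = L $ i $ j"
proof -
  have "axis i 1 $ k * L $ k $ m * axis j 1 $ m = (if k = i then if m = j then L $ i $ j else 0 else 0)" for k m
    by (simp add: axis_def)
  then have "form L (axis i 1) (axis j 1) = (\<Sum>k\<in>UNIV. \<Sum>m\<in>UNIV. if k = i then if m = j then L $ i $ j else 0 else 0)"
    unfolding form_def by presburger
  also have "\<dots> = (\<Sum>k\<in>UNIV. if k = i then L $ i $ j else 0)"
    by (intro sum.cong refl) (auto simp: sum.delta)
  finally show ?thesis by (simp add: sum.delta)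
qed

lemma form_skew:
  assumes "skew_symmetric_mod l L"
  shows "[form L g f = - form L f g] (mod int l)"
proof -
  have "[(\<Sum>i\<in>UNIV. \<Sum>j\<in>UNIV. g $ i * L $ i $ j * f $ j) = (\<Sum>i\<in>UNIV. \<Sum>j\<in>UNIV. g $ i * (- L $ j $ i) * f $ j)] (mod int l)"
    using assms by (intro cong_sum cong_mult cong_refl) (auto simp: skew_symmetric_mod_def)
  also have "(\<Sum>i\<in>UNIV. \<Sum>j\<in>UNIV. g $ i * (- L $ j $ i) * f $ j) = - form L f g"
    unfolding form_def by (subst sum.swap) (simp add: sum_negf mult_ac)
  finally show ?thesis by (simp add: form_def)
qed

text \<open>In the expansion of \<open>f\<close> in the standard basis the diagonal terms vanish by
  the second half of \<open>skew_symmetric_mod\<close>, and the mixed terms cancel in pairs.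
  Antisymmetry by itself would give this only for twice the value.\<close>

lemma dvd_form_diag:
  fixes L :: "int ^ 'n::finite ^ 'n"
  assumes "skew_symmetric_mod l L"
  shows "int l dvd form L f f"
proof -
  have axis: "int l dvd form L (c *s axis i 1) (c *s axis i 1)" for c :: int and i
  proof -
    have "form L (c *s axis i 1) (c *s axis i 1) = c * c * form L (axis i 1) (axis i 1)"
      by (simp add: form_def sum_distrib_left mult_ac)
    then have "form L (c *s axis i 1) (c *s axis i 1) = c * c * L $ i $ i"
      by (simp add: form_axis)
    then show ?thesis using assms by (simp add: skew_symmetric_mod_def cong_0_iff)
  qed
  have "int l dvd form L (\<Sum>i\<in>S. f $ i *s axis i 1) (\<Sum>i\<in>S. f $ i *s axis i 1)" if "finite S" for S
    using that
  proof induction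
    case (insert i S)
    let ?u = "f $ i *s axis i 1" and ?v = "\<Sum>i\<in>S. f $ i *s axis i 1"
    have "int l dvd form L ?u ?v + form L ?v ?u"
      using form_skew[OF assms, of ?v ?u] by (simp add: cong_iff_dvd_diff add.commute)
    then have "int l dvd form L ?u ?u + form L ?v ?v + (form L ?u ?v + form L ?v ?u)"
      by (intro dvd_add[OF dvd_add]) (use insert.IH axis[of "f $ i" i] in auto)
    then show ?case
      using insert.hyps by (simp add: form_add_left form_add_right algebra_simps)
  qed simp
  moreover have "f = (\<Sum>i\<in>UNIV. f $ i *s axis i 1)"
    by (metis basis_expansion)
  ultimately show ?thesis by (metis finite)
qed

lemma skew_symmetric_mod_double:
  "skew_symmetric_mod l L \<Longrightarrow> skew_symmetric_mod l (L + L)"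
  unfolding skew_symmetric_mod_def using cong_add by fastforce

text \<open>Separate from \<open>quantum_torus\<close>, so that the index of a kernel can be shown
  to be a square for any form modulo \<open>l\<close>, by characters whose values are powers of
  \<open>q\<close>.\<close>

locale root_of_unity =
  fixes q :: "'c::field" and l :: nat
  assumes l_pos: "l > 0" and primitive: "primitive_root_of_unity l q"
begin

lemma q_nonzero: "q \<noteq> 0"
  using primitive l_pos by (auto simp: primitive_root_of_unity_def power_0_left split: if_splits)

lemma q_power_l: "q ^ l = 1"
  using primitive by (simp add: primitive_root_of_unity_def)

lemma q_powi_add: "q powi (a + b) = q powi a * q powi b"
  using q_nonzero by (simp add: power_int_add)

lemma q_powi_mod: "q powi a = q ^ nat (a mod int l)"
proof -
  have "q powi a = q powi (int l * (a div int l) + a mod int l)" by simp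
  also have "\<dots> = (q powi int l) powi (a div int l) * q powi (a mod int l)"
    by (simp only: q_powi_add power_int_mult)
  also have "\<dots> = q powi (a mod int l)" by (simp add: q_power_l)
  also have "\<dots> = q ^ nat (a mod int l)"
    using l_pos by (simp add: power_int_def)
  finally show ?thesis .
qed

lemma q_powi_eq_1_iff: "q powi a = 1 \<longleftrightarrow> int l dvd a"
proof
  assume "q powi a = 1"
  then have "q ^ nat (a mod int l) = 1" by (simp add: q_powi_mod)
  moreover have "nat (a mod int l) < l" using l_pos by (simp add: nat_less_iff)
  moreover have "\<not> (0 < m \<and> m < l)" if "q ^ m = 1" for m
    using primitive that by (metis primitive_root_of_unity_def)
  ultimately have "nat (a mod int l) = 0" by (metis gr0I)
  moreover have "a mod int l \<ge> 0" using l_pos by simp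
  ultimately show "int l dvd a" by (simp add: dvd_eq_mod_eq_0)
next
  assume "int l dvd a"
  then show "q powi a = 1" by (simp add: q_powi_mod)
qed

lemma q_powi_cong: "[a = b] (mod int l) \<Longrightarrow> q powi a = q powi b"
  unfolding q_powi_mod[of a] q_powi_mod[of b] by (simp add: cong_def)

lemma q_powi_eq_iff: "q powi a = q powi b \<longleftrightarrow> [a = b] (mod int l)"
proof
  assume "q powi a = q powi b"
  then have "q powi (a - b) = 1" using q_nonzero by (simp add: power_int_diff)
  then show "[a = b] (mod int l)" by (simp add: q_powi_eq_1_iff cong_iff_dvd_diff)
qed (rule q_powi_cong)

end

section \<open>Quantum tori\<close>

text \<open>The coefficient ring is any subring \<open>A\<close> containing \<open>q\<close> of a
  field of characteristic 0. The span in \<open>fractions\<close> is written out because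
  \<open>monomial_span\<close> is tied to \<open>base_ring\<close>.\<close>

locale quantum_torus = root_of_unity q l for q :: "'c::field" and l :: nat +
  fixes A :: "'c set" and \<iota> :: "'c \<Rightarrow> 'a::division_ring"
    and M :: "int ^ 'n::finite \<Rightarrow> 'a" and L :: "int ^ 'n ^ 'n"
  assumes A: "unital_subring A" and q_in: "q \<in> A"
    and char_0: "\<And>m. of_nat (Suc m) \<noteq> (0::'c)"
    and alg: "algebra_structure A \<iota>"
    and skew: "skew_symmetric_mod l L"
    and M_0: "M 0 = 1"
    and M_mult: "\<And>f g. M f * M g = \<iota> (q powi form L f g) * M (f + g)"
    and M_indep: "\<And>S c f. \<lbrakk>finite S; c ` S \<subseteq> A; (\<Sum>f\<in>S. \<iota> (c f) * M f) = 0; f \<in> S\<rbrakk> \<Longrightarrow> c f = 0"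
    and fractions: "has_fractions {\<Sum>f\<in>S. \<iota> (c f) * M f | S c. finite S \<and> S \<subseteq> UNIV \<and> c ` S \<subseteq> A} UNIV"
begin

lemmas A_closed = unital_subring_0[OF A] unital_subring_1[OF A] unital_subring_add[OF A]
  unital_subring_diff[OF A] unital_subring_mult[OF A] unital_subring_uminus[OF A]
  unital_subring_sum[OF A] unital_subring_of_nat[OF A] unital_subring_power[OF A]

lemma q_powi_in: "q powi a \<in> A"
  unfolding q_powi_mod by (intro A_closed q_in)

lemma \<iota>_1: "\<iota> 1 = 1"
  using alg unfolding algebra_structure_def by (rule conjunct1)

lemma \<iota>_add: "a \<in> A \<Longrightarrow> b \<in> A \<Longrightarrow> \<iota> (a + b) = \<iota> a + \<iota> b"
  and \<iota>_mult: "a \<in> A \<Longrightarrow> b \<in> A \<Longrightarrow> \<iota> (a * b) = \<iota> a * \<iota> b"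
  using alg unfolding algebra_structure_def by meson+

lemma \<iota>_commute: "a \<in> A \<Longrightarrow> \<iota> a * x = x * \<iota> a"
  using alg unfolding algebra_structure_def by meson

lemma \<iota>_0: "\<iota> 0 = 0"
  using \<iota>_add[of 0 0] A_closed by simp

lemma \<iota>_uminus: "a \<in> A \<Longrightarrow> \<iota> (- a) = - \<iota> a"
  using \<iota>_add[of a "- a"] A_closed \<iota>_0 by (simp add: eq_neg_iff_add_eq_0 add.commute)

lemma \<iota>_diff: "a \<in> A \<Longrightarrow> b \<in> A \<Longrightarrow> \<iota> (a - b) = \<iota> a - \<iota> b"
  using \<iota>_add[of a "- b"] \<iota>_uminus A_closed by simp

lemma \<iota>_of_nat: "\<iota> (of_nat m) = of_nat m"
  by (induction m) (simp_all add: \<iota>_0 \<iota>_1 \<iota>_add A_closed)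

lemma \<iota>_eq_0_iff: "a \<in> A \<Longrightarrow> \<iota> a = 0 \<longleftrightarrow> a = 0"
  using M_indep[of "{0}" "\<lambda>_. a" 0] by (auto simp: \<iota>_0)

lemma \<iota>_left_commute: "a \<in> A \<Longrightarrow> x * (\<iota> a * y) = \<iota> a * (x * y)"
  by (metis \<iota>_commute mult.assoc)

lemma of_nat_nonzero: "m > 0 \<Longrightarrow> of_nat m \<noteq> (0::'a)"
  using \<iota>_eq_0_iff[of "of_nat m"] char_0[of "m - 1"] A_closed by (simp add: \<iota>_of_nat)

lemma of_nat_commute: "of_nat m * (x::'a) = x * of_nat m"
  by (rule mult_of_nat_commute)

text \<open>The commutation form, see \<open>M_commute\<close>. Its kernel determines the
  center.\<close>

definition W :: "int ^ 'n ^ 'n" where "W = L + L"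

lemma form_W: "form W f g = 2 * form L f g"
  by (simp only: W_def form_double)

lemma skew_W: "skew_symmetric_mod l W"
  unfolding W_def by (rule skew_symmetric_mod_double[OF skew])

abbreviation qi :: "int \<Rightarrow> 'a" where "qi a \<equiv> \<iota> (q powi a)"

lemma qi_add: "qi (a + b) = qi a * qi b"
  by (simp add: q_powi_add \<iota>_mult q_powi_in)

lemma qi_commute: "qi a * x = x * qi a"
  by (rule \<iota>_commute[OF q_powi_in])

lemma qi_left_commute: "x * (qi a * y) = qi a * (x * y)"
  by (rule \<iota>_left_commute[OF q_powi_in])

lemma qi_nonzero: "qi a \<noteq> 0"
  using qi_add[of a "- a"] by (auto simp: \<iota>_1)

lemma qi_inj: "qi a = qi b \<longleftrightarrow> [a = b] (mod int l)"
proof -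
  have "qi a = qi b \<longleftrightarrow> q powi a - q powi b = 0"
    using \<iota>_eq_0_iff[of "q powi a - q powi b"] by (simp add: \<iota>_diff q_powi_in A_closed)
  then show ?thesis by (simp add: q_powi_eq_iff)
qed

lemma qi_cong: "[a = b] (mod int l) \<Longrightarrow> qi a = qi b"
  by (simp add: qi_inj)

lemma M_nonzero: "M f \<noteq> 0"
  using M_indep[of "{f}" "\<lambda>_. 1" f] A_closed by (auto simp: \<iota>_1)

text \<open>There is no scalar factor because \<open>form L f f\<close> is divisible by
  \<open>l\<close>.\<close>

lemma M_minus: "M (- f) = inverse (M f)"
proof -
  have "M (- f) * M f = 1"
    using qi_cong[of "form L (- f) f" 0] dvd_form_diag[OF skew, of f]
    by (simp add: M_mult form_minus_left cong_0_iff M_0 \<iota>_1)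
  then show ?thesis by (metis inverse_unique inverse_inverse_eq inverse_eq_iff_eq nonzero_inverse_inverse_eq M_nonzero)
qed

lemma M_mult_minus: "M f * M (- f) = 1" "M (- f) * M f = 1"
  using M_nonzero[of f] by (simp_all add: M_minus)

lemma M_minus_cancel: "M (- f) * (M f * x) = x" "M f * (M (- f) * x) = x"
  "x * M f * M (- f) = x" "x * M (- f) * M f = x"
  using M_nonzero[of f] by (simp_all add: M_minus mult.assoc[symmetric]) (simp_all add: mult.assoc)

lemma M_commute: "M f * M g = qi (form W f g) * (M g * M f)"
proof -
  have "[form L f g = form W f g + form L g f] (mod int l)"
    using form_skew[OF skew, of f g] by (simp add: form_W cong_iff_dvd_diff dvd_diff_commute algebra_simps)
  then have "qi (form L f g) = qi (form W f g) * qi (form L g f)"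
    by (simp add: qi_cong flip: qi_add)
  then show ?thesis by (simp add: M_mult add.commute mult.assoc)
qed

lemma M_add: "M (f + g) = qi (- form L f g) * (M f * M g)"
  by (simp add: M_mult mult.assoc[symmetric] \<iota>_1 flip: qi_add)

lemma M_conj: "M g * M f * M (- g) = qi (form W g f) * M f"
  by (simp only: M_commute[of g f] mult.assoc M_mult_minus mult_1_right)

section \<open>Coefficients of torus elements\<close>

definition good :: "(int ^ 'n \<Rightarrow> 'c) \<Rightarrow> bool" where
  "good c \<longleftrightarrow> finite {f. c f \<noteq> 0} \<and> (\<forall>f. c f \<in> A)"

definition el :: "(int ^ 'n \<Rightarrow> 'c) \<Rightarrow> 'a" where
  "el c = (\<Sum>f | c f \<noteq> 0. \<iota> (c f) * M f)"

definition sp :: "(int ^ 'n) set \<Rightarrow> 'a set" where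
  "sp Y = {el c | c. good c \<and> {f. c f \<noteq> 0} \<subseteq> Y}"

abbreviation T :: "'a set" where "T \<equiv> sp UNIV"

text \<open>Determined by \<open>el_inj\<close> for \<open>x\<close> in \<open>T\<close>,
  unspecified elsewhere.\<close>

definition coef :: "'a \<Rightarrow> int ^ 'n \<Rightarrow> 'c" where
  "coef x = (SOME c. good c \<and> x = el c)"

lemma el_sum: "finite S \<Longrightarrow> {f. c f \<noteq> 0} \<subseteq> S \<Longrightarrow> el c = (\<Sum>f\<in>S. \<iota> (c f) * M f)"
  unfolding el_def by (rule sum.mono_neutral_left) (auto simp: \<iota>_0)

lemma good_add: "good c \<Longrightarrow> good d \<Longrightarrow> good (\<lambda>f. c f + d f)"
  unfolding good_def using A_closed
  by (auto intro: finite_subset[of _ "{f. c f \<noteq> 0} \<union> {f. d f \<noteq> 0}"])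

lemma good_uminus: "good c \<Longrightarrow> good (\<lambda>f. - c f)"
  unfolding good_def using A_closed by auto

lemma el_add:
  assumes "good c" "good d"
  shows "el (\<lambda>f. c f + d f) = el c + el d"
proof -
  let ?S = "{f. c f \<noteq> 0} \<union> {f. d f \<noteq> 0}"
  have S: "finite ?S" using assms by (simp add: good_def)
  have "el (\<lambda>f. c f + d f) = (\<Sum>f\<in>?S. \<iota> (c f + d f) * M f)"
    by (rule el_sum[OF S]) auto
  also have "\<dots> = (\<Sum>f\<in>?S. \<iota> (c f) * M f + \<iota> (d f) * M f)"
    using assms by (intro sum.cong) (auto simp: \<iota>_add good_def distrib_right image_subset_iff)
  also have "\<dots> = el c + el d"
    by (simp add: sum.distrib el_sum[OF S, of c] el_sum[OF S, of d])
  finally show ?thesis .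
qed

lemma el_uminus: "good c \<Longrightarrow> el (\<lambda>f. - c f) = - el c"
  unfolding el_def good_def by (auto simp: \<iota>_uminus sum_negf image_subset_iff intro!: sum.cong)

lemma el_inj:
  assumes "good c" "good d" "el c = el d"
  shows "c = d"
proof
  fix f
  let ?e = "\<lambda>f. c f + - d f"
  have g: "good ?e" using assms good_add good_uminus by blast
  have "el ?e = 0" using assms by (subst el_add) (auto simp: good_uminus el_uminus)
  then have "(\<Sum>f\<in>insert f {f. ?e f \<noteq> 0}. \<iota> (?e f) * M f) = 0"
    using g by (subst el_sum[symmetric]) (auto simp: good_def)
  then have "?e f = 0"
    using g by (intro M_indep[of "insert f {f. ?e f \<noteq> 0}" ?e f]) (auto simp: good_def)
  then show "c f = d f" by simp
qed

lemma coef_el: "good c \<Longrightarrow> coef (el c) = c"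
  unfolding coef_def by (rule some_equality) (auto dest: el_inj)

lemma el_sp: "good c \<Longrightarrow> (\<And>f. c f \<noteq> 0 \<Longrightarrow> f \<in> Y) \<Longrightarrow> el c \<in> sp Y"
  unfolding sp_def by blast

lemma coef_good: "x \<in> T \<Longrightarrow> good (coef x)" and el_coef: "x \<in> T \<Longrightarrow> el (coef x) = x"
  by (auto simp: sp_def coef_el)

lemma finite_supp: "x \<in> T \<Longrightarrow> finite {f. coef x f \<noteq> 0}" and coef_in: "x \<in> T \<Longrightarrow> coef x f \<in> A"
  using coef_good[of x] by (auto simp: good_def)

lemma sp_iff: "x \<in> sp Y \<longleftrightarrow> x \<in> T \<and> (\<forall>f. coef x f \<noteq> 0 \<longrightarrow> f \<in> Y)"
  using coef_good el_coef by (auto simp: sp_def coef_el subset_iff)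

lemma sp_mono: "Y \<subseteq> Z \<Longrightarrow> sp Y \<subseteq> sp Z"
  unfolding sp_def by blast

lemma sp_T: "x \<in> sp Y \<Longrightarrow> x \<in> T"
  unfolding sp_def by blast

lemma el_0: "el (\<lambda>_. 0) = 0" "good (\<lambda>_. 0)"
  by (auto simp: el_def good_def A_closed)

lemma coef_0 [simp]: "coef 0 f = 0"
  using coef_el[of "\<lambda>_. 0"] el_0 by simp

lemma sp_0: "0 \<in> sp Y"
  unfolding sp_def using el_0 by (auto intro!: exI[of _ "\<lambda>_. 0"])

lemma coef_eq_0_iff: "x \<in> T \<Longrightarrow> (\<forall>f. coef x f = 0) \<longleftrightarrow> x = 0"
  by (metis el_coef el_0(1) coef_0 ext)

lemma add_T: "x \<in> T \<Longrightarrow> y \<in> T \<Longrightarrow> x + y \<in> T"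
  and coef_add: "x \<in> T \<Longrightarrow> y \<in> T \<Longrightarrow> coef (x + y) f = coef x f + coef y f"
proof -
  assume xy: "x \<in> T" "y \<in> T"
  let ?c = "\<lambda>f. coef x f + coef y f"
  have "el ?c = x + y" "good ?c" using xy by (simp_all add: el_add coef_good el_coef good_add)
  then show "x + y \<in> T" "coef (x + y) f = coef x f + coef y f"
    using coef_el[of ?c] el_sp[of ?c UNIV] by simp_all
qed

lemma uminus_T: "x \<in> T \<Longrightarrow> - x \<in> T"
  and coef_uminus: "x \<in> T \<Longrightarrow> coef (- x) f = - coef x f"
proof -
  assume x: "x \<in> T"
  let ?c = "\<lambda>f. - coef x f"
  have "el ?c = - x" "good ?c" using x by (simp_all add: el_uminus coef_good el_coef good_uminus)
  then show "- x \<in> T" "coef (- x) f = - coef x f"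
    using coef_el[of ?c] el_sp[of ?c UNIV] by simp_all
qed

lemma sp_add: "x \<in> sp Y \<Longrightarrow> y \<in> sp Y \<Longrightarrow> x + y \<in> sp Y"
  using add_T[of x y] coef_add[of x y] sp_iff[of x Y] sp_iff[of y Y] sp_iff[of "x + y" Y]
  by (metis add_0)

lemma sp_uminus: "x \<in> sp Y \<Longrightarrow> - x \<in> sp Y"
  using uminus_T[of x] coef_uminus[of x] sp_iff[of x Y] sp_iff[of "- x" Y]
  by (metis neg_equal_0_iff_equal)

lemma sp_diff: "x \<in> sp Y \<Longrightarrow> y \<in> sp Y \<Longrightarrow> x - y \<in> sp Y"
  using sp_add[OF _ sp_uminus] by fastforce

lemma coef_diff: "x \<in> T \<Longrightarrow> y \<in> T \<Longrightarrow> coef (x - y) f = coef x f - coef y f"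
  using coef_add[of x "- y"] by (simp add: uminus_T coef_uminus)

lemma sp_sum: "(\<And>i. i \<in> I \<Longrightarrow> h i \<in> sp Y) \<Longrightarrow> sum h I \<in> sp Y"
  by (induction I rule: infinite_finite_induct) (auto intro: sp_0 sp_add)

lemma coef_sum: "(\<And>i. i \<in> I \<Longrightarrow> h i \<in> T) \<Longrightarrow> coef (sum h I) f = (\<Sum>i\<in>I. coef (h i) f)"
  by (induction I rule: infinite_finite_induct) (simp_all add: coef_add sp_sum)

lemma mono_T: "a \<in> A \<Longrightarrow> \<iota> a * M f \<in> T"
  and coef_mono: "a \<in> A \<Longrightarrow> coef (\<iota> a * M f) g = (if g = f then a else 0)"
proof -
  assume a: "a \<in> A"
  let ?c = "\<lambda>g. if g = f then a else 0"
  have c: "{g. ?c g \<noteq> 0} \<subseteq> {f}" by auto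
  have "el ?c = \<iota> a * M f" using el_sum[of "{f}" ?c] c by simp
  moreover have "good ?c" using a c A_closed finite_subset[OF c] by (auto simp: good_def)
  ultimately show "\<iota> a * M f \<in> T" "coef (\<iota> a * M f) g = (if g = f then a else 0)"
    using coef_el[of ?c] el_sp[of ?c UNIV] by simp_all
qed

lemma sp_mono_el: "a \<in> A \<Longrightarrow> f \<in> Y \<Longrightarrow> \<iota> a * M f \<in> sp Y"
  by (subst sp_iff) (auto simp: mono_T coef_mono split: if_splits)

lemma M_in_sp: "f \<in> Y \<Longrightarrow> M f \<in> sp Y"
  using sp_mono_el[of 1 f Y] A_closed by (simp add: \<iota>_1)

lemma coef_M: "coef (M f) g = (if g = f then 1 else 0)"
  using coef_mono[of 1 f g] A_closed by (simp add: \<iota>_1)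

lemma M_inj: "M f = M g \<Longrightarrow> f = g"
  using coef_M[of f f] coef_M[of g f] by (simp split: if_splits)

lemma \<iota>_in_sp: "a \<in> A \<Longrightarrow> 0 \<in> Y \<Longrightarrow> \<iota> a \<in> sp Y"
  using sp_mono_el[of a 0 Y] by (simp add: M_0)

text \<open>Reduces identities additive in x to monomials; products are treated by nesting it, once
  for each factor.\<close>

lemma sp_induct [consumes 1, case_names zero add mono]:
  assumes "x \<in> sp Y" "Q 0" "\<And>x y. x \<in> sp Y \<Longrightarrow> y \<in> sp Y \<Longrightarrow> Q x \<Longrightarrow> Q y \<Longrightarrow> Q (x + y)"
    "\<And>a f. a \<in> A \<Longrightarrow> f \<in> Y \<Longrightarrow> Q (\<iota> a * M f)"
  shows "Q x"
proof -
  have x: "x \<in> T" and Y: "\<And>f. coef x f \<noteq> 0 \<Longrightarrow> f \<in> Y" using assms(1) by (auto simp: sp_iff[of x Y])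
  have "(\<Sum>f\<in>S. \<iota> (coef x f) * M f) \<in> sp Y \<and> Q (\<Sum>f\<in>S. \<iota> (coef x f) * M f)"
    if "finite S" "S \<subseteq> {f. coef x f \<noteq> 0}" for S
    using that
  proof (induction S)
    case (insert f S)
    then have "\<iota> (coef x f) * M f \<in> sp Y" "Q (\<iota> (coef x f) * M f)"
      using assms(4) Y sp_mono_el coef_in[OF x] by auto
    then show ?case using insert assms(3) by (simp add: sp_add)
  qed (use assms sp_0 in auto)
  from this[OF finite_supp[OF x]] el_coef[OF x] show ?thesis by (simp add: el_def)
qed

lemma sp_eq_span: "sp Y = {\<Sum>f\<in>S. \<iota> (c f) * M f | S c. finite S \<and> S \<subseteq> Y \<and> c ` S \<subseteq> A}"
proof (intro equalityI subsetI)
  fix x assume "x \<in> sp Y"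
  then show "x \<in> {\<Sum>f\<in>S. \<iota> (c f) * M f | S c. finite S \<and> S \<subseteq> Y \<and> c ` S \<subseteq> A}"
    unfolding sp_def el_def good_def by blast
next
  fix x assume "x \<in> {\<Sum>f\<in>S. \<iota> (c f) * M f | S c. finite S \<and> S \<subseteq> Y \<and> c ` S \<subseteq> A}"
  then show "x \<in> sp Y" by (auto intro!: sp_sum sp_mono_el)
qed

lemma mono_mult:
  assumes "a \<in> A" "b \<in> A"
  shows "(\<iota> a * M f) * (\<iota> b * M g) = \<iota> (a * b * q powi form L f g) * M (f + g)"
proof -
  have "(\<iota> a * M f) * (\<iota> b * M g) = \<iota> a * (M f * (\<iota> b * M g))"
    by (simp only: mult.assoc)
  also have "\<dots> = \<iota> a * (\<iota> b * (M f * M g))"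
    by (simp only: \<iota>_left_commute[OF assms(2)])
  also have "\<dots> = \<iota> (a * b * q powi form L f g) * M (f + g)"
    using assms by (simp add: \<iota>_mult q_powi_in A_closed mult.assoc M_mult)
  finally show ?thesis .
qed

lemma sp_mult:
  assumes "x \<in> sp Y" "y \<in> sp Z" "\<And>f g. f \<in> Y \<Longrightarrow> g \<in> Z \<Longrightarrow> f + g \<in> V"
  shows "x * y \<in> sp V"
  using assms(1)
proof (induction rule: sp_induct)
  case (mono a f)
  from assms(2) show ?case
  proof (induction rule: sp_induct)
    case (mono b g)
    then show ?case using \<open>a \<in> A\<close> \<open>f \<in> Y\<close> assms(3)
      by (simp only: mono_mult) (intro sp_mono_el A_closed q_powi_in)
  qed (auto simp: distrib_left sp_0 sp_add)
qed (auto simp: distrib_right sp_0 sp_add)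

lemma T_mult: "x \<in> T \<Longrightarrow> y \<in> T \<Longrightarrow> x * y \<in> T"
  by (rule sp_mult) auto

lemma sp_subring: "additive_submonoid Y \<Longrightarrow> unital_subring (sp Y)"
  unfolding unital_subring_def additive_submonoid_def
  using M_in_sp[of 0 Y] by (auto simp: M_0 sp_diff intro: sp_mult)

lemma T_subring: "unital_subring T"
  by (rule sp_subring) (simp add: additive_submonoid_def)

text \<open>With \<open>Y = K\<close> this is the normalized trace onto the center; with
  \<open>Y\<close> a coset of an isotropic subgroup it extracts matrix entries.\<close>

definition proj :: "(int ^ 'n) set \<Rightarrow> 'a \<Rightarrow> 'a" where
  "proj Y x = el (\<lambda>f. if f \<in> Y then coef x f else 0)"

lemma proj_props:
  assumes "x \<in> T"
  shows proj_in: "proj Y x \<in> sp Y"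
    and coef_proj: "coef (proj Y x) f = (if f \<in> Y then coef x f else 0)"
proof -
  let ?c = "\<lambda>f. if f \<in> Y then coef x f else 0"
  have "good ?c" using coef_good[OF assms] A_closed
    by (auto simp: good_def intro: finite_subset[of _ "{f. coef x f \<noteq> 0}"])
  then show "proj Y x \<in> sp Y" "coef (proj Y x) f = (if f \<in> Y then coef x f else 0)"
    unfolding proj_def using coef_el[of ?c] by (auto intro!: el_sp split: if_splits)
qed

lemma T_eqI: "x \<in> T \<Longrightarrow> y \<in> T \<Longrightarrow> (\<And>f. coef x f = coef y f) \<Longrightarrow> x = y"
  by (metis el_coef ext)

lemma proj_T: "x \<in> T \<Longrightarrow> proj Y x \<in> T"
  using proj_in sp_T by blast

lemma proj_add: "x \<in> T \<Longrightarrow> y \<in> T \<Longrightarrow> proj Y (x + y) = proj Y x + proj Y y"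
  by (rule T_eqI) (auto simp: proj_T add_T coef_proj coef_add)

lemma proj_0: "proj Y 0 = 0"
  by (rule T_eqI) (auto simp: proj_T sp_0 coef_proj)

lemma proj_sum: "(\<And>i. i \<in> I \<Longrightarrow> h i \<in> T) \<Longrightarrow> proj Y (sum h I) = (\<Sum>i\<in>I. proj Y (h i))"
  by (induction I rule: infinite_finite_induct) (simp_all add: proj_0 proj_add sp_sum)

lemma proj_id: "x \<in> sp Y \<Longrightarrow> proj Y x = x"
  by (rule T_eqI) (auto simp: proj_T sp_iff[of x Y] coef_proj)

lemma proj_mono: "a \<in> A \<Longrightarrow> proj Y (\<iota> a * M f) = (if f \<in> Y then \<iota> a * M f else 0)"
  by (rule T_eqI) (auto simp: proj_T mono_T sp_0 coef_proj coef_mono)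

lemma proj_sp: "x \<in> sp Z \<Longrightarrow> proj Y x \<in> sp (Y \<inter> Z)"
  using sp_T[of x Z] sp_iff[of x Z] by (subst sp_iff) (auto simp: proj_T coef_proj split: if_splits)

text \<open>\<open>Y\<close> is stable under translation by \<open>P\<close> in both directions, so
  right multiplication by a monomial with exponent in \<open>P\<close> carries no term into
  \<open>Y\<close> or out of it.\<close>

lemma proj_mult_right:
  assumes "x \<in> T" "y \<in> sp P" and P: "\<And>f p. p \<in> P \<Longrightarrow> f + p \<in> Y \<longleftrightarrow> f \<in> Y"
  shows "proj Y (x * y) = proj Y x * y"
  using assms(1)
proof (induction rule: sp_induct)
  case (mono a f)
  from assms(2) show ?case
  proof (induction rule: sp_induct)
    case (mono b g)
    then show ?case using \<open>a \<in> A\<close> P[of g f]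
      by (simp add: proj_mono mono_mult A_closed q_powi_in)
  next
    case (add x y)
    have "\<iota> a * M f * x \<in> T" "\<iota> a * M f * y \<in> T"
      using add mono_T[OF \<open>a \<in> A\<close>] sp_T T_mult by blast+
    with add show ?case by (simp add: distrib_left proj_add)
  qed (simp add: proj_0)
next
  case (add x x')
  have "x * y \<in> T" "x' * y \<in> T" using add assms sp_T T_mult by blast+
  with add show ?case by (simp add: distrib_right proj_add)
qed (simp add: proj_0)


end

section \<open>Subgroups of finite index and isotropic subgroups\<close>

definition subgrp :: "'a::ab_group_add set \<Rightarrow> bool" where
  "subgrp H \<longleftrightarrow> 0 \<in> H \<and> (\<forall>f\<in>H. \<forall>g\<in>H. f - g \<in> H)"

text \<open>Elements of one coset give the same predicate and hence the same choice; this makes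
  \<open>rep\<close> constant on cosets.\<close>

definition rep :: "'a::ab_group_add set \<Rightarrow> 'a \<Rightarrow> 'a" where
  "rep H f = (SOME g. g - f \<in> H)"

definition index :: "'a::ab_group_add set \<Rightarrow> nat" where
  "index H = card (range (rep H))"

context
  fixes H :: "'a::ab_group_add set"
  assumes H: "subgrp H"
begin

lemma subgrp_0: "0 \<in> H"
  using H by (simp add: subgrp_def)

lemma subgrp_diff: "f \<in> H \<Longrightarrow> g \<in> H \<Longrightarrow> f - g \<in> H"
  using H by (simp add: subgrp_def)

lemma subgrp_uminus: "f \<in> H \<Longrightarrow> - f \<in> H"
  using subgrp_diff[OF subgrp_0, of f] by simp

lemma subgrp_add: "f \<in> H \<Longrightarrow> g \<in> H \<Longrightarrow> f + g \<in> H"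
  using subgrp_diff[OF _ subgrp_uminus, of f g] by simp

lemma subgrp_add_iff: "g \<in> H \<Longrightarrow> f + g \<in> H \<longleftrightarrow> f \<in> H"
  using subgrp_diff[of "f + g" g] subgrp_add[of f g] by auto

lemma rep_in: "rep H f - f \<in> H"
  unfolding rep_def by (rule someI[of _ f]) (simp add: subgrp_0)

lemma rep_eq_iff: "rep H f = rep H g \<longleftrightarrow> f - g \<in> H"
proof
  assume "rep H f = rep H g"
  then show "f - g \<in> H"
    using subgrp_diff[OF rep_in[of g] rep_in[of f]] by simp
next
  assume fg: "f - g \<in> H"
  have "h - f \<in> H \<longleftrightarrow> h - g \<in> H" for h
    using subgrp_add_iff[OF fg, of "h - f"] by simp
  then show "rep H f = rep H g" by (simp add: rep_def)
qed

lemma rep_rep: "rep H (rep H f) = rep H f"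
  by (simp add: rep_eq_iff rep_in)

lemma rep_fixed: "h \<in> range (rep H) \<Longrightarrow> rep H h = h"
  by (auto simp: rep_rep)

lemma rep_diff_eq: "h \<in> range (rep H) \<Longrightarrow> h' \<in> range (rep H) \<Longrightarrow> h - h' \<in> H \<Longrightarrow> h = h'"
  by (metis rep_eq_iff rep_fixed)

text \<open>\<open>frame_degree\<close> counts classes of a relation; elsewhere representatives are
  counted instead.\<close>

lemma card_quotient: "card ((UNIV :: 'a set) // {(f, g). f - g \<in> H}) = index H"
proof -
  let ?r = "{(f, g). f - g \<in> H}"
  have cls: "?r `` {f} = {g. rep H f = rep H g}" for f
    by (auto simp: rep_eq_iff)
  have "bij_betw (\<lambda>f. ?r `` {f}) (range (rep H)) (UNIV // ?r)"
  proof (rule bij_betw_imageI)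
    show "inj_on (\<lambda>f. ?r `` {f}) (range (rep H))"
    proof (rule inj_onI)
      fix h h' assume h: "h \<in> range (rep H)" "h' \<in> range (rep H)" "?r `` {h} = ?r `` {h'}"
      then have "rep H h = rep H h'" unfolding cls by auto
      then show "h = h'" using rep_fixed[OF h(1)] rep_fixed[OF h(2)] by simp
    qed
    show "(\<lambda>f. ?r `` {f}) ` range (rep H) = UNIV // ?r"
    proof (intro equalityI subsetI)
      fix U assume "U \<in> UNIV // ?r"
      then obtain f where "U = ?r `` {f}" by (auto simp: quotient_def)
      then have "U = ?r `` {rep H f}" unfolding cls by (simp only: rep_rep)
      then show "U \<in> (\<lambda>f. ?r `` {f}) ` range (rep H)" by blast
    qed (auto simp: quotient_def)
  qed
  then show ?thesis by (simp add: index_def bij_betw_same_card)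
qed

end

section \<open>Subgroups that contain all multiples of l\<close>

definition residue_box :: "nat \<Rightarrow> (int ^ 'n) set" where
  "residue_box l = {f. \<forall>i. 0 \<le> f $ i \<and> f $ i < int l}"

lemma finite_int_box: "finite {f :: int ^ 'n::finite. \<forall>i. a i \<le> f $ i \<and> f $ i \<le> b i}"
proof (rule finite_subset)
  show "{f :: int ^ 'n. \<forall>i. a i \<le> f $ i \<and> f $ i \<le> b i} \<subseteq> vec_lambda ` (PiE UNIV (\<lambda>i. {a i..b i}))"
  proof
    fix f :: "int ^ 'n" assume "f \<in> {f. \<forall>i. a i \<le> f $ i \<and> f $ i \<le> b i}"
    then show "f \<in> vec_lambda ` (PiE UNIV (\<lambda>i. {a i..b i}))"
      by (intro image_eqI[of _ _ "vec_nth f"]) auto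
  qed
qed (intro finite_imageI finite_PiE, simp_all)

lemma finite_residue_box: "finite (residue_box l :: (int ^ 'n::finite) set)"
  by (rule finite_subset[OF _ finite_int_box[of "\<lambda>_. 0" "\<lambda>_. int l"]]) (auto simp: residue_box_def less_imp_le)

text \<open>Ensures finite index, since every coset then meets the finite
  \<open>residue_box\<close>.\<close>

definition full :: "nat \<Rightarrow> (int ^ 'n) set \<Rightarrow> bool" where
  "full l H \<longleftrightarrow> (\<forall>f. int l *s f \<in> H)"

lemma reduce_to_box:
  fixes f :: "int ^ 'n::finite"
  assumes "l > 0" "full l H"
  obtains g where "g \<in> residue_box l" "f - g \<in> H"
proof -
  let ?g = "\<chi> i. f $ i mod int l"
  have "f - ?g = int l *s (\<chi> i. f $ i div int l)"
    by (simp add: Finite_Cartesian_Product.vec_eq_iff minus_mod_eq_mult_div)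
  then show ?thesis using assms that[of ?g] by (auto simp: residue_box_def full_def)
qed

lemma finite_range_rep:
  fixes H :: "(int ^ 'n::finite) set"
  assumes "l > 0" "subgrp H" "full l H"
  shows "finite (range (rep H))"
proof -
  have "range (rep H) \<subseteq> rep H ` residue_box l"
  proof clarify
    fix f :: "int ^ 'n"
    obtain g where "g \<in> residue_box l" "f - g \<in> H" using reduce_to_box[OF assms(1,3)] .
    then show "rep H f \<in> rep H ` residue_box l" using rep_eq_iff[OF assms(2), of f g] by auto
  qed
  then show ?thesis using finite_residue_box finite_subset by blast
qed

lemma form_scale_left: "form B (c *s f) g = c * form B f g"
  by (simp add: form_def sum_distrib_left mult_ac)

lemma form_scale_right: "form B f (c *s g) = c * form B f g"
  by (simp add: form_def sum_distrib_left mult_ac)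

lemma frame_kernel_iff: "f \<in> frame_kernel l B \<longleftrightarrow> (\<forall>g. int l dvd form B f g)"
  by (simp add: frame_kernel_def cong_0_iff)

lemma subgrp_frame_kernel: "subgrp (frame_kernel l B)"
  by (auto simp: subgrp_def frame_kernel_iff form_diff_left)

lemma full_frame_kernel: "full l (frame_kernel l B)"
  by (auto simp: full_def frame_kernel_iff form_scale_left)

lemma dvd_form_commute: "skew_symmetric_mod l B \<Longrightarrow> int l dvd form B f g \<longleftrightarrow> int l dvd form B g f"
  using form_skew[of l B f g] by (metis cong_dvd_iff dvd_minus_iff)

definition lagrangian :: "nat \<Rightarrow> int ^ 'n ^ 'n \<Rightarrow> (int ^ 'n) set \<Rightarrow> bool" where
  "lagrangian l B P \<longleftrightarrow> subgrp P \<and> (\<forall>f. f \<in> P \<longleftrightarrow> (\<forall>p\<in>P. int l dvd form B f p))"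

text \<open>Among full isotropic subgroups take one with the most points in
  \<open>residue_box\<close>. A vector orthogonal to it could be adjoined, since
  \<open>form B f f\<close> vanishes modulo \<open>l\<close>, and fullness makes the enlargement
  visible in the box.\<close>

lemma lagrangian_exists:
  fixes B :: "int ^ 'n::finite ^ 'n"
  assumes l: "l > 0" and skew: "skew_symmetric_mod l B"
  obtains P where "lagrangian l B P"
proof -
  define iso where "iso P \<longleftrightarrow> subgrp P \<and> full l P \<and> (\<forall>f\<in>P. \<forall>g\<in>P. int l dvd form B f g)" for P
  have "iso (frame_kernel l B)"
    by (simp add: iso_def subgrp_frame_kernel full_frame_kernel) (simp add: frame_kernel_iff)
  moreover have "\<forall>P. iso P \<longrightarrow> card (P \<inter> residue_box l) < Suc (card (residue_box l :: (int ^ 'n) set))"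
    by (auto intro!: card_mono finite_residue_box simp: less_Suc_eq_le)
  ultimately obtain P where P: "iso P" and max: "\<And>P'. iso P' \<Longrightarrow> card (P' \<inter> residue_box l) \<le> card (P \<inter> residue_box l)"
    using ex_has_greatest_nat[of iso _ "\<lambda>P. card (P \<inter> residue_box l)"] by metis
  have sP: "subgrp P" and fP: "full l P" and isoP: "\<And>f g. f \<in> P \<Longrightarrow> g \<in> P \<Longrightarrow> int l dvd form B f g"
    using P by (auto simp: iso_def)
  have max_iso: "f \<in> P" if f: "\<forall>p\<in>P. int l dvd form B f p" for f
  proof (rule ccontr)
    assume nf: "f \<notin> P"
    define P' where "P' = {p + n *s f | p n. p \<in> P}"
    have PP': "P \<subseteq> P'"
    proof
      fix p assume "p \<in> P"
      moreover have "p = p + 0 *s f" by simp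
      ultimately show "p \<in> P'" unfolding P'_def by blast
    qed
    have fP': "f \<in> P'"
    proof -
      have "f = 0 + 1 *s f" by simp
      then show ?thesis unfolding P'_def using subgrp_0[OF sP] by blast
    qed
    have "subgrp P'"
      unfolding subgrp_def
    proof (intro conjI ballI)
      show "0 \<in> P'" using PP' subgrp_0[OF sP] by blast
      fix g h assume "g \<in> P'" "h \<in> P'"
      then obtain p n p' n' where e: "g = p + n *s f" "p \<in> P" "h = p' + n' *s f" "p' \<in> P"
        unfolding P'_def by blast
      then have "g - h = (p - p') + (n - n') *s f"
        by (simp add: Finite_Cartesian_Product.vec_eq_iff algebra_simps)
      then show "g - h \<in> P'" unfolding P'_def using subgrp_diff[OF sP e(2,4)] by blast
    qed
    moreover have "full l P'" using fP PP' by (auto simp: full_def)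
    moreover have "int l dvd form B g h" if gh: "g \<in> P'" "h \<in> P'" for g h
    proof -
      obtain p n p' n' where e: "g = p + n *s f" "p \<in> P" "h = p' + n' *s f" "p' \<in> P"
        using gh unfolding P'_def by blast
      have "int l dvd form B p f" using f e(2) dvd_form_commute[OF skew, of p f] by metis
      moreover have "form B g h = form B p p' + n' * form B p f + n * form B f p' + n * n' * form B f f"
        unfolding e by (simp only: form_add_left form_add_right form_scale_left form_scale_right distrib_left
          add.assoc add.left_commute mult.assoc mult.left_commute)
      moreover have "int l dvd form B p p'" "int l dvd form B f p'" "int l dvd form B f f"
        using isoP[OF e(2,4)] f e(4) dvd_form_diag[OF skew, of f] by metis+
      ultimately show ?thesis by (simp only: dvd_add dvd_mult)
    qed
    ultimately have "iso P'" by (simp add: iso_def)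
    moreover have "P \<inter> residue_box l \<subset> P' \<inter> residue_box l"
    proof -
      \<comment> \<open>The representative of \<open>f\<close> in the box lies in \<open>P'\<close>
        but not in \<open>P\<close>, so the count goes up.\<close>
      obtain g where g: "g \<in> residue_box l" "f - g \<in> P" using reduce_to_box[OF l fP] .
      have "g \<in> P'" using subgrp_diff[OF \<open>subgrp P'\<close> fP', of "f - g"] g PP' by auto
      moreover have "g \<notin> P" using subgrp_add[OF sP, of "f - g" g] g nf by auto
      ultimately show ?thesis using g PP' by blast
    qed
    then have "card (P \<inter> residue_box l) < card (P' \<inter> residue_box l)"
      by (intro psubset_card_mono) (auto intro: finite_residue_box)
    ultimately show False using max[of P'] by simp
  qed
  have "lagrangian l B P" unfolding lagrangian_def using sP isoP max_iso by metis
  then show ?thesis by (rule that)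
qed

lemma lagrangian_kernel: "skew_symmetric_mod l B \<Longrightarrow> lagrangian l B P \<Longrightarrow> frame_kernel l B \<subseteq> P"
  unfolding lagrangian_def frame_kernel_iff[abs_def] by (metis frame_kernel_iff subsetI)

lemma full_mono: "full l H \<Longrightarrow> H \<subseteq> H' \<Longrightarrow> full l H'"
  by (auto simp: full_def)

context root_of_unity
begin

text \<open>As \<open>P\<close> is its own orthogonal, \<open>B\<close> pairs the lattice modulo
  \<open>P\<close> perfectly with \<open>P\<close> modulo the kernel. Independence of characters
  bounds each of the two quotients by the other, and the index of the kernel is the product of their
  sizes.\<close>

lemma index_lagrangian_aux:
  fixes B :: "int ^ 'n::finite ^ 'n"
  assumes skew: "skew_symmetric_mod l B" and P: "lagrangian l B P"
  shows "card (rep (frame_kernel l B) ` P) = index P"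
    and "index (frame_kernel l B) = index P * index P"
proof -
  define K where "K = frame_kernel l B"
  have sK: "subgrp K" and fK: "full l K" by (simp_all add: K_def subgrp_frame_kernel full_frame_kernel)
  have KP: "K \<subseteq> P" unfolding K_def by (rule lagrangian_kernel[OF skew P])
  have sP: "subgrp P" using P by (simp add: lagrangian_def)
  have iso: "int l dvd form B f g" if "f \<in> P" "g \<in> P" for f g
    using P that unfolding lagrangian_def by metis
  define R where "R = range (rep P)"
  define S where "S = rep K ` P"
  have fin: "finite R" "finite S"
    using finite_range_rep[OF l_pos sP full_mono[OF fK KP]] finite_range_rep[OF l_pos sK fK]
    by (auto simp: R_def S_def intro: finite_subset[of _ "range (rep K)"])
  have SP: "k \<in> P" if kS: "k \<in> S" for k
  proof -
    obtain p where p: "p \<in> P" "k = rep K p" using kS unfolding S_def by blast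
    then have "k - p \<in> P" using rep_in[OF sK, of p] KP by auto
    then show ?thesis using subgrp_add[OF sP _ p(1), of "k - p"] by simp
  qed
  let ?e = "\<lambda>f g. q powi form B f g"
  have e_cong: "?e f g = ?e f g'" if "int l dvd form B f (g - g')" for f g g'
    using that by (intro q_powi_cong) (simp add: cong_iff_dvd_diff form_diff_right)
  \<comment> \<open>Vectors modulo \<open>P\<close> act as characters of \<open>P\<close>. They are
    distinct because \<open>P\<close> contains everything orthogonal to it, and their values depend
    on the argument modulo \<open>K\<close> only.\<close>
  have "card R \<le> card S"
  proof (rule characters_card_le[of R S P "(+)" "?e"])
    show "\<exists>k\<in>S. \<forall>h\<in>R. ?e h p = ?e h k" if p: "p \<in> P" for p
    proof (intro bexI ballI e_cong)
      have "p - rep K p \<in> K" using subgrp_uminus[OF sK rep_in[OF sK, of p]] by simp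
      then show "int l dvd form B h (p - rep K p)" for h
        using dvd_form_commute[OF skew] by (auto simp: K_def frame_kernel_iff)
    qed (use p in \<open>simp add: S_def\<close>)
    show "\<exists>p\<in>P. ?e h p \<noteq> ?e h' p" if "h \<in> R" "h' \<in> R" "h \<noteq> h'" for h h'
    proof -
      have "h - h' \<notin> P" using rep_diff_eq[OF sP, of h h'] that unfolding R_def by blast
      then obtain p where "p \<in> P" "\<not> int l dvd form B (h - h') p" using P unfolding lagrangian_def by metis
      then show ?thesis by (intro bexI[of _ p]) (auto simp: q_powi_eq_iff cong_iff_dvd_diff form_diff_left)
    qed
  qed (use fin q_nonzero subgrp_add[OF sP] subgrp_0[OF sP] in \<open>auto simp: form_add_right q_powi_add\<close>)
  \<comment> \<open>Conversely, elements of \<open>P\<close> modulo \<open>K\<close> act as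
    characters of the whole lattice, constant on cosets of \<open>P\<close> by isotropy.\<close>
  moreover have "card S \<le> card R"
  proof (rule characters_card_le[of S R UNIV "(+)" "?e"])
    show "\<exists>k\<in>R. \<forall>h\<in>S. ?e h f = ?e h k" for f
    proof (intro bexI ballI e_cong)
      have "f - rep P f \<in> P" using subgrp_uminus[OF sP rep_in[OF sP, of f]] by simp
      then show "int l dvd form B h (f - rep P f)" if "h \<in> S" for h using iso SP that by blast
    qed (simp add: R_def)
    show "\<exists>p\<in>UNIV. ?e h p \<noteq> ?e h' p" if "h \<in> S" "h' \<in> S" "h \<noteq> h'" for h h'
    proof -
      have "h - h' \<notin> K" using rep_diff_eq[OF sK, of h h'] that unfolding S_def by blast
      then obtain p where "\<not> int l dvd form B (h - h') p" unfolding K_def frame_kernel_iff by blast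
      then show ?thesis by (intro bexI[of _ p]) (auto simp: q_powi_eq_iff cong_iff_dvd_diff form_diff_left)
    qed
  qed (use fin q_nonzero in \<open>auto simp: form_add_right q_powi_add\<close>)
  ultimately have RS: "card S = card R" by simp
  then show "card (rep (frame_kernel l B) ` P) = index P"
    by (simp add: S_def R_def K_def index_def)
  have "bij_betw (\<lambda>(h, k). rep K (h + k)) (R \<times> S) (range (rep K))"
  proof (rule bij_betw_imageI)
    show "inj_on (\<lambda>(h, k). rep K (h + k)) (R \<times> S)"
    proof (rule inj_onI, clarify)
      fix h k h' k' assume a: "h \<in> R" "k \<in> S" "h' \<in> R" "k' \<in> S" "rep K (h + k) = rep K (h' + k')"
      then have d: "(h + k) - (h' + k') \<in> K" by (simp add: rep_eq_iff[OF sK])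
      have "k' - k \<in> P" using SP a subgrp_diff[OF sP] by blast
      with d KP have "((h + k) - (h' + k')) + (k' - k) \<in> P" by (intro subgrp_add[OF sP]) auto
      then have "h = h'" using a rep_diff_eq[OF sP, of h h'] by (simp add: R_def algebra_simps)
      moreover from this d have "k = k'" using a rep_diff_eq[OF sK, of k k'] by (auto simp: S_def)
      ultimately show "h = h' \<and> k = k'" by simp
    qed
    show "(\<lambda>(h, k). rep K (h + k)) ` (R \<times> S) = range (rep K)"
    proof (intro equalityI subsetI)
      fix g assume "g \<in> range (rep K)"
      then obtain f where f: "g = rep K f" by blast
      let ?h = "rep P f" let ?p = "f - ?h"
      have "?p \<in> P" using subgrp_uminus[OF sP rep_in[OF sP, of f]] by simp
      then have "rep K ?p \<in> S" by (simp add: S_def)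
      moreover have "rep K (?h + rep K ?p) = g"
        using rep_in[OF sK, of ?p] by (simp add: f rep_eq_iff[OF sK] algebra_simps)
      moreover have "?h \<in> R" by (simp add: R_def)
      ultimately show "g \<in> (\<lambda>(h, k). rep K (h + k)) ` (R \<times> S)"
        by (intro image_eqI[of _ _ "(?h, rep K ?p)"]) auto
    qed auto
  qed
  then have "index K = card (R \<times> S)" by (simp add: index_def bij_betw_same_card)
  then show "index (frame_kernel l B) = index P * index P"
    using RS unfolding card_cartesian_product by (simp add: K_def R_def index_def)
qed

end

section \<open>Commutation in the torus and its center\<close>

context quantum_torus
begin

definition K :: "(int ^ 'n) set" where "K = frame_kernel l W"

lemma subgrp_K: "subgrp K" and full_K: "full l K"
  by (simp_all add: K_def subgrp_frame_kernel full_frame_kernel)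

lemma finite_reps_K: "finite (range (rep K))"
  by (rule finite_range_rep[OF l_pos subgrp_K full_K])

lemma K_iff: "f \<in> K \<longleftrightarrow> (\<forall>g. int l dvd form W g f)"
  unfolding K_def frame_kernel_iff using dvd_form_commute[OF skew_W] by blast

lemma qi_1_iff: "qi a = 1 \<longleftrightarrow> int l dvd a"
  using qi_inj[of a 0] by (simp add: \<iota>_1 cong_0_iff)

text \<open>Conjugation by \<open>M g\<close> is diagonal in the monomial basis; this restricts the
  exponents of every element that commutes with \<open>M g\<close>.\<close>

lemma coef_conj:
  assumes "x \<in> T"
  shows "M g * x * M (- g) \<in> T \<and> coef (M g * x * M (- g)) f = q powi form W g f * coef x f"
  using assms
proof (induction rule: sp_induct)
  case (mono a h)
  have "M g * (\<iota> a * M h) * M (- g) = \<iota> a * (M g * M h * M (- g))"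
    by (simp only: \<iota>_left_commute[OF mono(1)] mult.assoc)
  also have "\<dots> = \<iota> (a * q powi form W g h) * M h"
    unfolding M_conj using mono by (simp add: \<iota>_mult q_powi_in mult.assoc)
  finally show ?case using mono by (simp add: mono_T coef_mono A_closed q_powi_in)
next
  case (add x y)
  have "M g * (x + y) * M (- g) = M g * x * M (- g) + M g * y * M (- g)"
    by (simp add: algebra_simps)
  with add show ?case by (simp add: add_T coef_add algebra_simps)
qed (simp add: sp_0)

lemma commutes_with_M:
  assumes "x \<in> T" "M g * x = x * M g" "coef x f \<noteq> 0"
  shows "int l dvd form W g f"
proof -
  have "M g * x * M (- g) = x" using assms(2) by (simp add: M_minus_cancel)
  then have "q powi form W g f = 1" using coef_conj[OF assms(1), of g f] assms(3) by simp
  then show ?thesis by (simp add: q_powi_eq_1_iff)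
qed

lemma sp_commute:
  assumes "x \<in> sp Y" "y \<in> sp Z" and YZ: "\<And>f g. f \<in> Y \<Longrightarrow> g \<in> Z \<Longrightarrow> int l dvd form W f g"
  shows "x * y = y * x"
  using assms(1)
proof (induction rule: sp_induct)
  case (mono a f)
  from assms(2) show ?case
  proof (induction rule: sp_induct)
    case (mono b g)
    have "qi (form W f g) = 1" by (simp only: qi_1_iff YZ[OF \<open>f \<in> Y\<close> \<open>g \<in> Z\<close>])
    then have "M f * M g = M g * M f" using M_commute[of f g] by simp
    then have "\<iota> a * (\<iota> b * (M f * M g)) = \<iota> b * (\<iota> a * (M g * M f))"
      by (simp only: \<iota>_left_commute[OF \<open>b \<in> A\<close>, of "\<iota> a"])
    then show ?case
      by (simp only: mult.assoc \<iota>_left_commute[OF \<open>b \<in> A\<close>, of "M f"] \<iota>_left_commute[OF \<open>a \<in> A\<close>, of "M g"])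
  qed (simp_all add: distrib_left distrib_right)
qed (simp_all add: distrib_left distrib_right)

lemma spK_central_T: "z \<in> sp K \<Longrightarrow> x \<in> T \<Longrightarrow> z * x = x * z"
  by (erule sp_commute, assumption) (simp add: K_def frame_kernel_iff)

lemma T_fractions: "\<exists>a\<in>T. \<exists>b\<in>T. b \<noteq> 0 \<and> x = a * inverse b"
  using fractions unfolding sp_eq_span[symmetric] has_fractions_def units_in_def by blast

lemma commute_inverse:
  fixes x y :: "'b::division_ring"
  assumes "x * y = y * x" shows "x * inverse y = inverse y * x"
proof (cases "y = 0")
  case False
  have "x * inverse y = inverse y * (y * x) * inverse y"
    using False by (simp add: mult.assoc[symmetric])
  also have "\<dots> = inverse y * x"
    using False by (simp add: assms[symmetric] mult.assoc)
  finally show ?thesis .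
qed simp

text \<open>Every element of the division ring is a fraction of torus elements, and what commutes
  with a denominator commutes with its inverse.\<close>

lemma spK_central:
  assumes "z \<in> sp K"
  shows "z * x = x * z"
proof -
  obtain a b where ab: "a \<in> T" "b \<in> T" "x = a * inverse b" using T_fractions by metis
  then have "z * a = a * z" "z * inverse b = inverse b * z"
    using spK_central_T[OF assms] commute_inverse by auto
  then show ?thesis using ab by (metis mult.assoc)
qed

lemma proj_central:
  assumes z: "z \<in> sp K" and x: "x \<in> T" and Y: "\<And>f p. p \<in> K \<Longrightarrow> f + p \<in> Y \<longleftrightarrow> f \<in> Y"
  shows "proj Y (z * x) = z * proj Y x"
  unfolding spK_central[OF z] by (rule proj_mult_right[OF x z Y])

lemma center_T: "center_of T = sp K"
proof (intro equalityI subsetI)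
  fix z assume z: "z \<in> center_of T"
  then have zT: "z \<in> T" by (simp add: center_of_def)
  moreover have "f \<in> K" if "coef z f \<noteq> 0" for f
  proof -
    have "M g * z = z * M g" for g using z M_in_sp[of g UNIV] by (simp add: center_of_def)
    then show ?thesis using commutes_with_M[OF zT _ that] by (simp add: K_iff)
  qed
  ultimately show "z \<in> sp K" using sp_iff[of z K] by blast
next
  fix z assume "z \<in> sp K"
  then show "z \<in> center_of T"
    using sp_T[of z K] spK_central_T by (auto simp: center_of_def)
qed

lemma sp_Int: "sp Y \<inter> sp Z = sp (Y \<inter> Z)"
proof (intro equalityI subsetI)
  fix x assume "x \<in> sp Y \<inter> sp Z"
  then show "x \<in> sp (Y \<inter> Z)"
    using sp_iff[of x Y] sp_iff[of x Z] sp_iff[of x "Y \<inter> Z"] by blast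
next
  fix x assume "x \<in> sp (Y \<inter> Z)"
  then show "x \<in> sp Y \<inter> sp Z"
    using sp_iff[of x Y] sp_iff[of x Z] sp_iff[of x "Y \<inter> Z"] by blast
qed

end

section \<open>Central denominators for a monomial subalgebra\<close>

locale monomial_subalgebra = quantum_torus q l A \<iota> M L
  for q :: "'c::field" and l :: nat and A :: "'c set" and \<iota> :: "'c \<Rightarrow> 'a::division_ring"
    and M :: "int ^ 'n::finite \<Rightarrow> 'a" and L :: "int ^ 'n ^ 'n" +
  fixes \<Phi> :: "(int ^ 'n) set"
  assumes \<Phi>: "additive_submonoid \<Phi>"
begin

lemma \<Phi>_0: "0 \<in> \<Phi>" and \<Phi>_add: "f \<in> \<Phi> \<Longrightarrow> g \<in> \<Phi> \<Longrightarrow> f + g \<in> \<Phi>"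
  using \<Phi> by (simp_all add: additive_submonoid_def)

lemma \<Phi>_scale: "f \<in> \<Phi> \<Longrightarrow> int m *s f \<in> \<Phi>"
proof (induction m)
  case (Suc m)
  have "int (Suc m) *s f = f + int m *s f" by (simp add: Finite_Cartesian_Product.vec_eq_iff algebra_simps)
  with Suc show ?case by (simp only: \<Phi>_add)
qed (simp add: \<Phi>_0)

lemmas sp\<Phi> = sp_subring[OF \<Phi>]

text \<open>The part that is central in the whole torus; the center of \<open>sp \<Phi>\<close>
  itself may be larger.\<close>

abbreviation Z where "Z \<equiv> sp (\<Phi> \<inter> K)"

lemma Z_subring: "unital_subring Z"
  using subgrp_0[OF subgrp_K] subgrp_add[OF subgrp_K] \<Phi>
  by (intro sp_subring) (auto simp: additive_submonoid_def)

lemma Z_central: "z \<in> Z \<Longrightarrow> z * x = x * z"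
  by (rule spK_central) (use sp_mono[of "\<Phi> \<inter> K" K] in auto)

lemma Z_sub: "z \<in> Z \<Longrightarrow> z \<in> sp \<Phi>"
  using sp_mono[of "\<Phi> \<inter> K" \<Phi>] by auto

lemma Z_inverse_central: "z \<in> Z \<Longrightarrow> inverse z * x = x * inverse z"
  using commute_inverse[of x z] Z_central[of z x] by simp

definition D :: "'a set" where "D = {c * inverse d | c d. c \<in> Z \<and> d \<in> Z \<and> d \<noteq> 0}"

lemma Z_in_D: "z \<in> Z \<Longrightarrow> z \<in> D"
  unfolding D_def using unital_subring_1[OF Z_subring] by force

lemma D_central: "z \<in> D \<Longrightarrow> z * x = x * z"
proof -
  assume "z \<in> D"
  then obtain c d where cd: "z = c * inverse d" "c \<in> Z" "d \<in> Z" by (auto simp: D_def)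
  have "z * x = c * (inverse d * x)" by (simp only: cd mult.assoc)
  also have "\<dots> = (c * x) * inverse d" unfolding Z_inverse_central[OF cd(3)] by (simp only: mult.assoc)
  also have "\<dots> = x * z" unfolding Z_central[OF cd(2), of x] by (simp only: cd mult.assoc)
  finally show ?thesis .
qed

lemma D_inverse: "z \<in> D \<Longrightarrow> inverse z \<in> D"
proof -
  assume "z \<in> D"
  then obtain c d where cd: "z = c * inverse d" "c \<in> Z" "d \<in> Z" "d \<noteq> 0" by (auto simp: D_def)
  show ?thesis
  proof (cases "c = 0")
    case True
    then show ?thesis using cd Z_in_D[OF sp_0] by simp
  next
    case False
    then have "inverse z = d * inverse c" using cd by (simp add: nonzero_inverse_mult_distrib)
    then show ?thesis using cd False by (auto simp: D_def)
  qed
qed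

lemma D_subring: "unital_subring D"
  unfolding unital_subring_def
proof (intro conjI ballI)
  show "1 \<in> D" using Z_in_D[OF unital_subring_1[OF Z_subring]] .
next
  fix x y assume "x \<in> D" "y \<in> D"
  then obtain c d c' d' where cd: "x = c * inverse d" "c \<in> Z" "d \<in> Z" "d \<noteq> 0"
    "y = c' * inverse d'" "c' \<in> Z" "d' \<in> Z" "d' \<noteq> 0" by (auto simp: D_def)
  have inv: "inverse (d * d') = inverse d * inverse d'"
    using cd Z_central[OF cd(3), of d'] by (simp add: nonzero_inverse_mult_distrib)
  have "x * (d * d') = c * ((inverse d * d) * d')" by (simp only: cd(1) mult.assoc)
  moreover have "y * (d * d') = c' * ((inverse d' * d') * d)"
    by (simp only: cd(5) Z_central[OF cd(3), of d'] mult.assoc)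
  ultimately have "x * (d * d') = c * d'" "y * (d * d') = c' * d" using cd by simp_all
  then have "(x - y) * (d * d') = c * d' - c' * d" by (simp add: algebra_simps)
  then have "x - y = (c * d' - c' * d) * inverse (d * d')"
    using cd by (metis mult.assoc mult.right_neutral no_zero_divisors right_inverse)
  moreover have "c * d' - c' * d \<in> Z" "d * d' \<in> Z"
    using cd by (simp_all add: unital_subring_diff[OF Z_subring] unital_subring_mult[OF Z_subring])
  ultimately show "x - y \<in> D" unfolding D_def using cd no_zero_divisors by blast
  have "x * y = (c * c') * inverse (d * d')"
    unfolding inv cd(1,5) by (metis Z_inverse_central cd(3) mult.assoc)
  then show "x * y \<in> D" unfolding D_def using cd no_zero_divisors
    unital_subring_mult[OF Z_subring] by blast
qed

lemma common_denominator:
  assumes "finite I" "\<And>i. i \<in> I \<Longrightarrow> c i \<in> D"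
  shows "\<exists>e\<in>Z. e \<noteq> 0 \<and> (\<forall>i\<in>I. e * c i \<in> Z)"
  using assms
proof (induction I)
  case empty
  show ?case by (intro bexI[of _ 1]) (auto intro: unital_subring_1[OF Z_subring])
next
  case (insert i I)
  then obtain e where e: "e \<in> Z" "e \<noteq> 0" "\<forall>i\<in>I. e * c i \<in> Z" by auto
  obtain a d where ad: "c i = a * inverse d" "a \<in> Z" "d \<in> Z" "d \<noteq> 0"
    using insert.prems[of i] by (auto simp: D_def)
  have "d * e * c j \<in> Z" if "j \<in> I" for j
    using e that ad unital_subring_mult[OF Z_subring, of d "e * c j"] by (simp add: mult.assoc)
  moreover have "d * e * c i = e * a"
    using ad Z_central[OF ad(3)] by (simp add: mult.assoc[symmetric]) (simp add: mult.assoc)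
  then have "d * e * c i \<in> Z" using e ad unital_subring_mult[OF Z_subring] by simp
  ultimately show ?case using e ad unital_subring_mult[OF Z_subring, of d e]
    by (intro bexI[of _ "d * e"]) auto
qed

text \<open>In contrast to \<open>rep K\<close>, the representative is taken inside
  \<open>\<Phi>\<close>, so that its monomial belongs to the subalgebra.\<close>

definition rp :: "int ^ 'n \<Rightarrow> int ^ 'n" where "rp f = (SOME g. g \<in> \<Phi> \<and> g - f \<in> K)"

lemma rp: "f \<in> \<Phi> \<Longrightarrow> rp f \<in> \<Phi>" "f \<in> \<Phi> \<Longrightarrow> rp f - f \<in> K"
  unfolding rp_def using someI[of "\<lambda>g. g \<in> \<Phi> \<and> g - f \<in> K" f] subgrp_0[OF subgrp_K] by auto

lemma finite_rp: "finite (rp ` \<Phi>)"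
proof (rule inj_on_finite[of "rep K"])
  show "inj_on (rep K) (rp ` \<Phi>)"
  proof (rule inj_onI)
    fix g h assume "g \<in> rp ` \<Phi>" "h \<in> rp ` \<Phi>" "rep K g = rep K h"
    then obtain f f' where f: "f \<in> \<Phi>" "g = rp f" "f' \<in> \<Phi>" "h = rp f'" "g - h \<in> K"
      by (auto simp: rep_eq_iff[OF subgrp_K])
    have "g - h - (g - f) + (h - f') \<in> K"
      using subgrp_add[OF subgrp_K subgrp_diff[OF subgrp_K f(5) rp(2)[OF f(1)]] rp(2)[OF f(3)]] f by simp
    then have ff: "f - f' \<in> K" by simp
    have "k - f \<in> K \<longleftrightarrow> k - f' \<in> K" for k
      using subgrp_add_iff[OF subgrp_K ff, of "k - f"] by simp
    then show "g = h" unfolding f rp_def by simp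
  qed
qed (use finite_reps_K in auto)

text \<open>The difference need not lie in \<open>\<Phi>\<close>, but adding \<open>l g\<close>,
  which is in \<open>\<Phi>\<close> and in \<open>K\<close>, turns it into
  \<open>f + (l - 1) g\<close>. This displays the monomial as a fraction of elements of
  \<open>Z\<close>.\<close>

lemma M_diff_in_D:
  assumes "f \<in> \<Phi>" "g \<in> \<Phi>" "f - g \<in> K"
  shows "M (f - g) \<in> D"
proof -
  have lg: "int l *s g \<in> \<Phi> \<inter> K" using assms \<Phi>_scale full_K by (auto simp: full_def)
  have "f - g + int l *s g = f + int (l - 1) *s g"
    using l_pos by (simp add: Finite_Cartesian_Product.vec_eq_iff algebra_simps of_nat_diff)
  then have u: "f - g + int l *s g \<in> \<Phi> \<inter> K"
    using \<Phi>_add[OF assms(1) \<Phi>_scale[OF assms(2), of "l - 1"]] subgrp_add[OF subgrp_K assms(3), of "int l *s g"] lg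
    by (metis IntI IntD2)
  have "M (f - g) = M ((f - g + int l *s g) + (- (int l *s g)))" by simp
  also have "\<dots> = qi (- form L (f - g + int l *s g) (- (int l *s g))) * (M (f - g + int l *s g) * inverse (M (int l *s g)))"
    unfolding M_add M_minus ..
  also have "\<dots> = (qi (- form L (f - g + int l *s g) (- (int l *s g))) * M (f - g + int l *s g)) * inverse (M (int l *s g))"
    by (simp only: mult.assoc)
  finally show ?thesis
    using sp_mono_el[OF q_powi_in u] M_in_sp[OF lg] M_nonzero unfolding D_def by blast
qed

lemma D_span:
  assumes "x \<in> sp \<Phi>"
  shows "\<exists>d. d ` rp ` \<Phi> \<subseteq> D \<and> x = (\<Sum>r\<in>rp ` \<Phi>. d r * M r)"
  using assms
proof (induction rule: sp_induct)
  case zero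
  show ?case using Z_in_D[OF sp_0] by (intro exI[of _ "\<lambda>_. 0"]) auto
next
  case (add x y)
  then obtain d d' where "d ` rp ` \<Phi> \<subseteq> D" "x = (\<Sum>r\<in>rp ` \<Phi>. d r * M r)"
    "d' ` rp ` \<Phi> \<subseteq> D" "y = (\<Sum>r\<in>rp ` \<Phi>. d' r * M r)" by blast
  then show ?case using unital_subring_add[OF D_subring]
    by (intro exI[of _ "\<lambda>r. d r + d' r"]) (auto simp: sum.distrib distrib_right)
next
  case (mono a f)
  let ?g = "rp f"
  let ?c = "\<iota> a * qi (- form L (f - ?g) ?g) * M (f - ?g)"
  have fg: "f - ?g \<in> K" using rp(2)[OF mono(2)] subgrp_uminus[OF subgrp_K] by fastforce
  have "\<iota> a * M f = \<iota> a * M ((f - ?g) + ?g)" by simp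
  also have "\<dots> = ?c * M ?g" unfolding M_add by (simp only: mult.assoc)
  finally have eq: "\<iota> a * M f = ?c * M ?g" .
  have "?c \<in> D"
    using mono rp(1) fg \<Phi>_0 subgrp_0[OF subgrp_K]
    by (intro unital_subring_mult[OF D_subring] M_diff_in_D Z_in_D \<iota>_in_sp q_powi_in) auto
  moreover have "(\<Sum>r\<in>rp ` \<Phi>. (if r = ?g then ?c else 0) * M r) = (\<Sum>r\<in>rp ` \<Phi>. if r = ?g then ?c * M ?g else 0)"
    by (intro sum.cong) auto
  then have "(\<Sum>r\<in>rp ` \<Phi>. (if r = ?g then ?c else 0) * M r) = ?c * M ?g"
    using mono(2) finite_rp by simp
  ultimately show ?case using Z_in_D[OF sp_0] eq
    by (intro exI[of _ "\<lambda>r. if r = ?g then ?c else 0"]) auto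
qed

text \<open>Used with \<open>w\<close> the inverse of a central denominator, to pass from the
  subalgebra to its fractions. \<open>F\<close> may be larger than \<open>D\<close> because the
  denominator may come from the center of the whole torus.\<close>

lemma D_span_scaled:
  assumes x: "x \<in> sp \<Phi>" and F: "unital_subring F" "D \<subseteq> F" "w \<in> F"
  shows "\<exists>c. c ` M ` rp ` \<Phi> \<subseteq> F \<and> w * x = (\<Sum>e\<in>M ` rp ` \<Phi>. c e * e)"
proof -
  let ?R = "rp ` \<Phi>"
  obtain d where d: "d ` ?R \<subseteq> D" "x = (\<Sum>r\<in>?R. d r * M r)" using D_span[OF x] by blast
  have inj: "inj_on M ?R" using M_inj by (auto intro: inj_onI)
  let ?c = "\<lambda>e. w * d (inv_into ?R M e)"
  have "?c (M r) \<in> F" if r: "r \<in> ?R" for r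
    unfolding inv_into_f_f[OF inj r]
    by (rule unital_subring_mult[OF F(1,3) subsetD[OF F(2) subsetD[OF d(1) imageI[OF r]]]])
  moreover have "(\<Sum>e\<in>M ` ?R. ?c e * e) = (\<Sum>r\<in>?R. w * (d r * M r))"
    unfolding sum.reindex[OF inj] using inj by (intro sum.cong) (simp_all add: mult.assoc)
  ultimately show ?thesis unfolding d(2) sum_distrib_left[symmetric] by (intro exI[of _ ?c]) auto
qed

text \<open>The powers of \<open>b\<close> lie in a space of finite dimension over \<open>D\<close>,
  hence satisfy a polynomial relation with coefficients in \<open>Z\<close>. Cancelling the lowest
  power of \<open>b\<close> leaves a nonzero constant term, which is the product of \<open>b\<close>
  with a polynomial in \<open>b\<close>.\<close>

lemma central_multiple:
  assumes b: "b \<in> sp \<Phi>" "b \<noteq> 0"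
  obtains b' where "b' \<in> sp \<Phi>" "b * b' \<in> Z" "b * b' \<noteq> 0" "b' * b = b * b'"
proof -
  let ?n = "card (rp ` \<Phi>)"
  have "\<forall>i. \<exists>d. d ` rp ` \<Phi> \<subseteq> D \<and> b ^ i = (\<Sum>r\<in>rp ` \<Phi>. d r * M r)"
    using D_span unital_subring_power[OF sp\<Phi> b(1)] by blast
  then obtain d where d: "\<And>i r. r \<in> rp ` \<Phi> \<Longrightarrow> d i r \<in> D" "\<And>i. b ^ i = (\<Sum>r\<in>rp ` \<Phi>. d i r * M r)"
    by (auto simp: choice_iff image_subset_iff)
  have "\<exists>c. c ` {..?n} \<subseteq> D \<and> (\<exists>i\<in>{..?n}. c i \<noteq> 0) \<and> (\<forall>r\<in>rp ` \<Phi>. (\<Sum>i\<in>{..?n}. c i * d i r) = 0)"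
    by (rule underdetermined_system[OF D_subring D_inverse finite_rp]) (auto simp: d(1))
  then obtain c where c: "\<And>i. i \<le> ?n \<Longrightarrow> c i \<in> D" "\<exists>i\<le>?n. c i \<noteq> 0"
    "\<And>r. r \<in> rp ` \<Phi> \<Longrightarrow> (\<Sum>i\<le>?n. c i * d i r) = 0" by (auto simp: image_subset_iff)
  obtain e where e: "e \<in> Z" "e \<noteq> 0" "\<And>i. i \<le> ?n \<Longrightarrow> e * c i \<in> Z"
    using common_denominator[of "{..?n}" c] c(1) by auto
  define a where "a i = (if i \<le> ?n then e * c i else 0)" for i
  have aZ: "a i \<in> Z" for i using e by (simp add: a_def sp_0)
  have "(\<Sum>i\<le>?n. a i * b ^ i) = (\<Sum>i\<le>?n. \<Sum>r\<in>rp ` \<Phi>. e * (c i * d i r) * M r)"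
    by (intro sum.cong refl) (simp add: a_def d(2) sum_distrib_left mult.assoc)
  also have "\<dots> = (\<Sum>r\<in>rp ` \<Phi>. e * (\<Sum>i\<le>?n. c i * d i r) * M r)"
    by (subst sum.swap) (simp add: sum_distrib_left sum_distrib_right)
  also have "\<dots> = 0" using c(3) by simp
  finally have rel: "(\<Sum>i\<le>?n. a i * b ^ i) = 0" .
  define m where "m = (LEAST i. a i \<noteq> 0)"
  have ex: "\<exists>i. a i \<noteq> 0" using c(2) e by (auto simp: a_def)
  have am: "a m \<noteq> 0" and min: "\<And>i. i < m \<Longrightarrow> a i = 0"
    unfolding m_def using LeastI_ex[OF ex] not_less_Least by auto
  have mn: "m \<le> ?n" using am by (auto simp: a_def split: if_splits)
  \<comment> \<open>Minus the tail of the relation after division by \<open>b ^ Suc m\<close>, so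
    that \<open>b * b' = a m\<close>.\<close>
  define b' where "b' = (\<Sum>j<?n - m. - a (Suc (m + j)) * b ^ j)"
  have "(\<Sum>i\<le>?n. a i * b ^ i) = (\<Sum>i\<in>{m..?n}. a i * b ^ i)"
    by (rule sum.mono_neutral_right) (auto simp: min)
  also have "\<dots> = a m * b ^ m + (\<Sum>i\<in>{Suc m..?n}. a i * b ^ i)"
    using mn by (simp add: sum.atLeast_Suc_atMost)
  also have "(\<Sum>i\<in>{Suc m..?n}. a i * b ^ i) = (\<Sum>j<?n - m. a (Suc (m + j)) * b ^ (Suc (m + j)))"
    by (rule sum.reindex_bij_witness[of _ "\<lambda>j. Suc (m + j)" "\<lambda>i. i - Suc m"]) auto
  also have "\<dots> = - (b ^ m * (b * b'))"
    unfolding b'_def sum_distrib_left sum_negf[symmetric]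
  proof (rule sum.cong[OF refl])
    fix j
    have "b ^ m * (b * (a (Suc (m + j)) * b ^ j)) = a (Suc (m + j)) * (b ^ m * (b * b ^ j))"
      using Z_central[OF aZ] by (metis mult.assoc)
    moreover have "b ^ m * (b * b ^ j) = b ^ Suc (m + j)"
      by (simp add: power_add power_commutes flip: mult.assoc)
    ultimately show "a (Suc (m + j)) * b ^ Suc (m + j) = - (b ^ m * (b * (- a (Suc (m + j)) * b ^ j)))"
      by (simp del: power_Suc)
  qed
  finally have "a m * b ^ m = b ^ m * (b * b')" using rel by simp
  then have "b ^ m * (b * b') = b ^ m * a m" using Z_central[OF aZ[of m], of "b ^ m"] by (rule trans[OF sym])
  then have bb': "b * b' = a m" using b(2) by (metis mult_left_cancel power_not_zero)
  have "b' * b = inverse b * (b * b') * b" using b by (simp add: mult.assoc[symmetric])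
  also have "\<dots> = a m" unfolding bb' using Z_central[OF aZ[of m], of b] b by (simp add: mult.assoc) (simp add: mult.assoc[symmetric])
  finally have "b' * b = b * b'" using bb' by simp
  moreover have "b' \<in> sp \<Phi>" unfolding b'_def
    using Z_sub[OF aZ] b by (intro unital_subring_sum[OF sp\<Phi>] unital_subring_mult[OF sp\<Phi>]
      unital_subring_uminus[OF sp\<Phi>] unital_subring_power[OF sp\<Phi>]) auto
  ultimately show ?thesis using that[of b'] bb' aZ am by simp
qed

end

context quantum_torus
begin

text \<open>With all exponents allowed, \<open>torus.D\<close> is the field of fractions of the
  center of the torus.\<close>

sublocale torus: monomial_subalgebra q l A \<iota> M L UNIV
  by unfold_locales (simp add: additive_submonoid_def)

text \<open>Any denominator \<open>b\<close> can be replaced by its central multiple from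
  \<open>central_multiple\<close>.\<close>

lemma central_fraction:
  obtains z where "z \<in> sp K" "z \<noteq> 0" "z * x \<in> T"
proof -
  obtain a b where ab: "a \<in> T" "b \<in> T" "b \<noteq> 0" "x = a * inverse b" using T_fractions by metis
  obtain b' where b': "b' \<in> T" "b * b' \<in> sp K" "b * b' \<noteq> 0"
    using torus.central_multiple[OF ab(2,3)] by (metis Int_UNIV_left)
  have "x * (b * b') = a * b'" using ab by (simp add: mult.assoc[symmetric]) (simp add: mult.assoc)
  then have "(b * b') * x = a * b'" using spK_central[OF b'(2)] by simp
  then show ?thesis using that[of "b * b'"] b' ab T_mult by simp
qed

end

section \<open>The reduced trace\<close>

context quantum_torus
begin

lemma proj_disjoint: "x \<in> sp Y \<Longrightarrow> Y \<inter> Z = {} \<Longrightarrow> proj Z x = 0"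
  by (rule T_eqI) (auto simp: sp_0 proj_T coef_proj sp_T sp_iff[of x Y])

lemma central_fractions_T: "central_fractions T = torus.D"
  unfolding central_fractions_def torus.D_def center_T by (simp only: Int_UNIV_left)

lemma torus_rp: "torus.rp = rep K"
  unfolding torus.rp_def[abs_def] rep_def[abs_def] by simp

lemma D_span_T:
  "x \<in> T \<Longrightarrow> \<exists>d. d ` range (rep K) \<subseteq> torus.D \<and> x = (\<Sum>r\<in>range (rep K). d r * M r)"
  using torus.D_span unfolding torus_rp .

text \<open>After multiplication by a common central denominator the summands have exponents in
  different cosets of \<open>K\<close>; projection to the coset of \<open>s\<close> isolates one of
  them.\<close>

lemma reps_independent:
  assumes c: "c ` range (rep K) \<subseteq> torus.D" and zero: "(\<Sum>r\<in>range (rep K). c r * M r) = 0"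
    and s: "s \<in> range (rep K)"
  shows "c s = 0"
proof -
  have "c r \<in> torus.D" if "r \<in> range (rep K)" for r
    by (rule subsetD[OF c imageI[OF that]])
  from torus.common_denominator[OF finite_reps_K this, unfolded Int_UNIV_left]
  obtain e where e1: "e \<in> sp K" and e2: "e \<noteq> 0 \<and> (\<forall>r\<in>range (rep K). e * c r \<in> sp K)" ..
  note e = e1 conjunct1[OF e2] bspec[OF conjunct2[OF e2]]
  have mem: "e * c r * M r \<in> sp {f. f - r \<in> K}" if "r \<in> range (rep K)" for r
    by (rule sp_mult[OF e(3)[OF that] M_in_sp[of r "{r}"]]) auto
  have "0 = proj {f. f - s \<in> K} (e * (\<Sum>r\<in>range (rep K). c r * M r))"
    by (simp only: zero mult_zero_right proj_0)
  also have "\<dots> = (\<Sum>r\<in>range (rep K). proj {f. f - s \<in> K} (e * c r * M r))"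
    unfolding sum_distrib_left mult.assoc[symmetric] by (rule proj_sum) (rule sp_T[OF mem])
  also have "\<dots> = (\<Sum>r\<in>range (rep K). if r = s then e * c s * M s else 0)"
  proof (rule sum.cong[OF refl])
    fix r assume r: "r \<in> range (rep K)"
    show "proj {f. f - s \<in> K} (e * c r * M r) = (if r = s then e * c s * M s else 0)"
    proof (cases "r = s")
      case True
      then show ?thesis using proj_id[OF mem[OF s]] by simp
    next
      case False
      have "{f. f - r \<in> K} \<inter> {f. f - s \<in> K} = {}"
      proof (rule equals0I)
        fix f assume "f \<in> {f. f - r \<in> K} \<inter> {f. f - s \<in> K}"
        then have "(f - s) - (f - r) \<in> K" using subgrp_diff[OF subgrp_K, of "f - s" "f - r"] by blast
        then show False using rep_diff_eq[OF subgrp_K r s] False by simp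
      qed
      then show ?thesis using proj_disjoint[OF mem[OF r]] False by simp
    qed
  qed
  also have "\<dots> = e * c s * M s" using s finite_reps_K by simp
  finally show ?thesis using e(2) M_nonzero[of s] by simp
qed

text \<open>The basis in a splitting is arbitrary. Expanding it in the monomials of coset
  representatives, and conversely, bounds its size from both sides.\<close>

lemma basis_card:
  assumes E: "finite E" "E \<subseteq> T"
    and ex: "\<And>r. r \<in> T \<Longrightarrow> \<exists>!c. c \<in> E \<rightarrow>\<^sub>E torus.D \<and> r = (\<Sum>e\<in>E. c e * e)"
  shows "card E = index K"
proof (rule antisym)
  let ?R = "range (rep K)"
  note D = torus.D_subring torus.D_inverse
  have D0: "0 \<in> torus.D" by (rule unital_subring_0[OF D(1)])
  have "\<forall>e\<in>E. \<exists>d. d ` ?R \<subseteq> torus.D \<and> e = (\<Sum>r\<in>?R. d r * M r)"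
    using E D_span_T by blast
  from bchoice[OF this] obtain d where d': "\<forall>e\<in>E. d e ` ?R \<subseteq> torus.D \<and> e = (\<Sum>r\<in>?R. d e r * M r)" ..
  note d = bspec[OF d', THEN conjunct1] bspec[OF d', THEN conjunct2]
  show "card E \<le> index K"
    unfolding index_def
  proof (rule card_le_if_independent[OF D finite_reps_K E(1)])
    show "d e r \<in> torus.D" if "e \<in> E" "r \<in> ?R" for e r by (rule subsetD[OF d(1)[OF that(1)] imageI[OF that(2)]])
    fix c e0 assume c: "c ` E \<subseteq> torus.D" "\<And>r. r \<in> ?R \<Longrightarrow> (\<Sum>e\<in>E. c e * d e r) = 0" "e0 \<in> E"
    have "(\<Sum>e\<in>E. c e * e) = (\<Sum>e\<in>E. \<Sum>r\<in>?R. c e * d e r * M r)"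
      by (rule sum.cong[OF refl], subst d(2)) (simp_all add: sum_distrib_left mult.assoc)
    also have "\<dots> = (\<Sum>r\<in>?R. (\<Sum>e\<in>E. c e * d e r) * M r)"
      by (subst sum.swap) (simp add: sum_distrib_right)
    also have "\<dots> = 0" by (rule sum.neutral) (simp add: c(2))
    finally have "(\<Sum>e\<in>E. restrict c E e * e) = 0" by simp
    moreover have "restrict c E \<in> E \<rightarrow>\<^sub>E torus.D" using c(1) by auto
    moreover have "restrict (\<lambda>_. 0) E \<in> E \<rightarrow>\<^sub>E torus.D" using D0 by auto
    moreover have "(\<Sum>e\<in>E. restrict (\<lambda>_. 0) E e * e) = 0" by simp
    ultimately have "restrict c E = restrict (\<lambda>_. 0) E" using ex[OF sp_0] by metis
    then show "c e0 = 0" using c(3) by (metis restrict_apply')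
  qed
  have "\<forall>r\<in>?R. \<exists>d. d \<in> E \<rightarrow>\<^sub>E torus.D \<and> M r = (\<Sum>e\<in>E. d e * e)"
    using ex M_in_sp[of _ UNIV] by blast
  from bchoice[OF this] obtain u where u': "\<forall>r\<in>?R. u r \<in> E \<rightarrow>\<^sub>E torus.D \<and> M r = (\<Sum>e\<in>E. u r e * e)" ..
  note u = bspec[OF u', THEN conjunct1] bspec[OF u', THEN conjunct2]
  show "index K \<le> card E"
    unfolding index_def
  proof (rule card_le_if_independent[OF D E(1) finite_reps_K])
    show "u r e \<in> torus.D" if "r \<in> ?R" "e \<in> E" for r e by (rule PiE_mem[OF u(1)[OF that(1)] that(2)])
    fix c r0 assume c: "c ` ?R \<subseteq> torus.D" "\<And>e. e \<in> E \<Longrightarrow> (\<Sum>r\<in>?R. c r * u r e) = 0" "r0 \<in> ?R"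
    have "(\<Sum>r\<in>?R. c r * M r) = (\<Sum>r\<in>?R. \<Sum>e\<in>E. c r * u r e * e)"
      by (rule sum.cong[OF refl]) (simp add: u(2) sum_distrib_left mult.assoc)
    also have "\<dots> = (\<Sum>e\<in>E. (\<Sum>r\<in>?R. c r * u r e) * e)"
      by (subst sum.swap) (simp add: sum_distrib_right)
    also have "\<dots> = 0" by (rule sum.neutral) (simp add: c(2))
    finally show "c r0 = 0" by (rule reps_independent[OF c(1) _ c(3)])
  qed
qed

end

text \<open>The same comparison, now with the matrix units. Together with \<open>basis_card\<close>
  it determines the degree of every splitting.\<close>

lemma matrix_basis_card:
  fixes \<rho> :: "'b \<Rightarrow> nat \<Rightarrow> nat \<Rightarrow> 'a::division_ring"
  assumes F: "unital_subring F" "\<And>x. x \<in> F \<Longrightarrow> inverse x \<in> F"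
    and E: "finite E" "\<And>e i j. e \<in> E \<Longrightarrow> i < d \<Longrightarrow> j < d \<Longrightarrow> \<rho> e i j \<in> F"
    and ex: "\<And>A. (\<And>i j. i < d \<Longrightarrow> j < d \<Longrightarrow> A i j \<in> F) \<Longrightarrow>
        \<exists>!c. c \<in> E \<rightarrow>\<^sub>E F \<and> (\<forall>i<d. \<forall>j<d. A i j = (\<Sum>e\<in>E. c e * \<rho> e i j))"
  shows "card E = d * d"
proof (rule antisym)
  let ?R = "{..<d} \<times> {..<d}"
  have F0: "0 \<in> F" "1 \<in> F" using unital_subring_0[OF F(1)] unital_subring_1[OF F(1)] .
  have cR: "card ?R = d * d" "finite ?R" by (simp_all only: card_cartesian_product card_lessThan) simp
  show "card E \<le> d * d"
    unfolding cR(1)[symmetric]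
  proof (rule card_le_if_independent[OF F cR(2) E(1)])
    show "(case p of (i, j) \<Rightarrow> \<rho> e i j) \<in> F" if "e \<in> E" "p \<in> ?R" for e p using that E(2) by auto
    fix c e0 assume c: "c ` E \<subseteq> F" "\<And>p. p \<in> ?R \<Longrightarrow> (\<Sum>e\<in>E. c e * (case p of (i, j) \<Rightarrow> \<rho> e i j)) = 0" "e0 \<in> E"
    have "\<forall>i<d. \<forall>j<d. 0 = (\<Sum>e\<in>E. restrict c E e * \<rho> e i j)"
      using c(2)[of "(_, _)"] by simp
    moreover have "restrict c E \<in> E \<rightarrow>\<^sub>E F" using c(1) by auto
    moreover have "restrict (\<lambda>_. 0) E \<in> E \<rightarrow>\<^sub>E F" using F0 by auto
    moreover have "\<forall>i<d. \<forall>j<d. 0 = (\<Sum>e\<in>E. restrict (\<lambda>_. 0) E e * \<rho> e i j)" by simp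
    ultimately have "restrict c E = restrict (\<lambda>_. 0) E" using ex[of "\<lambda>_ _. 0"] F0 by metis
    then show "c e0 = 0" using c(3) by (metis restrict_apply')
  qed
  have "\<forall>p\<in>?R. \<exists>c. c \<in> E \<rightarrow>\<^sub>E F \<and> (\<forall>i<d. \<forall>j<d. (if (i, j) = p then 1 else 0) = (\<Sum>e\<in>E. c e * \<rho> e i j))"
    using ex[of "\<lambda>i j. if (i, j) = _ then 1 else 0"] F0 by (metis (full_types))
  from bchoice[OF this] obtain u where u': "\<forall>p\<in>?R. u p \<in> E \<rightarrow>\<^sub>E F \<and>
      (\<forall>i<d. \<forall>j<d. (if (i, j) = p then 1 else 0) = (\<Sum>e\<in>E. u p e * \<rho> e i j))" ..
  note u = bspec[OF u', THEN conjunct1] bspec[OF u', THEN conjunct2, rule_format]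
  show "d * d \<le> card E"
    unfolding cR(1)[symmetric]
  proof (rule card_le_if_independent[OF F E(1) cR(2)])
    show "u p e \<in> F" if "p \<in> ?R" "e \<in> E" for p e by (rule PiE_mem[OF u(1)[OF that(1)] that(2)])
    fix c p assume c: "\<And>e. e \<in> E \<Longrightarrow> (\<Sum>r\<in>?R. c r * u r e) = 0" and p: "p \<in> ?R"
    obtain i j where ij: "p = (i, j)" "i < d" "j < d" using p by blast
    have "c p = (\<Sum>r\<in>?R. if r = p then c p else 0)" using p cR(2) by simp
    also have "\<dots> = (\<Sum>r\<in>?R. c r * (if (i, j) = r then 1 else 0))"
      by (intro sum.cong) (auto simp: ij(1))
    also have "\<dots> = (\<Sum>r\<in>?R. \<Sum>e\<in>E. c r * u r e * \<rho> e i j)"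
      by (intro sum.cong refl, subst u(2)[OF _ ij(2,3)]) (simp_all add: sum_distrib_left mult.assoc)
    also have "\<dots> = (\<Sum>e\<in>E. (\<Sum>r\<in>?R. c r * u r e) * \<rho> e i j)"
      by (subst sum.swap) (simp only: sum_distrib_right)
    also have "\<dots> = 0" by (intro sum.neutral ballI) (simp only: c mult_zero_left)
    finally show "c p = 0" .
  qed
qed

lemma finite_extensionD:
  assumes "finite_extension Q F"
  shows "unital_subring F" and "\<And>x y. x \<in> F \<Longrightarrow> y \<in> F \<Longrightarrow> x * y = y * x"
    and "\<And>x. x \<in> F \<Longrightarrow> inverse x \<in> F"
proof -
  note a = conjunct2[OF assms[unfolded finite_extension_def]]
  show F: "unital_subring F" by (rule conjunct1[OF a])
  show "\<And>x y. x \<in> F \<Longrightarrow> y \<in> F \<Longrightarrow> x * y = y * x"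
    by (rule bspec[OF bspec[OF conjunct1[OF conjunct2[OF a]]]])
  have "\<forall>x\<in>F. x \<noteq> 0 \<longrightarrow> inverse x \<in> F" by (rule conjunct1[OF conjunct2[OF conjunct2[OF a]]])
  then show "\<And>x. x \<in> F \<Longrightarrow> inverse x \<in> F" by (metis inverse_zero)
qed

lemma splittingD:
  assumes "splitting R F d \<rho>" "i < d" "j < d"
  shows "\<And>r. r \<in> R \<Longrightarrow> \<rho> r i j \<in> F"
    and "\<And>r s. r \<in> R \<Longrightarrow> s \<in> R \<Longrightarrow> \<rho> (r + s) i j = \<rho> r i j + \<rho> s i j"
    and "\<And>r s. r \<in> R \<Longrightarrow> s \<in> R \<Longrightarrow> \<rho> (r * s) i j = (\<Sum>k<d. \<rho> r i k * \<rho> s k j)"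
    and "\<And>z r. z \<in> center_of R \<Longrightarrow> r \<in> R \<Longrightarrow> \<rho> (z * r) i j = z * \<rho> r i j"
    and "\<rho> 1 i j = (if i = j then 1 else 0)"
proof -
  note a = conjunct1[OF conjunct2[OF assms(1)[unfolded splitting_def]], rule_format, OF assms(2,3)]
  note b = a[THEN conjunct2] note c = b[THEN conjunct2] note d = c[THEN conjunct2]
  show "\<And>r. r \<in> R \<Longrightarrow> \<rho> r i j \<in> F" by (rule bspec[OF a[THEN conjunct1]])
  show "\<And>r s. r \<in> R \<Longrightarrow> s \<in> R \<Longrightarrow> \<rho> (r + s) i j = \<rho> r i j + \<rho> s i j"
    by (rule bspec[OF bspec[OF b[THEN conjunct1]]])
  show "\<And>r s. r \<in> R \<Longrightarrow> s \<in> R \<Longrightarrow> \<rho> (r * s) i j = (\<Sum>k<d. \<rho> r i k * \<rho> s k j)"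
    by (rule bspec[OF bspec[OF c[THEN conjunct1]]])
  show "\<And>z r. z \<in> center_of R \<Longrightarrow> r \<in> R \<Longrightarrow> \<rho> (z * r) i j = z * \<rho> r i j"
    by (rule bspec[OF bspec[OF d[THEN conjunct1]]])
  show "\<rho> 1 i j = (if i = j then 1 else 0)" by (rule d[THEN conjunct2])
qed

context quantum_torus
begin

text \<open>For \<open>f\<close> outside \<open>K\<close> some \<open>M g\<close> conjugates
  \<open>M f\<close> to a different scalar multiple of it, so its trace is 0; for \<open>f\<close>
  in \<open>K\<close> the monomial is central and can be pulled out. The values of
  \<open>\<tau>\<close> may lie anywhere in the division ring, which later admits traces that come
  from another frame.\<close>

lemma trace_unique:
  assumes add: "\<And>r s. r \<in> T \<Longrightarrow> s \<in> T \<Longrightarrow> \<tau> (r + s) = \<tau> r + \<tau> s"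
    and comm: "\<And>r s. r \<in> T \<Longrightarrow> s \<in> T \<Longrightarrow> \<tau> (r * s) = \<tau> (s * r)"
    and central: "\<And>z r. z \<in> sp K \<Longrightarrow> r \<in> T \<Longrightarrow> \<tau> (z * r) = z * \<tau> r"
    and x: "x \<in> T"
  shows "\<tau> x = proj K x * \<tau> 1"
  using x
proof (induction rule: sp_induct)
  case zero
  have "\<tau> (0 * 1) = 0 * \<tau> 1" by (rule central[OF sp_0 unital_subring_1[OF T_subring]])
  then show ?case by (simp add: proj_0)
next
  case (add x y)
  then show ?case by (simp add: assms(1) proj_add distrib_right)
next
  case (mono a f)
  let ?x = "\<iota> a * M f"
  show ?case
  proof (cases "f \<in> K")
    case True
    then have "\<tau> (?x * 1) = ?x * \<tau> 1"
      by (rule central[OF sp_mono_el[OF mono(1)] unital_subring_1[OF T_subring]])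
    then show ?thesis using mono True by (simp add: proj_mono)
  next
    case False
    then obtain g where g: "\<not> int l dvd form W g f" by (auto simp: K_iff)
    have xT: "?x \<in> T" by (rule mono_T[OF mono(1)])
    note MT = M_in_sp[OF UNIV_I]
    have "M g * ?x * M (- g) = \<iota> a * (M g * M f * M (- g))"
      by (simp only: mult.assoc \<iota>_left_commute[OF mono(1), of "M g"])
    also have "\<dots> = qi (form W g f) * ?x"
      unfolding M_conj by (rule \<iota>_left_commute[OF q_powi_in])
    finally have "\<tau> (M g * ?x * M (- g)) = \<tau> (qi (form W g f) * ?x)" by (rule arg_cong)
    moreover have "\<tau> (M g * ?x * M (- g)) = \<tau> (M (- g) * (M g * ?x))"
      by (rule comm[OF T_mult[OF MT xT] MT])
    moreover have "M (- g) * (M g * ?x) = ?x" by (rule M_minus_cancel(1))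
    moreover have "\<tau> (qi (form W g f) * ?x) = qi (form W g f) * \<tau> ?x"
      by (rule central[OF \<iota>_in_sp[OF q_powi_in subgrp_0[OF subgrp_K]] xT])
    ultimately have "(qi (form W g f) - 1) * \<tau> ?x = 0" by (simp only: left_diff_distrib mult_1_left diff_self)
    then have "\<tau> ?x = 0" using g qi_1_iff[of "form W g f"] by auto
    then show ?thesis using False mono by (simp add: proj_mono)
  qed
qed

text \<open>Commuting entries make the matrix trace invariant under exchange of factors, so
  \<open>trace_unique\<close> applies. The hypotheses are those common to an arbitrary splitting and
  to the matrices \<open>\<rho>\<close> of \<open>torus_rep\<close>.\<close>

lemma trace_formula:
  fixes \<sigma> :: "'a \<Rightarrow> nat \<Rightarrow> nat \<Rightarrow> 'a"
  assumes add: "\<And>r s i j. r \<in> T \<Longrightarrow> s \<in> T \<Longrightarrow> i < d \<Longrightarrow> j < d \<Longrightarrow> \<sigma> (r + s) i j = \<sigma> r i j + \<sigma> s i j"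
    and mult: "\<And>r s i j. r \<in> T \<Longrightarrow> s \<in> T \<Longrightarrow> i < d \<Longrightarrow> j < d \<Longrightarrow> \<sigma> (r * s) i j = (\<Sum>k<d. \<sigma> r i k * \<sigma> s k j)"
    and central: "\<And>z r i j. z \<in> sp K \<Longrightarrow> r \<in> T \<Longrightarrow> i < d \<Longrightarrow> j < d \<Longrightarrow> \<sigma> (z * r) i j = z * \<sigma> r i j"
    and one: "\<And>i j. i < d \<Longrightarrow> j < d \<Longrightarrow> \<sigma> 1 i j = (if i = j then 1 else 0)"
    and comm: "\<And>r s i j k m. r \<in> T \<Longrightarrow> s \<in> T \<Longrightarrow> i < d \<Longrightarrow> j < d \<Longrightarrow> k < d \<Longrightarrow> m < d \<Longrightarrow>
        \<sigma> r i j * \<sigma> s k m = \<sigma> s k m * \<sigma> r i j"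
    and x: "x \<in> T"
  shows "(\<Sum>i<d. \<sigma> x i i) = of_nat d * proj K x"
proof -
  have "(\<Sum>i<d. \<sigma> x i i) = proj K x * (\<Sum>i<d. \<sigma> 1 i i)"
  proof (rule trace_unique[OF _ _ _ x])
    fix r s assume rs: "r \<in> T" "s \<in> T"
    show "(\<Sum>i<d. \<sigma> (r + s) i i) = (\<Sum>i<d. \<sigma> r i i) + (\<Sum>i<d. \<sigma> s i i)"
      using rs by (simp add: add sum.distrib)
    have "(\<Sum>i<d. \<sigma> (r * s) i i) = (\<Sum>i<d. \<Sum>k<d. \<sigma> r i k * \<sigma> s k i)" using rs by (simp add: mult)
    also have "\<dots> = (\<Sum>i<d. \<Sum>k<d. \<sigma> s k i * \<sigma> r i k)" using rs by (intro sum.cong refl comm) auto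
    also have "\<dots> = (\<Sum>i<d. \<sigma> (s * r) i i)" using rs by (subst sum.swap) (simp add: mult)
    finally show "(\<Sum>i<d. \<sigma> (r * s) i i) = (\<Sum>i<d. \<sigma> (s * r) i i)" .
  next
    fix z r assume "z \<in> sp K" "r \<in> T"
    then show "(\<Sum>i<d. \<sigma> (z * r) i i) = z * (\<Sum>i<d. \<sigma> r i i)"
      by (simp add: central sum_distrib_left)
  qed
  then show ?thesis by (simp add: one of_nat_commute)
qed

text \<open>The basis \<open>E\<close> is counted twice: over the fractions of the center of the
  torus, and as a basis of the matrix algebra.\<close>

lemma splitting_degree:
  assumes "splitting T F d \<rho>"
  shows "d * d = index K"
proof -
  note ext = finite_extensionD[OF conjunct1[OF assms[unfolded splitting_def]]]
  from conjunct2[OF conjunct2[OF assms[unfolded splitting_def central_fractions_T]]]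
  obtain E where E: "finite E \<and> E \<subseteq> T \<and>
      (\<forall>r\<in>T. \<exists>!c. c \<in> E \<rightarrow>\<^sub>E torus.D \<and> r = (\<Sum>e\<in>E. c e * e)) \<and>
      (\<forall>A. (\<forall>i<d. \<forall>j<d. A i j \<in> F) \<longrightarrow>
        (\<exists>!c. c \<in> E \<rightarrow>\<^sub>E F \<and> (\<forall>i<d. \<forall>j<d. A i j = (\<Sum>e\<in>E. c e * \<rho> e i j))))" ..
  note E1 = conjunct1[OF E] and E2 = conjunct1[OF conjunct2[OF E]]
    and E3 = conjunct1[OF conjunct2[OF conjunct2[OF E]]] and E4 = conjunct2[OF conjunct2[OF conjunct2[OF E]]]
  have "card E = d * d"
  proof (rule matrix_basis_card[OF ext(1) _ E1, where \<rho> = \<rho> and d = d])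
    show "\<rho> e i j \<in> F" if "e \<in> E" "i < d" "j < d" for e i j
      by (rule splittingD(1)[OF assms that(2,3) subsetD[OF E2 that(1)]])
    show "\<exists>!c. c \<in> E \<rightarrow>\<^sub>E F \<and> (\<forall>i<d. \<forall>j<d. A i j = (\<Sum>e\<in>E. c e * \<rho> e i j))"
      if "\<And>i j. i < d \<Longrightarrow> j < d \<Longrightarrow> A i j \<in> F" for A
      by (rule E4[THEN spec, THEN mp]) (use that in simp)
  qed (rule ext(3))
  moreover have "card E = index K" by (rule basis_card[OF E1 E2 bspec[OF E3]])
  ultimately show ?thesis by simp
qed

lemma splitting_trace:
  assumes s: "splitting T F d \<rho>" and x: "x \<in> T"
  shows "(\<Sum>i<d. \<rho> x i i) = of_nat d * proj K x"
proof (rule trace_formula[where \<sigma> = \<rho>, OF _ _ _ _ _ x])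
  show "\<rho> (r + s') i j = \<rho> r i j + \<rho> s' i j" if "r \<in> T" "s' \<in> T" "i < d" "j < d" for r s' i j
    by (rule splittingD(2)[OF s that(3,4,1,2)])
  show "\<rho> (r * s') i j = (\<Sum>k<d. \<rho> r i k * \<rho> s' k j)" if "r \<in> T" "s' \<in> T" "i < d" "j < d" for r s' i j
    by (rule splittingD(3)[OF s that(3,4,1,2)])
  show "\<rho> (z * r) i j = z * \<rho> r i j" if "z \<in> sp K" "r \<in> T" "i < d" "j < d" for z r i j
    by (rule splittingD(4)[OF s that(3,4), unfolded center_T, OF that(1,2)])
  show "\<rho> 1 i j = (if i = j then 1 else 0)" if "i < d" "j < d" for i j
    by (rule splittingD(5)[OF s that])
  show "\<rho> r i j * \<rho> s' k m = \<rho> s' k m * \<rho> r i j"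
    if "r \<in> T" "s' \<in> T" "i < d" "j < d" "k < d" "m < d" for r s' i j k m
    by (rule finite_extensionD(2)[OF conjunct1[OF s[unfolded splitting_def]]
        splittingD(1)[OF s that(3,4,1)] splittingD(1)[OF s that(5,6,2)]])
qed

end

section \<open>Matrix representations of a quantum torus\<close>

text \<open>Isotropy in place of self-orthogonality admits both choices of \<open>P\<close>:
  self-orthogonal for \<open>W\<close> in \<open>splitting_exists\<close>, and for \<open>L\<close>
  in \<open>cayley_hamilton_T\<close>.\<close>

locale torus_rep = quantum_torus q l A \<iota> M L
  for q :: "'c::field" and l :: nat and A :: "'c set" and \<iota> :: "'c \<Rightarrow> 'a::division_ring"
    and M :: "int ^ 'n::finite \<Rightarrow> 'a" and L :: "int ^ 'n ^ 'n" +
  fixes P :: "(int ^ 'n) set"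
  assumes P: "subgrp P" and K_sub: "K \<subseteq> P" and P_iso: "\<And>f g. f \<in> P \<Longrightarrow> g \<in> P \<Longrightarrow> int l dvd form W f g"
begin

abbreviation dim :: nat where "dim \<equiv> index P"

lemma full_P: "full l P"
  by (rule full_mono[OF full_K K_sub])

lemma finite_reps_P: "finite (range (rep P))"
  by (rule finite_range_rep[OF l_pos P full_P])

definition \<xi> :: "nat \<Rightarrow> int ^ 'n" where "\<xi> = (SOME \<xi>. bij_betw \<xi> {..<dim} (range (rep P)))"

lemma \<xi>: "bij_betw \<xi> {..<dim} (range (rep P))"
proof -
  have "\<exists>\<xi>. bij_betw \<xi> {..<dim} (range (rep P))"
    using ex_bij_betw_nat_finite[OF finite_reps_P] by (simp add: atLeast0LessThan index_def)
  from someI_ex[OF this] show ?thesis unfolding \<xi>_def .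
qed

definition coset :: "nat \<Rightarrow> (int ^ 'n) set" where "coset i = {f. f - \<xi> i \<in> P}"

lemma \<xi>_coset_iff: "i < dim \<Longrightarrow> j < dim \<Longrightarrow> \<xi> j \<in> coset i \<longleftrightarrow> i = j"
proof -
  assume ij: "i < dim" "j < dim"
  have "\<xi> i \<in> range (rep P)" "\<xi> j \<in> range (rep P)" using \<xi> ij by (auto simp: bij_betw_def)
  then have "\<xi> j \<in> coset i \<longleftrightarrow> \<xi> j = \<xi> i"
    using rep_diff_eq[OF P, of "\<xi> j" "\<xi> i"] subgrp_0[OF P] by (auto simp: coset_def)
  then show ?thesis using \<xi> ij by (auto simp: bij_betw_def inj_on_def)
qed

lemma coset_ex: obtains i where "i < dim" "f \<in> coset i"
proof -
  have "rep P f \<in> \<xi> ` {..<dim}" using \<xi> by (simp add: bij_betw_def)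
  then obtain i where i: "i < dim" "rep P f = \<xi> i" by auto
  have "f - \<xi> i \<in> P" using subgrp_uminus[OF P rep_in[OF P, of f]] i by simp
  then show ?thesis using that[OF i(1)] by (simp add: coset_def)
qed

lemma coset_unique:
  assumes "i < dim" "j < dim" "f \<in> coset i" "f \<in> coset j"
  shows "i = j"
proof -
  have "(f - \<xi> i) - (f - \<xi> j) \<in> P" using subgrp_diff[OF P, of "f - \<xi> i" "f - \<xi> j"] assms by (simp add: coset_def)
  then have "\<xi> j \<in> coset i" by (simp add: coset_def)
  then show ?thesis using \<xi>_coset_iff assms by simp
qed

lemma coset_add_iff: "p \<in> P \<Longrightarrow> f + p \<in> coset i \<longleftrightarrow> f \<in> coset i"
  using subgrp_add_iff[OF P, of p "f - \<xi> i"] by (simp add: coset_def algebra_simps)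

text \<open>
  The torus is a free right module over its commutative subring \<open>sp P\<close>, with basis the \<open>M (\<xi> j)\<close>;
  \<open>\<rho> x\<close> is the matrix of the left multiplication by \<open>x\<close>.
\<close>

definition \<rho> :: "'a \<Rightarrow> nat \<Rightarrow> nat \<Rightarrow> 'a" where
  "\<rho> x i j = M (- \<xi> i) * proj (coset i) (x * M (\<xi> j))"

lemma MT: "M f \<in> T"
  by (rule M_in_sp) simp

lemma spP_commute: "x \<in> sp P \<Longrightarrow> y \<in> sp P \<Longrightarrow> x * y = y * x"
  by (erule sp_commute, assumption) (rule P_iso)

text \<open>The factor \<open>M (- \<xi> i)\<close> shifts the coset \<open>i\<close> to
  \<open>P\<close>.\<close>

lemma \<rho>_in: "x \<in> T \<Longrightarrow> \<rho> x i j \<in> sp P"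
  unfolding \<rho>_def
  by (rule sp_mult[OF M_in_sp[of "- \<xi> i" "{- \<xi> i}"] proj_in[OF T_mult[OF _ MT]]]) (auto simp: coset_def)

lemma \<rho>_add: "x \<in> T \<Longrightarrow> y \<in> T \<Longrightarrow> \<rho> (x + y) i j = \<rho> x i j + \<rho> y i j"
  unfolding \<rho>_def by (simp add: distrib_right distrib_left proj_add T_mult MT)

lemma sum_proj_coset:
  assumes "x \<in> T"
  shows "(\<Sum>i<dim. proj (coset i) x) = x"
proof (rule T_eqI)
  show "(\<Sum>i<dim. proj (coset i) x) \<in> T" using assms by (intro sp_sum proj_T)
  fix f
  obtain k where k: "k < dim" "f \<in> coset k" by (rule coset_ex)
  have "coef (\<Sum>i<dim. proj (coset i) x) f = (\<Sum>i<dim. coef (proj (coset i) x) f)"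
    using assms by (intro coef_sum proj_T)
  also have "\<dots> = (\<Sum>i<dim. if i = k then coef x f else 0)"
    using assms k coset_unique by (intro sum.cong) (auto simp: coef_proj)
  also have "\<dots> = coef x f" using k by simp
  finally show "coef (\<Sum>i<dim. proj (coset i) x) f = coef x f" .
qed (rule assms)

lemma \<rho>_mult:
  assumes "r \<in> T" "s \<in> T"
  shows "\<rho> (r * s) i j = (\<Sum>k<dim. \<rho> r i k * \<rho> s k j)"
proof -
  let ?s = "\<lambda>k. proj (coset k) (s * M (\<xi> j))"
  have sT: "s * M (\<xi> j) \<in> T" by (rule T_mult[OF assms(2) MT])
  \<comment> \<open>The factors \<open>M (\<xi> k)\<close> and \<open>M (- \<xi> k)\<close> cancel
    between the two entries, and \<open>\<rho> s k j\<close>, having exponents in \<open>P\<close>,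
    may be moved under the projection.\<close>
  have "\<rho> r i k * \<rho> s k j = M (- \<xi> i) * proj (coset i) (r * ?s k)" for k
  proof -
    have "\<rho> r i k * \<rho> s k j = M (- \<xi> i) * (proj (coset i) (r * M (\<xi> k)) * \<rho> s k j)"
      by (simp only: \<rho>_def[of r] mult.assoc)
    also have "proj (coset i) (r * M (\<xi> k)) * \<rho> s k j = proj (coset i) (r * M (\<xi> k) * \<rho> s k j)"
      by (rule proj_mult_right[OF T_mult[OF assms(1) MT] \<rho>_in[OF assms(2)] coset_add_iff, symmetric])
    also have "r * M (\<xi> k) * \<rho> s k j = r * ?s k"
      by (simp only: \<rho>_def mult.assoc M_minus_cancel)
    finally show ?thesis .
  qed
  then have "(\<Sum>k<dim. \<rho> r i k * \<rho> s k j) = M (- \<xi> i) * (\<Sum>k<dim. proj (coset i) (r * ?s k))"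
    by (simp only: sum_distrib_left)
  also have "(\<Sum>k<dim. proj (coset i) (r * ?s k)) = proj (coset i) (\<Sum>k<dim. r * ?s k)"
    by (rule proj_sum[symmetric]) (rule T_mult[OF assms(1) proj_T[OF sT]])
  also have "(\<Sum>k<dim. r * ?s k) = r * s * M (\<xi> j)"
    by (simp only: sum_distrib_left[symmetric] sum_proj_coset[OF sT] mult.assoc)
  finally show ?thesis by (simp only: \<rho>_def)
qed

lemma \<rho>_central:
  assumes "z \<in> sp K" "r \<in> T"
  shows "\<rho> (z * r) i j = z * \<rho> r i j"
proof -
  have "proj (coset i) (z * (r * M (\<xi> j))) = z * proj (coset i) (r * M (\<xi> j))"
    by (rule proj_central[OF assms(1) T_mult[OF assms(2) MT]]) (use K_sub coset_add_iff in blast)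
  then have "\<rho> (z * r) i j = (M (- \<xi> i) * z) * proj (coset i) (r * M (\<xi> j))"
    by (simp only: \<rho>_def mult.assoc)
  also have "M (- \<xi> i) * z = z * M (- \<xi> i)" by (rule spK_central[OF assms(1), symmetric])
  finally show ?thesis by (simp only: \<rho>_def[of r] mult.assoc)
qed

lemma proj_M: "proj Y (M f) = (if f \<in> Y then M f else 0)"
  using proj_mono[of 1 Y f] A_closed(2) by (simp add: \<iota>_1)

lemma \<rho>_1: "i < dim \<Longrightarrow> j < dim \<Longrightarrow> \<rho> 1 i j = (if i = j then 1 else 0)"
  by (simp add: \<rho>_def proj_M \<xi>_coset_iff M_mult_minus)

lemma \<rho>_trace: "x \<in> T \<Longrightarrow> (\<Sum>i<dim. \<rho> x i i) = of_nat dim * proj K x"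
proof (rule trace_formula[where \<sigma> = \<rho>])
  show "\<rho> (r + s) i j = \<rho> r i j + \<rho> s i j" if "r \<in> T" "s \<in> T" for r s i j by (rule \<rho>_add[OF that])
  show "\<rho> (r * s) i j = (\<Sum>k<dim. \<rho> r i k * \<rho> s k j)" if "r \<in> T" "s \<in> T" for r s i j by (rule \<rho>_mult[OF that])
  show "\<rho> (z * r) i j = z * \<rho> r i j" if "z \<in> sp K" "r \<in> T" for z r i j by (rule \<rho>_central[OF that])
  show "\<rho> 1 i j = (if i = j then 1 else 0)" if "i < dim" "j < dim" for i j by (rule \<rho>_1[OF that])
  show "\<rho> r i j * \<rho> s k m = \<rho> s k m * \<rho> r i j" if "r \<in> T" "s \<in> T" for r s i j k m
    by (rule spP_commute[OF \<rho>_in[OF that(1)] \<rho>_in[OF that(2)]])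
qed

lemma \<rho>_faithful:
  assumes "x \<in> T" "\<And>i j. i < dim \<Longrightarrow> j < dim \<Longrightarrow> \<rho> x i j = 0" "dim > 0"
  shows "x = 0"
proof -
  \<comment> \<open>Column 0 suffices: it holds all parts of \<open>x * M (\<xi> 0)\<close>, and
    \<open>M (\<xi> 0)\<close> is invertible.\<close>
  have "proj (coset i) (x * M (\<xi> 0)) = 0" if "i < dim" for i
    using assms(2)[OF that assms(3)] M_nonzero by (simp add: \<rho>_def)
  then have "x * M (\<xi> 0) = 0"
    using sum_proj_coset[OF T_mult[OF assms(1) MT], of "\<xi> 0"] by simp
  then show ?thesis using M_nonzero by simp
qed

text \<open>For self-orthogonal \<open>P\<close> this centralizer is the field of fractions of
  \<open>sp P\<close>, obtained without constructing fractions. It will be the splitting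
  field.\<close>

definition KF :: "'a set" where "KF = {x. \<forall>p\<in>P. M p * x = x * M p}"

lemma KF_subring: "unital_subring KF"
  unfolding unital_subring_def KF_def by (auto simp: algebra_simps) (metis mult.assoc)

lemma KF_inverse: "x \<in> KF \<Longrightarrow> inverse x \<in> KF"
  unfolding KF_def using commute_inverse by blast

lemma KF_commute:
  assumes "x \<in> KF" "y \<in> sp P"
  shows "x * y = y * x"
  using assms(2)
proof (induction rule: sp_induct)
  case (mono a f)
  then have "M f * x = x * M f" using assms(1) by (simp add: KF_def)
  then show ?case by (simp only: mult.assoc \<iota>_left_commute[OF mono(1), of x])
qed (simp_all add: distrib_left distrib_right)

lemma spP_KF: "sp P \<subseteq> KF"
  unfolding KF_def using spP_commute M_in_sp by blast

lemma \<rho>_M: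
  "\<rho> (M r) i j = (if r + \<xi> j \<in> coset i then M (- \<xi> i) * (M r * M (\<xi> j)) else 0)"
proof -
  have "proj (coset i) (M r * M (\<xi> j)) = (if r + \<xi> j \<in> coset i then M r * M (\<xi> j) else 0)"
    unfolding M_mult by (rule proj_mono[OF q_powi_in])
  then show ?thesis by (simp add: \<rho>_def)
qed

text \<open>Only the representatives congruent to \<open>r0\<close> modulo \<open>P\<close> have
  nonzero entries where \<open>M r0\<close> has. In column \<open>j\<close> such an entry is that of
  \<open>M r0\<close> times \<open>M (r - r0)\<close>, up to scalars, among them the value at
  \<open>\<xi> j\<close> of the character \<open>qi (form W (r - r0) f)\<close> of \<open>f\<close>.
  Different \<open>r\<close> give different characters, so the coefficients vanish.\<close>

lemma \<rho>_independent:
  assumes c: "\<And>r. r \<in> range (rep K) \<Longrightarrow> c r \<in> KF"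
    and zero: "\<And>i j. i < dim \<Longrightarrow> j < dim \<Longrightarrow> (\<Sum>r\<in>range (rep K). c r * \<rho> (M r) i j) = 0"
    and r0: "r0 \<in> range (rep K)"
  shows "c r0 = 0"
proof -
  define S where "S = {r \<in> range (rep K). r - r0 \<in> P}"
  have finS: "finite S" using finite_reps_K by (simp add: S_def)
  \<comment> \<open>Collects what does not depend on the column \<open>j\<close> after the entry of
    \<open>M r0\<close> is factored out.\<close>
  define C where "C r = c r * (qi (- form L r0 (r - r0)) * M (r - r0))" for r
  have basis: "(\<Sum>r\<in>S. C r * qi (form W (r - r0) (\<xi> j))) = 0" if j: "j < dim" for j
  proof -
    obtain i where i: "i < dim" "r0 + \<xi> j \<in> coset i" by (rule coset_ex)
    let ?u = "M (- \<xi> i) * M r0 * M (\<xi> j)"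
    have iff: "r + \<xi> j \<in> coset i \<longleftrightarrow> r - r0 \<in> P" for r
    proof -
      have "r0 + \<xi> j - \<xi> i \<in> P" using i by (simp add: coset_def)
      from subgrp_add_iff[OF P this, of "r - r0"] show ?thesis by (simp add: coset_def algebra_simps)
    qed
    have "\<rho> (M r0) i j = ?u" by (simp only: \<rho>_M i(2) if_True mult.assoc)
    then have u: "?u \<in> sp P" using \<rho>_in[OF MT, of r0 i j] by simp
    have u0: "?u \<noteq> 0" using M_nonzero by simp
    have "0 = (\<Sum>r\<in>range (rep K). c r * \<rho> (M r) i j)" using zero[OF i(1) j] by simp
    also have "\<dots> = (\<Sum>r\<in>S. c r * (M (- \<xi> i) * (M r * M (\<xi> j))))"
      unfolding S_def by (rule sum.mono_neutral_cong_right[OF finite_reps_K]) (auto simp: \<rho>_M iff)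
    also have "\<dots> = (\<Sum>r\<in>S. ?u * (C r * qi (form W (r - r0) (\<xi> j))))"
    proof (rule sum.cong[OF refl])
      fix r assume r: "r \<in> S"
      let ?p = "r - r0"
      let ?a = "qi (- form L r0 ?p)" and ?b = "qi (form W ?p (\<xi> j))"
      have "M r = ?a * (M r0 * M ?p)" using M_add[of r0 ?p] by simp
      then have "M (- \<xi> i) * (M r * M (\<xi> j)) = M (- \<xi> i) * (?a * (M r0 * (M ?p * M (\<xi> j))))"
        by (simp only: mult.assoc)
      also have "\<dots> = ?a * (M (- \<xi> i) * (M r0 * (?b * (M (\<xi> j) * M ?p))))"
        unfolding M_commute[of ?p] by (simp only: qi_left_commute[of "M (- \<xi> i)"])
      also have "\<dots> = ?a * (?u * (M ?p * ?b))"
        unfolding mult.assoc by (simp only: qi_commute[of "form W ?p (\<xi> j)"] mult.assoc)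
      also have "\<dots> = ?u * ((?a * M ?p) * ?b)"
        by (simp only: mult.assoc qi_left_commute[of _ "- form L r0 ?p"])
      finally have e: "M (- \<xi> i) * (M r * M (\<xi> j)) = ?u * ((?a * M ?p) * ?b)" .
      have cu: "c r * ?u = ?u * c r" using KF_commute[OF c u] r by (simp add: S_def)
      show "c r * (M (- \<xi> i) * (M r * M (\<xi> j))) = ?u * (C r * ?b)"
      proof -
        have "c r * (?u * ((?a * M ?p) * ?b)) = (c r * ?u) * ((?a * M ?p) * ?b)" by (rule mult.assoc[symmetric])
        also have "\<dots> = ?u * (c r * ((?a * M ?p) * ?b))" unfolding cu by (rule mult.assoc)
        also have "c r * ((?a * M ?p) * ?b) = C r * ?b" unfolding C_def by (rule mult.assoc[symmetric])
        finally show ?thesis unfolding e .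
      qed
    qed
    also have "\<dots> = ?u * (\<Sum>r\<in>S. C r * qi (form W (r - r0) (\<xi> j)))"
      by (simp only: sum_distrib_left)
    finally show ?thesis using u0 by simp
  qed
  have "C r0 = 0"
  proof (rule characters_independent[of S UNIV "(+)" "\<lambda>r f. qi (form W (r - r0) f)" C r0])
    show "(\<Sum>r\<in>S. C r * qi (form W (r - r0) f)) = 0" for f
    proof -
      obtain j where j: "j < dim" "f \<in> coset j" by (rule coset_ex)
      \<comment> \<open>As \<open>r - r0\<close> lies in the isotropic \<open>P\<close>, the
        character is constant on cosets of \<open>P\<close>; so the columns account for all
        \<open>f\<close>.\<close>
      have "qi (form W (r - r0) f) = qi (form W (r - r0) (\<xi> j))" if "r \<in> S" for r
        using P_iso[of "r - r0" "f - \<xi> j"] that j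
        by (intro qi_cong) (simp add: cong_iff_dvd_diff form_diff_right S_def coset_def)
      then have "(\<Sum>r\<in>S. C r * qi (form W (r - r0) f)) = (\<Sum>r\<in>S. C r * qi (form W (r - r0) (\<xi> j)))"
        by (intro sum.cong refl) simp
      then show ?thesis using basis[OF j(1)] by simp
    qed
    show "\<exists>f\<in>UNIV. qi (form W (r - r0) f) \<noteq> qi (form W (r' - r0) f)" if r: "r \<in> S" "r' \<in> S" "r \<noteq> r'" for r r'
    proof -
      have "r - r' \<notin> K" using rep_diff_eq[OF subgrp_K, of r r'] r unfolding S_def by blast
      then obtain f where "\<not> int l dvd form W (r - r') f" unfolding K_def frame_kernel_iff by blast
      then have "qi (form W (r - r0) f) \<noteq> qi (form W (r' - r0) f)"
        by (simp add: qi_inj cong_iff_dvd_diff form_diff_left)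
      then show ?thesis by blast
    qed
    show "r0 \<in> S" using r0 subgrp_0[OF P] by (simp add: S_def)
    show "qi (form W (r - r0) (f + g)) = qi (form W (r - r0) f) * qi (form W (r - r0) g)" for r f g
      by (simp only: form_add_right qi_add)
    show "qi a * qi b = qi b * qi a" for a b by (rule qi_commute)
    show "\<exists>f\<in>UNIV. qi (form W (r - r0) f) \<noteq> 0" for r using qi_nonzero by blast
  qed (use finS in simp_all)
  then show ?thesis by (simp add: C_def M_0 \<iota>_1)
qed

end

section \<open>Existence of a splitting and value of the reduced trace\<close>

context quantum_torus
begin

text \<open>For \<open>P\<close> self-orthogonal for \<open>W\<close>, the index of \<open>K\<close>
  is \<open>dim * dim\<close>, the number of matrix entries; so the matrices that
  \<open>\<rho>_independent\<close> shows to be independent form a basis over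
  \<open>KF\<close>.\<close>

lemma splitting_exists: "\<exists>F d \<rho>. splitting T F d \<rho>"
proof -
  obtain P where lag: "lagrangian l W P" using lagrangian_exists[OF l_pos skew_W] .
  have sP: "subgrp P" using lag unfolding lagrangian_def by (rule conjunct1)
  have lagP: "f \<in> P \<longleftrightarrow> (\<forall>p\<in>P. int l dvd form W f p)" for f using lag unfolding lagrangian_def by metis
  have iso: "int l dvd form W f g" if "f \<in> P" "g \<in> P" for f g using lagP that by blast
  have KP: "K \<subseteq> P" unfolding K_def by (rule lagrangian_kernel[OF skew_W lag])
  interpret torus_rep q l A \<iota> M L P
    by unfold_locales (rule sP KP iso, assumption?)+
  interpret psub: monomial_subalgebra q l A \<iota> M L P
    by unfold_locales (use subgrp_0[OF P] subgrp_add[OF P] in \<open>simp add: additive_submonoid_def\<close>)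
  let ?R = "range (rep K)"
  have dim2: "card ?R = dim * dim"
    using index_lagrangian_aux(2)[OF skew_W lag] by (simp add: K_def index_def)
  have D_KF: "torus.D \<subseteq> KF" unfolding KF_def using torus.D_central[symmetric] by blast
  \<comment> \<open>A central multiple of an element of \<open>KF\<close> lies in the torus. As it
    commutes with the monomials of \<open>P\<close>, its exponents are orthogonal to
    \<open>P\<close>, hence in \<open>P\<close>.\<close>
  have to_spP: "\<exists>z\<in>sp K. z \<noteq> 0 \<and> z * x \<in> sp P" if x: "x \<in> KF" for x
  proof -
    obtain z where z: "z \<in> sp K" "z \<noteq> 0" "z * x \<in> T" by (rule central_fraction)
    have "f \<in> P" if "coef (z * x) f \<noteq> 0" for f
    proof -
      have "int l dvd form W f p" if "p \<in> P" for p
      proof -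
        have "M p * (z * x) = (z * x) * M p"
        proof -
          have xp: "M p * x = x * M p" using x \<open>p \<in> P\<close> unfolding KF_def by blast
          have "M p * (z * x) = (z * M p) * x" by (simp only: mult.assoc spK_central[OF z(1), of "M p"])
          then show ?thesis by (simp only: mult.assoc xp)
        qed
        then have "int l dvd form W p f" by (rule commutes_with_M[OF z(3) _ \<open>coef (z * x) f \<noteq> 0\<close>])
        then show ?thesis by (rule iffD1[OF dvd_form_commute[OF skew_W]])
      qed
      then show ?thesis using lagP by blast
    qed
    then have "z * x \<in> sp P" using z(3) sp_iff[of "z * x" P] by blast
    then show ?thesis using z by blast
  qed
  have KF_comm: "x * y = y * x" if xy: "x \<in> KF" "y \<in> KF" for x y
  proof -
    obtain z where z: "z \<in> sp K" "z \<noteq> 0" "z * y \<in> sp P" using to_spP[OF xy(2)] by blast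
    have "z * (x * y) = x * (z * y)" using spK_central[OF z(1), of x] by (metis mult.assoc)
    also have "\<dots> = z * (y * x)" using KF_commute[OF xy(1) z(3)] by (simp only: mult.assoc)
    finally show ?thesis using z(2) by simp
  qed
  have psubD: "psub.D \<subseteq> torus.D"
    unfolding psub.D_def torus.D_def using sp_mono[of "P \<inter> K" "UNIV \<inter> K"] by blast
  have ext: "finite_extension torus.D KF"
    unfolding finite_extension_def
  proof (intro conjI)
    let ?E = "M ` psub.rp ` P"
    show "\<exists>E. finite E \<and> E \<subseteq> KF \<and> (\<forall>x\<in>KF. \<exists>c. c ` E \<subseteq> torus.D \<and> x = (\<Sum>e\<in>E. c e * e))"
    proof (intro exI[of _ ?E] conjI ballI)
      show "finite ?E" using psub.finite_rp by simp
      show "?E \<subseteq> KF" using psub.rp(1) M_in_sp spP_KF by blast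
      fix x assume "x \<in> KF"
      then obtain z where z: "z \<in> sp K" "z \<noteq> 0" "z * x \<in> sp P" using to_spP by blast
      have iz: "inverse z \<in> torus.D" using z torus.D_inverse torus.Z_in_D by simp
      have "x = inverse z * (z * x)" using z(2) by (simp add: mult.assoc[symmetric])
      then show "\<exists>c. c ` ?E \<subseteq> torus.D \<and> x = (\<Sum>e\<in>?E. c e * e)"
        using psub.D_span_scaled[OF z(3) torus.D_subring psubD iz] by simp
    qed
  qed (use D_KF KF_subring KF_comm KF_inverse in blast)+
  have basis: "(\<forall>r\<in>T. \<exists>!c. c \<in> M ` ?R \<rightarrow>\<^sub>E torus.D \<and> r = (\<Sum>e\<in>M ` ?R. c e * e)) \<and>
        (\<forall>B. (\<forall>i<dim. \<forall>j<dim. B i j \<in> KF) \<longrightarrow>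
           (\<exists>!c. c \<in> M ` ?R \<rightarrow>\<^sub>E KF \<and> (\<forall>i<dim. \<forall>j<dim. B i j = (\<Sum>e\<in>M ` ?R. c e * \<rho> e i j))))"
  proof (intro conjI ballI allI impI)
    have inj: "inj_on M ?R" using M_inj by (auto intro: inj_onI)
    {
      fix x assume x: "x \<in> T"
      obtain d where d: "d ` ?R \<subseteq> torus.D" "x = (\<Sum>r\<in>?R. d r * M r)" using D_span_T[OF x] by blast
      have "\<exists>!c. c \<in> M ` ?R \<rightarrow>\<^sub>E torus.D \<and> (\<forall>i\<in>{()}. \<forall>j\<in>{()}. x = (\<Sum>e\<in>M ` ?R. c e * e))"
        by (rule unique_coefficients[OF torus.D_subring inj]) (use d reps_independent in auto)
      then show "\<exists>!c. c \<in> M ` ?R \<rightarrow>\<^sub>E torus.D \<and> x = (\<Sum>e\<in>M ` ?R. c e * e)" by simp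
    }
    {
      fix B :: "nat \<Rightarrow> nat \<Rightarrow> 'a" assume B: "\<forall>i<dim. \<forall>j<dim. B i j \<in> KF"
      \<comment> \<open>\<open>None\<close> stands for the matrix \<open>B\<close> itself: one
        unknown more than there are entries forces a linear relation, in which \<open>B\<close>
        occurs because the other matrices are independent.\<close>
      let ?F = "insert None (Some ` ?R)" and ?I = "{..<dim} \<times> {..<dim}"
      define a where "a o' p = (case o' of None \<Rightarrow> B (fst p) (snd p) | Some r \<Rightarrow> \<rho> (M r) (fst p) (snd p))" for o' p
      have card: "card ?I < card ?F"
        using finite_reps_K dim2 by (simp add: card_image)
      have "\<exists>c. c ` ?F \<subseteq> KF \<and> (\<exists>f\<in>?F. c f \<noteq> 0) \<and> (\<forall>p\<in>?I. (\<Sum>f\<in>?F. c f * a f p) = 0)"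
        by (rule underdetermined_system[OF KF_subring KF_inverse _ _ card])
          (use finite_reps_K B \<rho>_in[OF MT] spP_KF in \<open>auto simp: a_def\<close>)
      then obtain c where c: "c ` ?F \<subseteq> KF" "\<exists>f\<in>?F. c f \<noteq> 0" "\<And>p. p \<in> ?I \<Longrightarrow> (\<Sum>f\<in>?F. c f * a f p) = 0"
        by blast
      have rel: "c None * B i j + (\<Sum>r\<in>?R. c (Some r) * \<rho> (M r) i j) = 0" if "i < dim" "j < dim" for i j
        using c(3)[of "(i, j)"] that finite_reps_K
        by (simp add: sum.reindex a_def)
      have nz: "c None \<noteq> 0"
      proof
        assume n: "c None = 0"
        have "c (Some r) = 0" if "r \<in> ?R" for r
          by (rule \<rho>_independent[of "\<lambda>r. c (Some r)", OF _ _ that]) (use c(1) rel n in auto)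
        with n c(2) show False by auto
      qed
      define d where "d r = - inverse (c None) * c (Some r)" for r
      have dKF: "d r \<in> KF" if "r \<in> ?R" for r
        unfolding d_def using c(1) that by (intro unital_subring_mult[OF KF_subring] unital_subring_uminus[OF KF_subring] KF_inverse) auto
      have dB: "B i j = (\<Sum>r\<in>?R. d r * \<rho> (M r) i j)" if "i < dim" "j < dim" for i j
      proof -
        have "(\<Sum>r\<in>?R. d r * \<rho> (M r) i j) = - inverse (c None) * (\<Sum>r\<in>?R. c (Some r) * \<rho> (M r) i j)"
          unfolding d_def by (simp only: sum_distrib_left mult.assoc)
        also have "(\<Sum>r\<in>?R. c (Some r) * \<rho> (M r) i j) = - (c None * B i j)"
          using rel[OF that] by (simp add: eq_neg_iff_add_eq_0 add.commute)
        also have "- inverse (c None) * - (c None * B i j) = B i j"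
          using nz by (simp add: mult.assoc[symmetric])
        finally show ?thesis by simp
      qed
      have "\<exists>!c. c \<in> M ` ?R \<rightarrow>\<^sub>E KF \<and> (\<forall>i\<in>{..<dim}. \<forall>j\<in>{..<dim}. B i j = (\<Sum>e\<in>M ` ?R. c e * \<rho> e i j))"
      proof (rule unique_coefficients[OF KF_subring inj dKF])
        show "c r = 0" if "c ` ?R \<subseteq> KF" "r \<in> ?R"
          "\<And>i j. i \<in> {..<dim} \<Longrightarrow> j \<in> {..<dim} \<Longrightarrow> (\<Sum>r\<in>?R. c r * \<rho> (M r) i j) = 0" for c r
          by (rule \<rho>_independent[OF _ _ that(2)]) (use that(1,3) in auto)
      qed (use dB in simp_all)
      then show "\<exists>!c. c \<in> M ` ?R \<rightarrow>\<^sub>E KF \<and> (\<forall>i<dim. \<forall>j<dim. B i j = (\<Sum>e\<in>M ` ?R. c e * \<rho> e i j))"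
        by (simp add: Ball_def)
    }
  qed
  have "finite (M ` ?R)" "M ` ?R \<subseteq> T" using finite_reps_K MT by auto
  note fin = this
  have KF: "\<rho> r i j \<in> KF" if "r \<in> T" for r i j by (rule subsetD[OF spP_KF \<rho>_in[OF that]])
  have "splitting T KF dim \<rho>"
    unfolding splitting_def central_fractions_T center_T
  proof (intro conjI exI[of _ "M ` ?R"] allI impI ballI ext fin)
    fix i j assume ij: "i < dim" "j < dim"
    show "\<rho> 1 i j = (if i = j then 1 else 0)" by (rule \<rho>_1[OF ij])
    fix r s assume r: "r \<in> T"
    show "\<rho> r i j \<in> KF" by (rule KF[OF r])
    show "\<rho> (z * r) i j = z * \<rho> r i j" if "z \<in> sp K" for z by (rule \<rho>_central[OF that r])
    assume s: "s \<in> T"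
    show "\<rho> (r + s) i j = \<rho> r i j + \<rho> s i j" by (rule \<rho>_add[OF r s])
    show "\<rho> (r * s) i j = (\<Sum>k<dim. \<rho> r i k * \<rho> s k j)" by (rule \<rho>_mult[OF r s])
  qed (rule bspec[OF conjunct1[OF basis]], assumption, rule conjunct2[OF basis, THEN spec, THEN mp], blast)
  then show ?thesis by blast
qed

text \<open>The description is meaningful because all splittings share the degree, by
  \<open>splitting_degree\<close>, and therefore the trace.\<close>

lemma reduced_trace_T:
  assumes d: "d * d = index K" and x: "x \<in> T"
  shows "reduced_trace T x = of_nat d * proj K x"
  unfolding reduced_trace_def
proof (rule the_equality)
  have deg: "d' = d" if "splitting T F d' \<rho>" for F d' \<rho>
    using splitting_degree[OF that] d by (metis mult_eq_self_implies_10 nat_mult_eq_cancel_disj power2_eq_square power2_nat_le_eq_le order_antisym order_refl)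
  obtain F d' \<rho> where s: "splitting T F d' \<rho>" using splitting_exists by blast
  show "\<exists>F d' \<rho>. splitting T F d' \<rho> \<and> of_nat d * proj K x = (\<Sum>i<d'. \<rho> x i i)"
    using splitting_trace[OF s x] deg[OF s] s by metis
  show "t = of_nat d * proj K x" if "\<exists>F d \<rho>. splitting T F d \<rho> \<and> t = (\<Sum>i<d. \<rho> x i i)" for t
    using that splitting_trace[OF _ x] deg by metis
qed

end

section \<open>The Cayley--Hamilton identity\<close>

lemma of_nat_fact_split:
  "i \<le> n \<Longrightarrow> (of_nat (fact n) :: 'b::semiring_1) = of_nat (fact n div fact i) * of_nat (fact i)"
  using fact_dvd[of i n, where 'a = nat] by (metis dvd_div_mult_self of_nat_mult)

text \<open>Multiplication by \<open>i!\<close> turns the recursion into one with integer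
  coefficients \<open>i! / (i - j)!\<close>, so that the scaled values stay in the torus and can be
  evaluated.\<close>

lemma newton_poly_scaled:
  fixes s :: "nat \<Rightarrow> 'b::division_ring"
  assumes nz: "of_nat (Suc i) \<noteq> (0::'b)"
  shows "of_nat (fact (Suc i)) * newton_poly s (Suc i) =
    (\<Sum>j\<le>i. (-1) ^ j * (of_nat (fact i div fact (i - j)) * (of_nat (fact (i - j)) * newton_poly s (i - j)) * s (Suc j)))"
proof -
  define S where "S = (\<Sum>j\<le>i. (-1) ^ j * newton_poly s (i - j) * s (Suc j))"
  have "of_nat (fact (Suc i)) * newton_poly s (Suc i) = of_nat (fact i) * (of_nat (Suc i) * (S / of_nat (Suc i)))"
    unfolding newton_poly.simps S_def[symmetric] by (simp only: fact_Suc of_nat_mult mult.assoc of_nat_id mult.commute)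
  also have "of_nat (Suc i) * (S / of_nat (Suc i)) = S / of_nat (Suc i) * of_nat (Suc i)"
    by (rule mult_of_nat_commute)
  also have "\<dots> = S" by (simp only: divide_inverse mult.assoc left_inverse[OF nz] mult_1_right)
  also have "of_nat (fact i) * S = (\<Sum>j\<le>i. (-1) ^ j * (of_nat (fact i div fact (i - j)) * (of_nat (fact (i - j)) * newton_poly s (i - j)) * s (Suc j)))"
    unfolding S_def sum_distrib_left
  proof (rule sum.cong[OF refl])
    fix j assume "j \<in> {..i}"
    have "(of_nat (fact i) :: 'b) = of_nat (fact i div fact (i - j)) * of_nat (fact (i - j))"
      by (rule of_nat_fact_split) simp
    moreover have "of_nat (fact i) * ((-1) ^ j * newton_poly s (i - j) * s (Suc j))
        = (-1) ^ j * (of_nat (fact i) * newton_poly s (i - j) * s (Suc j))"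
      by (simp add: mult.assoc minus_one_power_iff)
    ultimately show "of_nat (fact i) * ((-1) ^ j * newton_poly s (i - j) * s (Suc j)) =
       (-1) ^ j * (of_nat (fact i div fact (i - j)) * (of_nat (fact (i - j)) * newton_poly s (i - j)) * s (Suc j))"
      by (simp only: mult.assoc)
  qed
  finally show ?thesis .
qed

text \<open>
  If \<open>P\<close> is isotropic for \<open>L\<close>, not just for \<open>2L\<close>, then \<open>sp P\<close> is a ring of Laurent polynomials, and
  evaluating them reduces the Cayley--Hamilton identity for \<open>\<rho> a\<close> to matrices over the field \<open>'c\<close>.
\<close>

locale torus_eval = torus_rep q l A \<iota> M L P
  for q :: "'c::field" and l :: nat and A :: "'c set" and \<iota> :: "'c \<Rightarrow> 'a::division_ring"
    and M :: "int ^ 'n::finite \<Rightarrow> 'a" and L :: "int ^ 'n ^ 'n" and P +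
  assumes L_iso: "\<And>f g. f \<in> P \<Longrightarrow> g \<in> P \<Longrightarrow> int l dvd form L f g"
begin

definition mon :: "('n \<Rightarrow> 'c) \<Rightarrow> int ^ 'n \<Rightarrow> 'c" where
  "mon x f = (\<Prod>i\<in>UNIV. x i powi (f $ i))"

definition ev :: "('n \<Rightarrow> 'c) \<Rightarrow> 'a \<Rightarrow> 'c" where
  "ev x t = (\<Sum>f | coef t f \<noteq> 0. coef t f * mon x f)"

lemma ev_superset: "finite S \<Longrightarrow> {f. coef t f \<noteq> 0} \<subseteq> S \<Longrightarrow> ev x t = (\<Sum>f\<in>S. coef t f * mon x f)"
  unfolding ev_def by (rule sum.mono_neutral_left) auto

lemma ev_add:
  assumes "t \<in> T" "u \<in> T" shows "ev x (t + u) = ev x t + ev x u"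
proof -
  let ?S = "{f. coef t f \<noteq> 0} \<union> {f. coef u f \<noteq> 0}"
  have S: "finite ?S" using assms by (simp add: finite_supp)
  have "ev x (t + u) = (\<Sum>f\<in>?S. coef (t + u) f * mon x f)"
    by (rule ev_superset[OF S]) (auto simp: coef_add[OF assms])
  then show ?thesis
    using ev_superset[OF S, of t x] ev_superset[OF S, of u x]
    by (simp add: coef_add[OF assms] distrib_right sum.distrib)
qed

lemma ev_0: "ev x 0 = 0"
  by (simp add: ev_def)

lemma ev_uminus: "t \<in> T \<Longrightarrow> ev x (- t) = - ev x t"
  using ev_add[of t "- t" x] by (simp add: uminus_T ev_0 eq_neg_iff_add_eq_0 add.commute)

lemma ev_sum: "(\<And>i. i \<in> I \<Longrightarrow> h i \<in> T) \<Longrightarrow> ev x (sum h I) = (\<Sum>i\<in>I. ev x (h i))"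
  by (induction I rule: infinite_finite_induct) (simp_all add: ev_0 ev_add sp_sum)

lemma ev_mono: "a \<in> A \<Longrightarrow> ev x (\<iota> a * M f) = a * mon x f"
  by (subst ev_superset[of "{f}"]) (auto simp: coef_mono split: if_splits)

lemma mon_add: "(\<And>i. x i \<noteq> 0) \<Longrightarrow> mon x (f + g) = mon x f * mon x g"
  by (simp add: mon_def power_int_add prod.distrib)

text \<open>Isotropy for \<open>L\<close> removes the twist from products in \<open>sp P\<close>;
  isotropy for \<open>W\<close> could leave signs.\<close>

lemma ev_mult:
  assumes x: "\<And>i. x i \<noteq> 0" and t: "t \<in> sp P" and u: "u \<in> sp P"
  shows "ev x (t * u) = ev x t * ev x u"
  using t
proof (induction rule: sp_induct)
  case (mono a f)
  from u show ?case
  proof (induction rule: sp_induct)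
    case (mono b g)
    have "q powi form L f g = 1" by (simp only: q_powi_eq_1_iff L_iso[OF \<open>f \<in> P\<close> \<open>g \<in> P\<close>])
    then show ?case using \<open>a \<in> A\<close> mono
      by (simp add: mono_mult ev_mono A_closed mon_add[OF x])
  next
    case (add y z)
    have "\<iota> a * M f * y \<in> T" "\<iota> a * M f * z \<in> T"
      by (rule T_mult[OF mono_T[OF \<open>a \<in> A\<close>] sp_T], fact)+
    with add show ?case by (simp add: distrib_left ev_add sp_T)
  qed (simp add: ev_0)
next
  case (add y z)
  have "y * u \<in> T" "z * u \<in> T" using add u sp_T T_mult by blast+
  with add show ?case by (simp add: distrib_right ev_add sp_T)
qed (simp add: ev_0)

lemma spP_subring: "unital_subring (sp P)"
  by (rule sp_subring) (simp add: additive_submonoid_def subgrp_0[OF P] subgrp_add[OF P])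

lemma ev_1: "ev x 1 = 1"
proof -
  have "mon x 0 = 1" by (simp add: mon_def)
  then show ?thesis using ev_mono[OF A_closed(2), of x 0] by (simp add: \<iota>_1 M_0)
qed

lemma ev_of_nat: "ev x (of_nat m) = of_nat m"
  by (induction m) (simp_all add: ev_0 ev_1 ev_add unital_subring_of_nat[OF T_subring] unital_subring_1[OF T_subring])

lemma ev_sign: "t \<in> T \<Longrightarrow> ev x ((-1) ^ j * t) = (-1) ^ j * ev x t"
  by (simp add: minus_one_power_iff ev_uminus)

text \<open>In characteristic 0 the number 2 is not a root of unity; it will separate the exponents
  of Laurent monomials.\<close>

lemma two_powi_inj: "(2::'c) powi a = 2 powi b \<Longrightarrow> a = b"
proof -
  have two: "(2::'c) \<noteq> 0" using char_0[of 1] by (simp add: numeral_2_eq_2)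
  have pow: "n = 0" if "(2::'c) ^ n = 1" for n
  proof (rule ccontr)
    assume "n \<noteq> 0"
    then have "(2::nat) ^ n \<ge> 2" by (cases n) auto
    then have m: "(2::nat) ^ n = Suc (Suc (2 ^ n - 2))" by linarith
    define m where "m = (2::nat) ^ n - 2"
    have "(of_nat (2 ^ n) :: 'c) = 1" using that by simp
    then have "of_nat (Suc (Suc m)) = (1::'c)" unfolding m_def m[symmetric] .
    then have "of_nat (Suc m) = (0::'c)" by (metis add_cancel_left_right of_nat_Suc)
    with char_0 show False by blast
  qed
  assume "(2::'c) powi a = 2 powi b"
  then have e: "(2::'c) powi (a - b) = 1" using two by (simp add: power_int_diff)
  then show "a = b"
  proof (cases "a \<ge> b")
    case True
    then have "(2::'c) ^ nat (a - b) = 1" using e by (simp add: power_int_def)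
    then show ?thesis using pow True by fastforce
  next
    case False
    then have "(2::'c) ^ nat (b - a) = 1" using e by (simp add: power_int_def power_divide)
    then show ?thesis using pow False by fastforce
  qed
qed

text \<open>Laurent monomials are pairwise different characters of the group of points with nonzero
  coordinates, hence independent.\<close>

lemma ev_faithful:
  assumes t: "t \<in> T" and zero: "\<And>x. (\<And>i. x i \<noteq> 0) \<Longrightarrow> ev x t = 0"
  shows "t = 0"
proof (rule ccontr)
  assume "t \<noteq> 0"
  then obtain f0 where f0: "coef t f0 \<noteq> 0" using coef_eq_0_iff[OF t] by blast
  let ?G = "{x :: 'n \<Rightarrow> 'c. \<forall>i. x i \<noteq> 0}"
  have "coef t f0 = 0"
  proof (rule characters_independent[of "{f. coef t f \<noteq> 0}" ?G "\<lambda>x y i. x i * y i" "\<lambda>f x. mon x f" "coef t" f0])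
    show "finite {f. coef t f \<noteq> 0}" by (rule finite_supp[OF t])
    show "mon (\<lambda>i. x i * y i) f = mon x f * mon y f" for x y f
      by (simp add: mon_def power_int_mult_distrib prod.distrib)
    show "\<exists>x\<in>?G. mon x f \<noteq> 0" for f
      by (intro bexI[of _ "\<lambda>_. 1"]) (auto simp: mon_def)
    show "\<exists>x\<in>?G. mon x f \<noteq> mon x g" if fg: "f \<noteq> g" for f g
    proof -
      obtain i where i: "f $ i \<noteq> g $ i" using fg by (auto simp: Finite_Cartesian_Product.vec_eq_iff)
      let ?x = "\<lambda>j. if j = i then 2 else (1::'c)"
      have "mon ?x h = 2 powi (h $ i)" for h
      proof -
        have "mon ?x h = (\<Prod>j\<in>UNIV. if j = i then 2 powi (h $ i) else 1)"
          unfolding mon_def by (intro prod.cong) auto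
        then show ?thesis by simp
      qed
      then have "mon ?x f \<noteq> mon ?x g" using two_powi_inj i by metis
      moreover have "(2::'c) \<noteq> 0" using char_0[of 1] by (simp add: numeral_2_eq_2)
      then have "?x \<in> ?G" by auto
      ultimately show ?thesis by blast
    qed
    show "(\<Sum>f | coef t f \<noteq> 0. coef t f * mon x f) = 0" if "x \<in> ?G" for x
      using zero[of x] that by (simp add: ev_def)
  qed (use f0 in \<open>auto simp: mult.commute\<close>)
  with f0 show False by contradiction
qed

definition mt :: "('n \<Rightarrow> 'c) \<Rightarrow> 'a \<Rightarrow> 'c mat" where
  "mt x a = mat dim dim (\<lambda>(i, j). ev x (\<rho> a i j))"

lemma \<rho>_T: "a \<in> T \<Longrightarrow> \<rho> a i j \<in> T"
  using \<rho>_in sp_T by blast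

lemma mt_power:
  assumes x: "\<And>i. x i \<noteq> 0" and a: "a \<in> T"
  shows "mt x (a ^ m) = mt x a ^\<^sub>m m"
proof (induction m)
  case 0
  show ?case by (rule eq_matI) (auto simp: mt_def \<rho>_1 ev_0 ev_1)
next
  case (Suc m)
  have am: "a ^ m \<in> T" by (rule unital_subring_power[OF T_subring a])
  have "mt x (a ^ m * a) = mt x (a ^ m) * mt x a"
  proof (rule eq_matI)
    fix i j assume "i < dim_row (mt x (a ^ m) * mt x a)" "j < dim_col (mt x (a ^ m) * mt x a)"
    then have ij: "i < dim" "j < dim" by (simp_all add: mt_def)
    have "ev x (\<rho> (a ^ m * a) i j) = (\<Sum>k<dim. ev x (\<rho> (a ^ m) i k * \<rho> a k j))"
      unfolding \<rho>_mult[OF am a] by (rule ev_sum) (rule T_mult[OF \<rho>_T[OF am] \<rho>_T[OF a]])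
    also have "\<dots> = (\<Sum>k<dim. ev x (\<rho> (a ^ m) i k) * ev x (\<rho> a k j))"
      by (intro sum.cong refl ev_mult[OF x \<rho>_in[OF am] \<rho>_in[OF a]])
    finally show "mt x (a ^ m * a) $$ (i, j) = (mt x (a ^ m) * mt x a) $$ (i, j)"
      using ij by (simp add: mt_def scalar_prod_def lessThan_atLeast0)
  qed (simp_all add: mt_def)
  then show ?case using Suc.IH by (simp add: power_commutes)
qed

lemma dim_pos: "dim > 0"
  unfolding index_def using finite_reps_P by (simp add: card_gt_0_iff)

lemma spK_subring: "unital_subring (sp K)"
  by (rule sp_subring) (simp add: additive_submonoid_def subgrp_0[OF subgrp_K] subgrp_add[OF subgrp_K])

text \<open>Evaluating \<open>\<rho> a\<close> at a point gives a matrix over a field whose power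
  traces are the values of \<open>s\<close>. Its Cayley-Hamilton identity says that all values of
  \<open>\<rho> y\<close> vanish, where \<open>y\<close> is \<open>dim!\<close> times the left side;
  \<open>ev_faithful\<close> and \<open>\<rho>_faithful\<close> bring this back to the
  torus.\<close>

theorem cayley_hamilton_identity:
  assumes a: "a \<in> T"
  shows "(\<Sum>i\<le>dim. (-1) ^ i * newton_poly (\<lambda>j. of_nat dim * proj K (a ^ j)) i * a ^ (dim - i)) = 0"
proof -
  define s where "s j = of_nat dim * proj K (a ^ j)" for j
  define N where "N i = of_nat (fact i) * newton_poly s i" for i
  note SK = unital_subring_sum[OF spK_subring] unital_subring_mult[OF spK_subring]
    unital_subring_of_nat[OF spK_subring] unital_subring_power[OF spK_subring]
    unital_subring_uminus[OF spK_subring] unital_subring_1[OF spK_subring]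
  have KP: "t \<in> sp P" if "t \<in> sp K" for t using sp_mono[OF K_sub] that by blast
  have aT: "a ^ j \<in> T" for j by (rule unital_subring_power[OF T_subring a])
  have sK: "s j \<in> sp K" for j unfolding s_def by (intro SK proj_in aT)
  have sign_K: "(-1) ^ j * t \<in> sp K" if "t \<in> sp K" for j t
    using that by (intro SK) auto
  \<comment> \<open>The recursion of \<open>newton_poly_scaled\<close> gives membership in the
    center and compatibility with evaluation at once.\<close>
  have N: "N i \<in> sp K \<and> (\<forall>x. (\<forall>i. x i \<noteq> 0) \<longrightarrow> ev x (N i) = of_nat (fact i) * newton_poly (\<lambda>j. ev x (s j)) i)" for i
  proof (induction i rule: less_induct)
    case (less i)
    show ?case
    proof (cases i)
      case 0
      then show ?thesis by (simp add: N_def ev_1 SK)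
    next
      case (Suc m)
      let ?t = "\<lambda>j. of_nat (fact m div fact (m - j)) * N (m - j) * s (Suc j)"
      have Ns: "N i = (\<Sum>j\<le>m. (-1) ^ j * ?t j)"
        unfolding N_def Suc by (rule newton_poly_scaled[OF of_nat_nonzero]) simp
      have NK: "N (m - j) \<in> sp K" for j using less.IH[of "m - j"] Suc by simp
      have tK: "?t j \<in> sp K" for j by (intro SK NK sK)
      have 1: "N i \<in> sp K" unfolding Ns by (intro SK(1) sign_K tK)
      have 2: "ev x (N i) = of_nat (fact i) * newton_poly (\<lambda>j. ev x (s j)) i" if x: "\<forall>i. x i \<noteq> 0" for x
      proof -
        have evt: "ev x (?t j) = of_nat (fact m div fact (m - j)) *
            (of_nat (fact (m - j)) * newton_poly (\<lambda>j. ev x (s j)) (m - j)) * ev x (s (Suc j))" for j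
        proof -
          have "ev x (?t j) = of_nat (fact m div fact (m - j)) * ev x (N (m - j)) * ev x (s (Suc j))"
            unfolding ev_mult[where x = x, OF spec[OF x] KP[OF SK(2)[OF SK(3) NK]] KP[OF sK]]
              ev_mult[where x = x, OF spec[OF x] KP[OF SK(3)] KP[OF NK]] ev_of_nat ..
          then show ?thesis using less.IH[of "m - j"] Suc x by simp
        qed
        have "ev x (N i) = (\<Sum>j\<le>m. (-1) ^ j * ev x (?t j))"
          unfolding Ns by (subst ev_sum) (auto intro!: sp_T[OF sign_K] sp_T[OF tK] tK simp only: ev_sign[OF sp_T[OF tK]])
        also have "\<dots> = of_nat (fact (Suc m)) * newton_poly (\<lambda>j. ev x (s j)) (Suc m)"
          unfolding newton_poly_scaled[OF char_0] evt ..
        finally show ?thesis by (simp only: Suc)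
      qed
      show ?thesis using 1 2 by blast
    qed
  qed
  \<comment> \<open>The numbers \<open>dim! / i!\<close> bring the differently scaled
    \<open>N i\<close> to the common factor \<open>dim!\<close>.\<close>
  define c where "c i = (-1) ^ i * (of_nat (fact dim div fact i) * N i)" for i
  have cK: "c i \<in> sp K" for i unfolding c_def using N by (intro sign_K SK) blast
  define y where "y = (\<Sum>i\<le>dim. c i * a ^ (dim - i))"
  have cT: "c i * a ^ (dim - i) \<in> T" for i by (rule T_mult[OF sp_T[OF cK] aT])
  have yT: "y \<in> T" unfolding y_def by (intro sp_sum cT)
  have \<rho>y: "\<rho> y i j = (\<Sum>m\<le>dim. c m * \<rho> (a ^ (dim - m)) i j)" for i j
  proof -
    have "\<rho> (\<Sum>m\<in>S. c m * a ^ (dim - m)) i j = (\<Sum>m\<in>S. c m * \<rho> (a ^ (dim - m)) i j)" if "finite S" for S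
      using that
    proof induction
      case empty
      show ?case using \<rho>_central[OF sp_0 sp_0, of i j] by simp
    next
      case (insert m S)
      then show ?case by (simp add: \<rho>_add cT sp_sum \<rho>_central[OF cK aT])
    qed
    then show ?thesis unfolding y_def by simp
  qed
  have "y = 0"
  proof (rule \<rho>_faithful[OF yT _ dim_pos])
    fix i j assume ij: "i < dim" "j < dim"
    show "\<rho> y i j = 0"
    proof (rule ev_faithful[OF \<rho>_T[OF yT]])
      fix x :: "'n \<Rightarrow> 'c" assume x: "\<And>i. x i \<noteq> 0"
      have car: "mt x a \<in> carrier_mat dim dim" by (simp add: mt_def)
      have entry: "ev x (\<rho> (a ^ m) i j) = (mt x a ^\<^sub>m m) $$ (i, j)" if "i < dim" "j < dim" for m i j
        unfolding mt_power[where x = x, OF x a, symmetric] using that by (simp add: mt_def)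
      have tr: "(\<Sum>b<dim. (mt x a ^\<^sub>m m) $$ (b, b)) = ev x (s m)" for m
      proof -
        have "(\<Sum>b<dim. (mt x a ^\<^sub>m m) $$ (b, b)) = (\<Sum>b<dim. ev x (\<rho> (a ^ m) b b))"
          by (intro sum.cong refl) (simp add: entry)
        also have "\<dots> = ev x (\<Sum>b<dim. \<rho> (a ^ m) b b)" by (rule ev_sum[symmetric]) (rule \<rho>_T[OF aT])
        also have "\<dots> = ev x (s m)" unfolding s_def \<rho>_trace[OF aT] ..
        finally show ?thesis .
      qed
      have "ev x (\<rho> y i j) = (\<Sum>m\<le>dim. ev x (c m * \<rho> (a ^ (dim - m)) i j))"
        unfolding \<rho>y by (rule ev_sum) (rule T_mult[OF sp_T[OF cK] \<rho>_T[OF aT]])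
      also have "\<dots> = (\<Sum>m\<le>dim. of_nat (fact dim) * ((-1) ^ m * newton_poly (\<lambda>j. ev x (s j)) m * (mt x a ^\<^sub>m (dim - m)) $$ (i, j)))"
      proof (rule sum.cong[OF refl])
        fix m assume m: "m \<in> {..dim}"
        have "ev x (c m) = (-1) ^ m * (of_nat (fact dim div fact m) * ev x (N m))"
        proof -
          have NP: "N m \<in> sp P" using N KP by blast
          have "ev x (of_nat (fact dim div fact m) * N m) = of_nat (fact dim div fact m) * ev x (N m)"
            using ev_mult[where x = x, OF x KP[OF SK(3)] NP] by (simp only: ev_of_nat)
          then show ?thesis unfolding c_def
            using ev_sign[OF sp_T[OF unital_subring_mult[OF spP_subring KP[OF SK(3)] NP]]] by simp
        qed
        also have "\<dots> = of_nat (fact dim) * ((-1) ^ m * newton_poly (\<lambda>j. ev x (s j)) m)"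
          using N[of m] x of_nat_fact_split[of m dim, where 'b = 'c] m by simp
        finally have "ev x (c m) = of_nat (fact dim) * ((-1) ^ m * newton_poly (\<lambda>j. ev x (s j)) m)" .
        moreover have "ev x (c m * \<rho> (a ^ (dim - m)) i j) = ev x (c m) * ev x (\<rho> (a ^ (dim - m)) i j)"
          by (rule ev_mult[where x = x, OF x KP[OF cK] \<rho>_in[OF aT]])
        ultimately show "ev x (c m * \<rho> (a ^ (dim - m)) i j) =
            of_nat (fact dim) * ((-1) ^ m * newton_poly (\<lambda>j. ev x (s j)) m * (mt x a ^\<^sub>m (dim - m)) $$ (i, j))"
          by (simp add: entry[OF ij] mult.assoc)
      qed
      also have "\<dots> = 0"
        using cayley_hamilton_newton[OF car char_0 ij] unfolding tr sum_distrib_left[symmetric] by simp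
      finally show "ev x (\<rho> y i j) = 0" .
    qed
  qed
  moreover have "y = of_nat (fact dim) * (\<Sum>i\<le>dim. (-1) ^ i * newton_poly s i * a ^ (dim - i))"
    unfolding y_def sum_distrib_left
  proof (rule sum.cong[OF refl])
    fix i assume "i \<in> {..dim}"
    then have "c i = (-1) ^ i * (of_nat (fact dim) * newton_poly s i)"
      using of_nat_fact_split[of i dim, where 'b = 'a] by (simp add: c_def N_def mult.assoc)
    then have "c i = of_nat (fact dim) * ((-1) ^ i * newton_poly s i)"
      by (simp add: minus_one_power_iff)
    then show "c i * a ^ (dim - i) = of_nat (fact dim) * ((-1) ^ i * newton_poly s i * a ^ (dim - i))"
      by (simp only: mult.assoc)
  qed
  moreover have "of_nat (fact dim) \<noteq> (0::'a)" by (rule of_nat_nonzero) simp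
  ultimately show ?thesis by (simp add: s_def[abs_def])
qed

end

section \<open>Cayley-Hamilton triples in the torus, and the trace on the division ring\<close>

context quantum_torus
begin

text \<open>If \<open>f + g\<close> is in \<open>K\<close>, then \<open>form W f g\<close> vanishes
  modulo \<open>l\<close>, along with \<open>form W f (f + g)\<close> and \<open>form W f f\<close>.
  So \<open>form L f g\<close> is congruent to its negative, hence to \<open>form L g f\<close>. If
  \<open>f + g\<close> is not in \<open>K\<close>, both sides are 0.\<close>

lemma proj_K_commute:
  assumes "x \<in> T" "y \<in> T"
  shows "proj K (x * y) = proj K (y * x)"
  using assms(1)
proof (induction rule: sp_induct)
  case (mono a f)
  from assms(2) show ?case
  proof (induction rule: sp_induct)
    case (mono b g)
    have eq: "q powi form L f g = q powi form L g f" if "f + g \<in> K"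
    proof (rule q_powi_cong)
      have "int l dvd form W f (f + g)" using that by (simp add: K_iff)
      then have "int l dvd form W f g"
        using dvd_form_diag[OF skew_W, of f] by (simp add: form_add_right dvd_add_right_iff)
      then have "[form L f g + form L f g = 0] (mod int l)" by (simp add: form_W cong_0_iff)
      then have "[form L f g = - form L f g] (mod int l)"
        by (simp add: cong_iff_dvd_diff)
      then show "[form L f g = form L g f] (mod int l)"
        by (rule cong_trans[OF _ cong_sym[OF form_skew[OF skew]]])
    qed
    have "(\<iota> a * M f) * (\<iota> b * M g) = \<iota> (a * b * q powi form L f g) * M (f + g)"
      "(\<iota> b * M g) * (\<iota> a * M f) = \<iota> (a * b * q powi form L g f) * M (f + g)"
      using mono_mult[OF \<open>a \<in> A\<close> \<open>b \<in> A\<close>] mono_mult[OF \<open>b \<in> A\<close> \<open>a \<in> A\<close>]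
      by (simp_all only: add.commute[of g f] mult.commute[of b a])
    note products = this
    have in_A: "a * b * q powi n \<in> A" for n
      by (intro A_closed(5) q_powi_in \<open>a \<in> A\<close> \<open>b \<in> A\<close>)
    show ?case
    proof (cases "f + g \<in> K")
      case True
      then show ?thesis by (simp only: products eq)
    next
      case False
      then show ?thesis by (simp only: products proj_mono[OF in_A] if_False)
    qed
  next
    case (add y z)
    have "\<iota> a * M f * y \<in> T" "\<iota> a * M f * z \<in> T" "y * (\<iota> a * M f) \<in> T" "z * (\<iota> a * M f) \<in> T"
      by (rule T_mult[OF mono_T[OF \<open>a \<in> A\<close>]] T_mult[OF _ mono_T[OF \<open>a \<in> A\<close>]], fact)+
    with add show ?case by (simp add: distrib_left distrib_right proj_add)
  qed simp
next
  case (add x z)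
  have "x * y \<in> T" "z * y \<in> T" "y * x \<in> T" "y * z \<in> T" using add assms T_mult by blast+
  with add show ?case by (simp add: distrib_left distrib_right proj_add)
qed simp

lemma proj_K_central:
  assumes "z \<in> sp K" "x \<in> T"
  shows "proj K (z * x) = z * proj K x"
  by (rule proj_central[OF assms]) (rule subgrp_add_iff[OF subgrp_K])

text \<open>The equality of kernels enters twice: it places \<open>K\<close> inside a
  self-orthogonal subgroup for \<open>L\<close>, and it makes the index of that subgroup equal to
  \<open>d\<close>.\<close>

lemma cayley_hamilton_T:
  assumes ker: "frame_kernel l (L + L) = frame_kernel l L" and d: "d * d = index K" and a: "a \<in> T"
  shows "(\<Sum>i\<le>d. (-1) ^ i * newton_poly (\<lambda>j. of_nat d * proj K (a ^ j)) i * a ^ (d - i)) = 0"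
proof -
  obtain P where lag: "lagrangian l L P" using lagrangian_exists[OF l_pos skew] .
  have sP: "subgrp P" using lag unfolding lagrangian_def by (rule conjunct1)
  have K: "K = frame_kernel l L" using ker by (simp add: K_def W_def)
  have KP: "K \<subseteq> P" unfolding K by (rule lagrangian_kernel[OF skew lag])
  have iso: "int l dvd form L f g" if "f \<in> P" "g \<in> P" for f g using lag that unfolding lagrangian_def by metis
  interpret torus_eval q l A \<iota> M L P
    by unfold_locales (simp_all add: sP KP iso form_W)
  have "index P * index P = d * d"
    using index_lagrangian_aux(2)[OF skew lag] d K by simp
  then have "index P = d" by (metis power2_eq_square power2_eq_iff_nonneg zero_le)
  then show ?thesis using cayley_hamilton_identity[OF a] by simp
qed

text \<open>The identity is inherited from the torus. What remains of \<open>C\<close> is to contain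
  the traces and to consist of central elements of the torus; this serves single subalgebras and
  intersections alike.\<close>

lemma cayley_hamilton_subring:
  assumes ker: "frame_kernel l (L + L) = frame_kernel l L" and d: "d * d = index K"
    and R: "unital_subring R" "R \<subseteq> T" and C: "unital_subring C" "C \<subseteq> R" "C \<subseteq> sp K" "\<iota> ` A \<subseteq> C"
    and tr: "\<And>x. x \<in> R \<Longrightarrow> of_nat d * proj K x \<in> C"
  shows "cayley_hamilton d (\<iota> ` A) R C (reduced_trace T)"
proof -
  have rt: "reduced_trace T x = of_nat d * proj K x" if "x \<in> R" for x
    using reduced_trace_T[OF d] R(2) that by blast
  have RT: "x \<in> T" if "x \<in> R" for x using R(2) that by blast
  have k: "unital_subring (\<iota> ` A)"
    unfolding unital_subring_def
  proof (intro conjI ballI)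
    show "1 \<in> \<iota> ` A" using A_closed(2) by (intro image_eqI[of _ _ 1]) (simp_all add: \<iota>_1)
    fix x y assume "x \<in> \<iota> ` A" "y \<in> \<iota> ` A"
    then obtain a b where "x = \<iota> a" "y = \<iota> b" "a \<in> A" "b \<in> A" by blast
    then show "x - y \<in> \<iota> ` A" "x * y \<in> \<iota> ` A"
      using A_closed(4)[of a b] A_closed(5)[of a b] by (auto simp: \<iota>_diff[symmetric] \<iota>_mult[symmetric])
  qed
  have pow: "x ^ j \<in> R" if "x \<in> R" for x j by (rule unital_subring_power[OF R(1) that])
  have "algebra_with_trace (\<iota> ` A) R C (reduced_trace T)"
    unfolding algebra_with_trace_def subalgebra_over_def
  proof (intro conjI ballI)
    show cen: "C \<subseteq> center_of R" using C(2,3) spK_central by (auto simp: center_of_def)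
    show "\<iota> ` A \<subseteq> center_of R" using cen C(4) by blast
    show "\<iota> ` A \<subseteq> R" using C(2,4) by blast
    show "\<iota> ` A \<subseteq> C" by (rule C(4))
  next
    fix x assume x: "x \<in> R"
    show "reduced_trace T x \<in> C" using tr[OF x] rt[OF x] by simp
    fix y assume y: "y \<in> R"
    show "reduced_trace T (x + y) = reduced_trace T x + reduced_trace T y"
      using x y by (simp add: rt unital_subring_add[OF R(1)] proj_add RT distrib_left)
    show "reduced_trace T (x * y) = reduced_trace T (y * x)"
      using x y by (simp add: rt unital_subring_mult[OF R(1)] proj_K_commute[OF RT RT])
  next
    fix c x assume c: "c \<in> C" and x: "x \<in> R"
    have "of_nat d * (c * proj K x) = c * (of_nat d * proj K x)"
      using of_nat_commute[of d c] by (metis mult.assoc)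
    moreover have "c * x \<in> R" "c \<in> sp K" using c x C unital_subring_mult[OF R(1)] by blast+
    ultimately show "reduced_trace T (c * x) = c * reduced_trace T x"
      using x by (simp add: rt proj_K_central RT)
  qed (rule k R C)+
  moreover have "of_nat m * x = 0 \<longrightarrow> x = 0" if "m \<in> {1..d}" for m and x :: 'a
    using of_nat_nonzero[of m] that by simp
  moreover have "(\<Sum>i\<le>d. (-1) ^ i * newton_poly (\<lambda>j. reduced_trace T (x ^ j)) i * x ^ (d - i)) = 0" if "x \<in> R" for x
    using cayley_hamilton_T[OF ker d RT[OF that]] pow[OF that] by (simp add: rt)
  moreover have "reduced_trace T 1 = of_nat d"
    using rt[OF unital_subring_1[OF R(1)]] proj_id[OF M_in_sp[OF subgrp_0[OF subgrp_K]]] by (simp add: M_0)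
  ultimately show ?thesis unfolding cayley_hamilton_def by blast
qed

lemma T_in_denominator:
  assumes "finite S"
  shows "\<exists>z\<in>sp K. z \<noteq> 0 \<and> (\<forall>x\<in>S. z * x \<in> T)"
  using assms
proof induction
  case empty
  show ?case using M_in_sp[OF subgrp_0[OF subgrp_K]] by (intro bexI[of _ 1]) (auto simp: M_0)
next
  case (insert x S)
  then obtain z where z: "z \<in> sp K" "z \<noteq> 0" "\<forall>x\<in>S. z * x \<in> T" by blast
  obtain z' where z': "z' \<in> sp K" "z' \<noteq> 0" "z' * x \<in> T" by (rule central_fraction)
  have zz: "z * z' \<in> sp K" by (rule sp_mult[OF z(1) z'(1)]) (rule subgrp_add[OF subgrp_K])
  have "z * z' * y \<in> T" if "y \<in> insert x S" for y
  proof (cases "y = x")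
    case True
    then show ?thesis using T_mult[OF sp_T[OF z(1)] z'(3)] by (simp add: mult.assoc)
  next
    case False
    then have "z' * (z * y) \<in> T" using that z by (intro T_mult[OF sp_T[OF z'(1)]]) auto
    moreover have "z * z' * y = z' * (z * y)" using spK_central[OF z(1), of z'] by (metis mult.assoc)
    ultimately show ?thesis by simp
  qed
  then show ?case using zz z(2) z'(2) by (intro bexI[of _ "z * z'"]) auto
qed

text \<open>The tori of two frames need not contain one another, so they are compared through a
  trace on the whole division ring. \<open>fraction_proj_eq\<close> shows independence of the chosen
  denominator.\<close>

definition fraction_proj :: "'a \<Rightarrow> 'a" where
  "fraction_proj x = (let z = (SOME z. z \<in> sp K \<and> z \<noteq> 0 \<and> z * x \<in> T) in inverse z * proj K (z * x))"

lemma fraction_proj_eq: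
  assumes z: "z \<in> sp K" "z \<noteq> 0" "z * x \<in> T"
  shows "fraction_proj x = inverse z * proj K (z * x)"
proof -
  define y where "y = (SOME z. z \<in> sp K \<and> z \<noteq> 0 \<and> z * x \<in> T)"
  have y: "y \<in> sp K" "y \<noteq> 0" "y * x \<in> T"
    using someI[of "\<lambda>z. z \<in> sp K \<and> z \<noteq> 0 \<and> z * x \<in> T" z] z unfolding y_def by auto
  have "z * proj K (y * x) = proj K (z * (y * x))" by (rule proj_K_central[OF z(1) y(3), symmetric])
  also have "z * (y * x) = y * (z * x)" using spK_central[OF z(1), of y] by (metis mult.assoc)
  also have "proj K (y * (z * x)) = y * proj K (z * x)" by (rule proj_K_central[OF y(1) z(3)])
  finally have e: "z * proj K (y * x) = y * proj K (z * x)" .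
  have "inverse y * proj K (y * x) = inverse y * (inverse z * (z * proj K (y * x)))"
    using z(2) by (simp add: mult.assoc[symmetric])
  also have "\<dots> = inverse z * (inverse y * (y * proj K (z * x)))"
    unfolding e using commute_inverse[of "inverse z" y] commute_inverse[of y z] spK_central[OF y(1), of z]
    by (metis mult.assoc)
  also have "\<dots> = inverse z * proj K (z * x)" using y(2) by (simp add: mult.assoc[symmetric])
  finally show ?thesis unfolding fraction_proj_def Let_def y_def .
qed

lemma fraction_proj_T: "x \<in> T \<Longrightarrow> fraction_proj x = proj K x"
  using fraction_proj_eq[of 1 x] M_in_sp[OF subgrp_0[OF subgrp_K]] by (simp add: M_0)

lemma fraction_proj_add: "fraction_proj (x + y) = fraction_proj x + fraction_proj y"
proof -
  obtain z where "z \<in> sp K" "z \<noteq> 0" "z * x \<in> T" "z * y \<in> T"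
    using T_in_denominator[of "{x, y}"] by auto
  then show ?thesis using fraction_proj_eq[of z x] fraction_proj_eq[of z y] fraction_proj_eq[of z "x + y"]
    by (simp add: distrib_left add_T proj_add)
qed

lemma fraction_proj_commute: "fraction_proj (x * y) = fraction_proj (y * x)"
proof -
  obtain z where z: "z \<in> sp K" "z \<noteq> 0" "z * x \<in> T" "z * y \<in> T"
    using T_in_denominator[of "{x, y}"] by auto
  have e: "(z * z) * (x * y) = (z * x) * (z * y)" "(z * z) * (y * x) = (z * y) * (z * x)"
    using spK_central[OF z(1), of x] spK_central[OF z(1), of y] by (metis mult.assoc)+
  have zz: "z * z \<in> sp K" "z * z \<noteq> 0" using z sp_mult[OF z(1) z(1) subgrp_add[OF subgrp_K]] by auto
  show ?thesis
    using fraction_proj_eq[OF zz, of "x * y"] fraction_proj_eq[OF zz, of "y * x"] T_mult[OF z(3,4)] T_mult[OF z(4,3)]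
      proj_K_commute[OF z(3,4)] by (simp only: e)
qed

text \<open>The factor \<open>c\<close> commutes with everything but need not lie in this torus, as
  it may come from the center of another one. Its multiple \<open>z * c\<close> is in the torus and
  central there, hence in \<open>sp K\<close>.\<close>

lemma fraction_proj_central:
  assumes c: "\<And>y. c * y = y * c"
  shows "fraction_proj (c * x) = c * fraction_proj x"
proof -
  obtain z where z: "z \<in> sp K" "z \<noteq> 0" "z * c \<in> T" "z * x \<in> T"
    using T_in_denominator[of "{c, x}"] by auto
  have "(z * c) * y = y * (z * c)" for y
    using c[of y] spK_central[OF z(1), of y] by (metis mult.assoc)
  then have zc: "z * c \<in> sp K" using z(3) unfolding center_T[symmetric] center_of_def by blast
  have e: "(z * z) * (c * x) = (z * c) * (z * x)"
    using spK_central[OF z(1), of c] by (metis mult.assoc)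
  have zz: "z * z \<in> sp K" "z * z \<noteq> 0" using z sp_mult[OF z(1) z(1) subgrp_add[OF subgrp_K]] by auto
  have "fraction_proj (c * x) = inverse (z * z) * proj K ((z * c) * (z * x))"
    using fraction_proj_eq[OF zz, of "c * x"] T_mult[OF z(3,4)] by (simp only: e)
  also have "proj K ((z * c) * (z * x)) = (z * c) * proj K (z * x)" by (rule proj_K_central[OF zc z(4)])
  also have "inverse (z * z) * ((z * c) * proj K (z * x)) = inverse z * (c * proj K (z * x))"
    using z(2) by (simp add: nonzero_inverse_mult_distrib mult.assoc[symmetric]) (simp add: mult.assoc)
  also have "\<dots> = c * (inverse z * proj K (z * x))" using c[of "inverse z"] by (metis mult.assoc)
  also have "\<dots> = c * fraction_proj x" using fraction_proj_eq[OF z(1,2,4)] by simp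
  finally show ?thesis .
qed

end

text \<open>\<open>a.fraction_proj\<close> is a trace on the second torus, takes 1 to 1, and is
  linear over the center of that torus because this center is central in the division ring.
  \<open>b.trace_unique\<close> identifies it with the projection there.\<close>

lemma projections_agree:
  assumes "quantum_torus q l A \<iota> M L" "quantum_torus q l A \<iota> M' L'"
    and x: "x \<in> quantum_torus.sp A \<iota> M UNIV" "x \<in> quantum_torus.sp A \<iota> M' UNIV"
  shows "quantum_torus.proj A \<iota> M (quantum_torus.K l L) x = quantum_torus.proj A \<iota> M' (quantum_torus.K l L') x"
proof -
  interpret a: quantum_torus q l A \<iota> M L by fact
  interpret b: quantum_torus q l A \<iota> M' L' by fact
  have "a.fraction_proj x = b.proj b.K x * a.fraction_proj 1"
    by (rule b.trace_unique[OF a.fraction_proj_add a.fraction_proj_commute a.fraction_proj_central[OF b.spK_central] x(2)])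
  moreover have one: "1 \<in> a.sp a.K" using a.M_in_sp[OF subgrp_0[OF a.subgrp_K]] by (simp add: a.M_0)
  then have "a.fraction_proj 1 = 1" using a.fraction_proj_T[OF a.sp_T[OF one]] a.proj_id[OF one] by simp
  ultimately show ?thesis using a.fraction_proj_T[OF x(1)] by simp
qed

section \<open>The coefficient ring\<close>

lemma base_ring_hom:
  fixes q :: "'k::idom fract alg_closure"
  defines "E \<equiv> \<lambda>p :: 'k poly. poly (map_poly (\<lambda>a. to_ac (to_fract a)) p) q"
  shows "E (p + r) = E p + E r" and "E (p * r) = E p * E r" and "E (- p) = - E p"
    and "E [:a:] = to_ac (to_fract a)" and "E [:0, 1:] = q"
proof -
  have pC: "E (pCons a p) = to_ac (to_fract a) + q * E p" for a p
    unfolding E_def by (subst Polynomial.map_poly_pCons) simp_all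
  have E0: "E 0 = 0" by (simp add: E_def)
  show add: "E (p + r) = E p + E r" for p r
    by (induction p r rule: poly_induct2) (simp_all add: pC E0 algebra_simps)
  have smult: "E (Polynomial.smult a p) = to_ac (to_fract a) * E p" for a p
    by (induction p) (simp_all add: pC E0 algebra_simps)
  show "E (p * r) = E p * E r"
    by (induction p) (simp_all add: pC E0 add smult algebra_simps)
  show "E (- p) = - E p"
    using add[of p "- p"] E0 by (simp add: eq_neg_iff_add_eq_0 add.commute)
  show "E [:a:] = to_ac (to_fract a)" by (simp add: pC E0)
  show "E [:0, 1:] = q" by (simp add: pC E0)
qed

lemma base_ring_subring: "unital_subring (base_ring q)" and q_in_base_ring: "q \<in> base_ring q"
proof -
  let ?E = "\<lambda>p. poly (map_poly (\<lambda>a. to_ac (to_fract a)) p) q"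
  have one: "1 = ?E [:1:]" unfolding base_ring_hom by simp
  have diff: "?E p - ?E r = ?E (p + - r)" for p r unfolding base_ring_hom by simp
  have mult: "?E p * ?E r = ?E (p * r)" for p r unfolding base_ring_hom ..
  show "unital_subring (base_ring q)"
    unfolding unital_subring_def base_ring_def
  proof (intro conjI ballI)
    show "1 \<in> range ?E" using rangeI[of ?E "[:1:]"] unfolding one[symmetric] .
    fix x y assume "x \<in> range ?E" "y \<in> range ?E"
    then obtain p r where xy: "x = ?E p" "y = ?E r" by blast
    show "x - y \<in> range ?E" using rangeI[of ?E "p + - r"] unfolding xy diff[symmetric] .
    show "x * y \<in> range ?E" using rangeI[of ?E "p * r"] unfolding xy mult[symmetric] .
  qed
  have "q = ?E [:0, 1:]" unfolding base_ring_hom ..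
  then show "q \<in> base_ring q" unfolding base_ring_def by (rule range_eqI)
qed

lemma of_nat_alg_closure_nonzero:
  "of_nat (Suc m) \<noteq> (0 :: 'k::{idom, ring_char_0} fract alg_closure)"
proof -
  have "to_fract (of_nat n :: 'k) = of_nat n" for n by (induction n) simp_all
  then have "(of_nat n :: 'k fract alg_closure) = to_ac (to_fract (of_nat n))" for n
    by simp
  then have "(of_nat (Suc m) :: 'k fract alg_closure) = 0 \<longleftrightarrow> (of_nat (Suc m) :: 'k) = 0"
    by (metis to_ac_eq_0_iff to_fract_eq_0_iff)
  then show ?thesis using of_nat_neq_0 by blast
qed

lemma toric_frame_quantum_torus:
  fixes q :: "'k::{idom, ring_char_0} fract alg_closure" and M :: "int ^ 'n::finite \<Rightarrow> 'a::division_ring"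
  assumes "l > 0" "primitive_root_of_unity l q" "algebra_structure (base_ring q) \<iota>"
    and M: "toric_frame q \<iota> l M L"
  shows "quantum_torus q l (base_ring q) \<iota> M L"
proof
  note t = M[unfolded toric_frame_def monomial_span_def]
  show "skew_symmetric_mod l L" by (rule conjunct1[OF t])
  show "M 0 = 1" by (rule conjunct1[OF conjunct2[OF t]])
  note t2 = conjunct2[OF conjunct2[OF t]]
  show "M f * M g = \<iota> (q powi form L f g) * M (f + g)" for f g
    by (rule conjunct1[OF t2, THEN spec, THEN spec])
  show "c f = 0" if "finite S" "c ` S \<subseteq> base_ring q" "(\<Sum>f\<in>S. \<iota> (c f) * M f) = 0" "f \<in> S" for S c f
    using conjunct1[OF conjunct2[OF t2]] that by metis
  show "has_fractions {\<Sum>f\<in>S. \<iota> (c f) * M f |S c. finite S \<and> S \<subseteq> UNIV \<and> c ` S \<subseteq> base_ring q} UNIV"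
    by (rule conjunct2[OF conjunct2[OF t2]])
qed (rule assms base_ring_subring q_in_base_ring of_nat_alg_closure_nonzero)+

section \<open>Mutations\<close>

text \<open>Keeps the symmetrizer \<open>d\<close> fixed along a sequence of mutations; it
  guarantees that the diagonal entry at \<open>k\<close> is 0 in every exchange matrix met on the
  way.\<close>

lemma mutate_matrix_exchange:
  assumes B: "exchange_matrix ex d B" and k: "k \<in> ex"
  shows "exchange_matrix ex d (mutate_matrix k B)"
proof -
  have cols: "j \<notin> ex \<Longrightarrow> B $ i $ j = 0" and dpos: "j \<in> ex \<Longrightarrow> d j > 0"
    and sk: "i \<in> ex \<Longrightarrow> j \<in> ex \<Longrightarrow> d i * B $ i $ j = - (d j * B $ j $ i)" for i j
    using B unfolding exchange_matrix_def by metis+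
  have "mutate_matrix k B $ i $ j = 0" if "j \<notin> ex" for i j
    using cols[OF that] k that by (auto simp: mutate_matrix_def)
  moreover have "d i * mutate_matrix k B $ i $ j = - (d j * mutate_matrix k B $ j $ i)"
    if i: "i \<in> ex" and j: "j \<in> ex" for i j
  proof (cases "i = k \<or> j = k")
    case True
    then show ?thesis using sk[OF i j] by (auto simp: mutate_matrix_def)
  next
    case False
    define h where "h i j = \<bar>B $ i $ k\<bar> * B $ k $ j + B $ i $ k * \<bar>B $ k $ j\<bar>" for i j
    \<comment> \<open>The division by 2 in the mutation rule is exact, so it can be undone.\<close>
    have half: "2 * (h i j div 2) = h i j" for i j
    proof -
      have "even (h i j)" unfolding h_def by (cases "even (B $ i $ k)"; cases "even (B $ k $ j)") auto
      then show ?thesis by simp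
    qed
    have ik: "d i * B $ i $ k = - (d k * B $ k $ i)" and kj: "d k * B $ k $ j = - (d j * B $ j $ k)"
      using sk[OF i k] sk[OF k j] by auto
    have aik: "d i * \<bar>B $ i $ k\<bar> = d k * \<bar>B $ k $ i\<bar>"
      using arg_cong[OF ik, of abs] dpos[OF i] dpos[OF k] by (simp add: abs_mult)
    have akj: "d k * \<bar>B $ k $ j\<bar> = d j * \<bar>B $ j $ k\<bar>"
      using arg_cong[OF kj, of abs] dpos[OF j] dpos[OF k] by (simp add: abs_mult)
    have "d i * h i j = (d i * \<bar>B $ i $ k\<bar>) * B $ k $ j + (d i * B $ i $ k) * \<bar>B $ k $ j\<bar>"
      by (simp add: h_def distrib_left mult.assoc)
    also have "\<dots> = \<bar>B $ k $ i\<bar> * (d k * B $ k $ j) - B $ k $ i * (d k * \<bar>B $ k $ j\<bar>)"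
      unfolding aik ik by (simp add: mult_ac)
    also have "\<dots> = - (d j * h j i)"
      unfolding kj akj h_def by (simp add: algebra_simps)
    finally have "d i * (2 * (h i j div 2)) = - (d j * (2 * (h j i div 2)))" unfolding half .
    then have "2 * (d i * u) = 2 * - (d j * v)" if "u = h i j div 2" "v = h j i div 2" for u v
      unfolding that by (simp only: mult.left_commute[of _ 2] mult_minus_right)
    then have "d i * u = - (d j * v)" if "u = h i j div 2" "v = h j i div 2" for u v
      using that by (metis mult_left_cancel zero_neq_numeral)
    then have "d i * (h i j div 2) = - (d j * (h j i div 2))" by blast
    then show ?thesis using False sk[OF i j] by (simp add: mutate_matrix_def h_def distrib_left)
  qed
  ultimately show ?thesis using dpos unfolding exchange_matrix_def by blast
qed

text \<open>Congruence after an automorphism of the lattice. It also relates two integer matrices of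
  one frame, which need only give congruent forms.\<close>

definition equivalent_forms :: "nat \<Rightarrow> int ^ 'n ^ 'n \<Rightarrow> int ^ 'n ^ 'n \<Rightarrow> bool" where
  "equivalent_forms l L L' \<longleftrightarrow> (\<exists>e. bij e \<and> (\<forall>f g. e (f - g) = e f - e g) \<and>
     (\<forall>f g. [form L' f g = form L (e f) (e g)] (mod int l)))"

lemma equivalent_forms_trans:
  assumes "equivalent_forms l L L'" "equivalent_forms l L' L''"
  shows "equivalent_forms l L L''"
proof -
  obtain e where e: "bij e" "\<forall>f g. e (f - g) = e f - e g" "\<forall>f g. [form L' f g = form L (e f) (e g)] (mod int l)"
    using assms(1) unfolding equivalent_forms_def by blast
  obtain e' where e': "bij e'" "\<forall>f g. e' (f - g) = e' f - e' g" "\<forall>f g. [form L'' f g = form L' (e' f) (e' g)] (mod int l)"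
    using assms(2) unfolding equivalent_forms_def by blast
  have "[form L'' f g = form L ((e \<circ> e') f) ((e \<circ> e') g)] (mod int l)" for f g
    using cong_trans[OF e'(3)[rule_format] e(3)[rule_format]] by simp
  then show ?thesis
    unfolding equivalent_forms_def using e e' bij_comp[OF e'(1) e(1)]
    by (intro exI[of _ "e \<circ> e'"]) simp
qed

lemma equivalent_forms_cong:
  assumes "\<And>f g. [form L' f g = form L f g] (mod int l)"
  shows "equivalent_forms l L L'"
  unfolding equivalent_forms_def using assms by (intro exI[of _ id]) simp

lemma equivalent_forms_double:
  assumes "equivalent_forms l L L'"
  shows "equivalent_forms l (L + L) (L' + L')"
proof -
  obtain e where e: "bij e" "\<forall>f g. e (f - g) = e f - e g" "\<forall>f g. [form L' f g = form L (e f) (e g)] (mod int l)"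
    using assms unfolding equivalent_forms_def by blast
  have "[form (L' + L') f g = form (L + L) (e f) (e g)] (mod int l)" for f g
    unfolding form_double by (rule cong_scalar_left) (use e(3) in blast)
  then show ?thesis unfolding equivalent_forms_def using e by blast
qed

lemma equivalent_forms_kernel:
  assumes "equivalent_forms l L L'"
  obtains e where "bij e" "\<And>f g. e (f - g) = e f - e g" "\<And>f. f \<in> frame_kernel l L' \<longleftrightarrow> e f \<in> frame_kernel l L"
    "\<And>f. f \<in> frame_kernel l (L' + L') \<longleftrightarrow> e f \<in> frame_kernel l (L + L)"
proof -
  obtain e where e: "bij e" "\<And>f g. e (f - g) = e f - e g" "\<And>f g. [form L' f g = form L (e f) (e g)] (mod int l)"
    using assms unfolding equivalent_forms_def by blast
  have surj: "(\<forall>g. Q (e g)) \<longleftrightarrow> (\<forall>g. Q g)" for Q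
    using bij_is_surj[OF e(1)] by (metis surjD)
  have dvd: "int l dvd form L' f g \<longleftrightarrow> int l dvd form L (e f) (e g)" for f g
    by (rule cong_dvd_iff[OF e(3)])
  have dvd2: "int l dvd form (L' + L') f g \<longleftrightarrow> int l dvd form (L + L) (e f) (e g)" for f g
    unfolding form_double by (rule cong_dvd_iff[OF cong_scalar_left[OF e(3)]])
  show ?thesis
  proof (rule that[OF e(1,2)])
    show "f \<in> frame_kernel l L' \<longleftrightarrow> e f \<in> frame_kernel l L" for f
      unfolding frame_kernel_iff dvd surj[of "\<lambda>g. int l dvd form L (e f) g"] ..
    show "f \<in> frame_kernel l (L' + L') \<longleftrightarrow> e f \<in> frame_kernel l (L + L)" for f
      unfolding frame_kernel_iff dvd2 surj[of "\<lambda>g. int l dvd form (L + L) (e f) g"] ..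
  qed
qed

lemma index_bij:
  assumes H: "subgrp H" "subgrp H'" and e: "bij e" "\<And>f g. e (f - g) = e f - e g" "\<And>f. f \<in> H' \<longleftrightarrow> e f \<in> H"
  shows "index H' = index H"
proof -
  have eq: "rep H' f = rep H' g \<longleftrightarrow> rep H (e f) = rep H (e g)" for f g
    unfolding rep_eq_iff[OF H(2)] rep_eq_iff[OF H(1)] e(3) e(2) ..
  have rr: "rep H (e (rep H' f)) = rep H (e f)" for f
    unfolding eq[symmetric] by (rule rep_rep[OF H(2)])
  have "bij_betw (\<lambda>h. rep H (e h)) (range (rep H')) (range (rep H))"
  proof (rule bij_betw_imageI)
    show "inj_on (\<lambda>h. rep H (e h)) (range (rep H'))"
    proof (rule inj_onI)
      fix h h' assume h: "h \<in> range (rep H')" "h' \<in> range (rep H')" "rep H (e h) = rep H (e h')"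
      then have "rep H' h = rep H' h'" using eq by blast
      then show "h = h'" unfolding rep_fixed[OF H(2) h(1)] rep_fixed[OF H(2) h(2)] .
    qed
    show "(\<lambda>h. rep H (e h)) ` range (rep H') = range (rep H)"
    proof (intro equalityI subsetI)
      fix g assume "g \<in> range (rep H)"
      then obtain f where "g = rep H f" by blast
      moreover obtain u where "f = e u" using bij_is_surj[OF e(1)] by (metis surjD)
      ultimately have "g = rep H (e (rep H' u))" using rr by simp
      then show "g \<in> (\<lambda>h. rep H (e h)) ` range (rep H')" by blast
    qed blast
  qed
  then show ?thesis unfolding index_def by (rule bij_betw_same_card)
qed

lemma equivalent_forms_index:
  assumes "equivalent_forms l L L'"
  shows "index (frame_kernel l L') = index (frame_kernel l L)"
proof -
  obtain e where "bij e" "\<And>f g. e (f - g) = e f - e g" "\<And>f. f \<in> frame_kernel l L' \<longleftrightarrow> e f \<in> frame_kernel l L"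
    by (rule equivalent_forms_kernel[OF assms]) blast
  then show ?thesis by (intro index_bij subgrp_frame_kernel)
qed

lemma equivalent_forms_kernel_double:
  assumes "equivalent_forms l L L'" "frame_kernel l (L + L) = frame_kernel l L"
  shows "frame_kernel l (L' + L') = frame_kernel l L'"
proof -
  obtain e where "\<And>f. f \<in> frame_kernel l L' \<longleftrightarrow> e f \<in> frame_kernel l L"
    "\<And>f. f \<in> frame_kernel l (L' + L') \<longleftrightarrow> e f \<in> frame_kernel l (L + L)"
    by (rule equivalent_forms_kernel[OF assms(1)]) blast
  then show ?thesis using assms(2) by blast
qed

lemma frame_degree_index: "frame_degree l L = sqrt (real (index (frame_kernel l L)))"
  by (simp only: frame_degree_def card_quotient[OF subgrp_frame_kernel])

lemma form_expand:
  fixes L :: "int ^ 'n::finite ^ 'n" and e :: "int ^ 'n \<Rightarrow> int ^ 'n"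
  assumes e: "\<And>f. e f = (\<Sum>i\<in>UNIV. f $ i *s u i)"
  shows "form L (e f) (e g) = (\<Sum>i\<in>UNIV. \<Sum>j\<in>UNIV. f $ i * form L (u i) (u j) * g $ j)"
proof -
  have sum_left: "form L (sum h S) g = (\<Sum>i\<in>S. form L (h i) g)" for h :: "'n \<Rightarrow> int ^ 'n" and S g
    by (induction S rule: infinite_finite_induct) (simp_all add: form_add_left)
  have sum_right: "form L g (sum h S) = (\<Sum>i\<in>S. form L g (h i))" for h :: "'n \<Rightarrow> int ^ 'n" and S g
    by (induction S rule: infinite_finite_induct) (simp_all add: form_add_right)
  show ?thesis
    unfolding e sum_left form_scale_left
    by (intro sum.cong refl) (simp add: sum_right form_scale_right sum_distrib_left mult_ac)
qed

text \<open>The matrix of the mutated frame is that of \<open>L\<close> in another basis of the lattice.\<close>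

lemma mutation_equivalent_forms:
  fixes L L' :: "int ^ 'n::finite ^ 'n" and b :: "int ^ 'n"
  assumes skew: "skew_symmetric_mod l L" "skew_symmetric_mod l L'" and b: "b $ k = 0"
    and off: "\<And>i j. i \<noteq> k \<Longrightarrow> j \<noteq> k \<Longrightarrow> [L' $ i $ j = L $ i $ j] (mod int l)"
    and col: "\<And>i. i \<noteq> k \<Longrightarrow> [L' $ i $ k = form L (axis i 1) (- axis k 1 + pos_part b)] (mod int l)"
  shows "equivalent_forms l L L'"
proof -
  define u where "u i = (if i = k then - axis k 1 + pos_part b else axis i (1::int))" for i
  define e where "e f = (\<Sum>i\<in>UNIV. f $ i *s u i)" for f
  have pk: "pos_part b $ k = 0" by (simp add: pos_part_def b)
  have e_nth: "e f $ i = (if i = k then - f $ k else f $ i + f $ k * pos_part b $ i)" for f i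
  proof -
    have "e f $ i = (\<Sum>j\<in>UNIV. f $ j * u j $ i)" by (simp add: e_def)
    also have "\<dots> = (\<Sum>j\<in>UNIV. (if j = k then f $ k * u k $ i else 0) + (if j = i then (if i = k then 0 else f $ i) else 0))"
      by (intro sum.cong refl) (auto simp: u_def axis_def)
    also have "\<dots> = f $ k * u k $ i + (if i = k then 0 else f $ i)" by (simp add: sum.distrib)
    finally show ?thesis using pk by (auto simp: u_def axis_def)
  qed
  have ee: "e (e f) = f" for f
    using pk by (simp add: Finite_Cartesian_Product.vec_eq_iff e_nth)
  then have "bij e" by (intro o_bij[of e e]) (auto simp: fun_eq_iff)
  moreover have "e (f - g) = e f - e g" for f g
    by (simp add: Finite_Cartesian_Product.vec_eq_iff e_nth algebra_simps)
  moreover have "[form L' f g = form L (e f) (e g)] (mod int l)" for f g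
  proof -
    have basis: "[L' $ i $ j = form L (u i) (u j)] (mod int l)" for i j
    proof (cases "i = k"; cases "j = k")
      \<comment> \<open>\<open>col\<close> says nothing about this entry; both sides vanish modulo
        \<open>l\<close> because the forms are alternating.\<close>
      assume "i = k" "j = k"
      moreover have "[L' $ k $ k = 0] (mod int l)" using skew(2) by (simp add: skew_symmetric_mod_def)
      moreover have "[form L (u k) (u k) = 0] (mod int l)" using dvd_form_diag[OF skew(1)] by (simp add: cong_0_iff)
      ultimately show ?thesis by (metis cong_sym cong_trans)
    next
      assume ij: "i = k" "j \<noteq> k"
      have "[L' $ k $ j = - L' $ j $ k] (mod int l)" using skew(2) by (simp add: skew_symmetric_mod_def)
      also have "[- L' $ j $ k = - form L (u j) (u k)] (mod int l)"
        using col[OF ij(2)] ij by (simp add: u_def cong_minus_minus_iff)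
      also have "[- form L (u j) (u k) = form L (u k) (u j)] (mod int l)"
        by (rule cong_sym[OF form_skew[OF skew(1)]])
      finally show ?thesis using ij by simp
    next
      assume "i \<noteq> k" "j = k"
      then show ?thesis using col[of i] by (simp add: u_def)
    next
      assume "i \<noteq> k" "j \<noteq> k"
      then show ?thesis using off[of i j] by (simp add: u_def form_axis)
    qed
    have "[(\<Sum>i\<in>UNIV. \<Sum>j\<in>UNIV. f $ i * L' $ i $ j * g $ j)
        = (\<Sum>i\<in>UNIV. \<Sum>j\<in>UNIV. f $ i * form L (u i) (u j) * g $ j)] (mod int l)"
      by (intro cong_sum cong_mult cong_refl basis)
    then show ?thesis unfolding form_expand[of e u, OF e_def] form_def[of L'] .
  qed
  ultimately show ?thesis unfolding equivalent_forms_def by blast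
qed

text \<open>Comparing the two expressions for \<open>M f * M g\<close> and cancelling
  \<open>M (f + g)\<close> determines the power of \<open>q\<close>, hence the form modulo
  \<open>l\<close>.\<close>

lemma toric_frame_unique:
  fixes q :: "'k::{idom, ring_char_0} fract alg_closure" and M :: "int ^ 'n::finite \<Rightarrow> 'a::division_ring"
  assumes q: "l > 0" "primitive_root_of_unity l q" "algebra_structure (base_ring q) \<iota>"
    and M: "toric_frame q \<iota> l M L" "toric_frame q \<iota> l M L'"
  shows "equivalent_forms l L L'"
proof (rule equivalent_forms_cong)
  interpret a: quantum_torus q l "base_ring q" \<iota> M L by (rule toric_frame_quantum_torus[OF q M(1)])
  interpret b: quantum_torus q l "base_ring q" \<iota> M L' by (rule toric_frame_quantum_torus[OF q M(2)])
  fix f g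
  have "\<iota> (q powi form L f g) * M (f + g) = \<iota> (q powi form L' f g) * M (f + g)"
    by (rule trans[OF a.M_mult[symmetric] b.M_mult])
  then have "\<iota> (q powi form L' f g) = \<iota> (q powi form L f g)"
    using a.M_nonzero[of "f + g"] by (metis mult_right_cancel)
  then show "[form L' f g = form L f g] (mod int l)" by (simp add: a.qi_inj)
qed

lemma mutation_equivalent_invariant:
  fixes q :: "'k::{idom, ring_char_0} fract alg_closure" and \<Sigma> :: "('a::division_ring, 'n::finite) seed"
  assumes q: "l > 0" "primitive_root_of_unity l q" "algebra_structure (base_ring q) \<iota>"
    and seed: "quantum_seed q \<iota> l ex \<Sigma>" and L: "toric_frame q \<iota> l (fst \<Sigma>) L"
    and mut: "mutation_equivalent q \<iota> l ex \<Sigma> \<Sigma>'"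
  obtains L' where "toric_frame q \<iota> l (fst \<Sigma>') L'" "equivalent_forms l L L'"
proof -
  obtain d where d: "exchange_matrix ex d (snd \<Sigma>)"
    using seed unfolding quantum_seed_def by blast
  from mut[unfolded mutation_equivalent_def]
  have "\<exists>L'. toric_frame q \<iota> l (fst \<Sigma>') L' \<and> equivalent_forms l L L' \<and> exchange_matrix ex d (snd \<Sigma>')"
  proof (induction rule: rtranclp_induct)
    case base
    have "equivalent_forms l L L" by (rule equivalent_forms_cong) simp
    then show ?case using L d by blast
  next
    case (step \<Sigma>' \<Sigma>'')
    then obtain L' k where L': "toric_frame q \<iota> l (fst \<Sigma>') L'" "equivalent_forms l L L'"
      "exchange_matrix ex d (snd \<Sigma>')" and k: "k \<in> ex" "seed_mutation q \<iota> l k \<Sigma>' \<Sigma>''" by blast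
    let ?b = "column k (snd \<Sigma>')"
    have fm: "frame_mutation q \<iota> l k ?b (fst \<Sigma>') (fst \<Sigma>'')" and sn: "snd \<Sigma>'' = mutate_matrix k (snd \<Sigma>')"
      using k(2) unfolding seed_mutation_def by blast+
    \<comment> \<open>These matrices are only asserted to exist; \<open>toric_frame_unique\<close>
      connects \<open>L1\<close> with the matrix \<open>L'\<close> of the induction
      hypothesis.\<close>
    obtain L1 L2 where L12: "toric_frame q \<iota> l (fst \<Sigma>') L1" "toric_frame q \<iota> l (fst \<Sigma>'') L2"
      "\<And>i j. i \<noteq> k \<Longrightarrow> j \<noteq> k \<Longrightarrow> [L2 $ i $ j = L1 $ i $ j] (mod int l)"
      "\<And>i. i \<noteq> k \<Longrightarrow> [L2 $ i $ k = form L1 (axis i 1) (- axis k 1 + pos_part ?b)] (mod int l)"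
      using fm unfolding frame_mutation_def by blast
    have "d k * snd \<Sigma>' $ k $ k = - (d k * snd \<Sigma>' $ k $ k)" "d k > 0"
      using L'(3) k(1) unfolding exchange_matrix_def by blast+
    then have "?b $ k = 0" by (simp add: column_def)
    then have "equivalent_forms l L1 L2"
      by (intro mutation_equivalent_forms[OF _ _ _ L12(3,4)]) (use L12(1,2) in \<open>auto simp: toric_frame_def\<close>)
    then have "equivalent_forms l L L2"
      using equivalent_forms_trans[OF L'(2) equivalent_forms_trans[OF toric_frame_unique[OF q L'(1) L12(1)]]] by blast
    moreover have "exchange_matrix ex d (snd \<Sigma>'')" unfolding sn by (rule mutate_matrix_exchange[OF L'(3) k(1)])
    ultimately show ?case using L12(2) by blast
  qed
  then show ?thesis using that by blast
qed

section \<open>Cones of submonoids\<close>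

lemma real_vec_add: "real_vec (f + g) = real_vec f + real_vec g"
  and real_vec_diff: "real_vec (f - g) = real_vec f - real_vec g"
  and real_vec_scale: "real_vec (c *s f) = real_of_int c *\<^sub>R real_vec f"
  and real_vec_0: "real_vec 0 = 0"
  by (simp_all add: real_vec_def Finite_Cartesian_Product.vec_eq_iff)

lemma real_vec_inj: "real_vec f = real_vec g \<longleftrightarrow> f = g"
  by (simp add: real_vec_def Finite_Cartesian_Product.vec_eq_iff)

lemma real_vec_sum: "real_vec (sum h S) = (\<Sum>i\<in>S. real_vec (h i))"
  by (induction S rule: infinite_finite_induct) (simp_all add: real_vec_0 real_vec_add)

lemma submonoid_scale:
  fixes \<Phi> :: "(int ^ 'n) set"
  assumes \<Phi>: "additive_submonoid \<Phi>" and f: "f \<in> \<Phi>" and c: "c \<ge> 0"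
  shows "c *s f \<in> \<Phi>"
proof -
  have "int m *s f \<in> \<Phi>" for m
  proof (induction m)
    case (Suc m)
    have "int (Suc m) *s f = f + int m *s f"
      by (simp add: Finite_Cartesian_Product.vec_eq_iff algebra_simps)
    then show ?case using Suc f \<Phi> by (simp only: additive_submonoid_def)
  qed (use \<Phi> in \<open>simp add: additive_submonoid_def\<close>)
  from this[of "nat c"] show ?thesis using c by simp
qed

lemma submonoid_sum:
  assumes \<Phi>: "additive_submonoid \<Phi>" and "\<And>i. i \<in> I \<Longrightarrow> h i \<in> \<Phi>"
  shows "sum h I \<in> \<Phi>"
  using assms(2) \<Phi> by (induction I rule: infinite_finite_induct) (auto simp: additive_submonoid_def)

text \<open>
  Approximating the real coefficients simultaneously by rational numbers with the same
  denominator makes the error vector so small that it vanishes, being integral.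
\<close>

lemma multiple_in_submonoid:
  fixes \<Phi> :: "(int ^ 'n::finite) set" and e :: "'i \<Rightarrow> int ^ 'n"
  assumes \<Phi>: "additive_submonoid \<Phi>" and I: "finite I" "\<And>i. i \<in> I \<Longrightarrow> e i \<in> \<Phi>" "\<And>i. i \<in> I \<Longrightarrow> \<beta> i \<ge> 0"
    and h: "real_vec h = (\<Sum>i\<in>I. \<beta> i *\<^sub>R real_vec (e i))"
  shows "\<exists>k::int>0. k *s h \<in> \<Phi>"
proof -
  define n where "n = card I"
  obtain \<sigma> where \<sigma>: "bij_betw \<sigma> {..<n} I"
    using ex_bij_betw_nat_finite[OF I(1)] by (auto simp: n_def atLeast0LessThan)
  have \<sigma>I: "\<sigma> m \<in> I" if "m < n" for m using \<sigma> that by (auto simp: bij_betw_def)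
  \<comment> \<open>A strict bound for the absolute values of any coordinate, summed over all
    vectors; errors below \<open>1 / N\<close> in the coefficients then move each coordinate by less
    than 1.\<close>
  define N where "N = Suc (nat (\<Sum>m<n. \<Sum>j\<in>UNIV. \<bar>e (\<sigma> m) $ j\<bar>))"
  have N: "N > 0" by (simp add: N_def)
  obtain k p where k: "0 < k" and p: "\<And>m. m < n \<Longrightarrow> \<bar>of_int k * \<beta> (\<sigma> m) - of_int (p m)\<bar> < 1 / real N"
    using Dirichlet_approx_simult[OF N, of n "\<lambda>m. \<beta> (\<sigma> m)"] by metis
  \<comment> \<open>The approximated number is nonnegative and the error below 1, so the integer
    exceeds -1.\<close>
  have p0: "p m \<ge> 0" if m: "m < n" for m
  proof -
    have "of_int k * \<beta> (\<sigma> m) \<ge> 0" using k I(3)[OF \<sigma>I[OF m]] by simp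
    moreover have "1 / real N \<le> 1" using N by (simp add: field_simps)
    ultimately have "real_of_int (p m) > -1" using p[OF m] by linarith
    then show ?thesis by linarith
  qed
  have "k *s h = (\<Sum>m<n. p m *s e (\<sigma> m))"
  proof -
    have "(k *s h) $ j = (\<Sum>m<n. p m *s e (\<sigma> m)) $ j" for j
    proof -
      let ?E = "\<lambda>m. real_of_int (e (\<sigma> m) $ j)"
      have "real_of_int (h $ j) = real_vec h $ j" by (simp add: real_vec_def)
      also have "\<dots> = (\<Sum>i\<in>I. \<beta> i * real_of_int (e i $ j))" unfolding h by (simp add: real_vec_def)
      also have "\<dots> = (\<Sum>m<n. \<beta> (\<sigma> m) * ?E m)" by (rule sum.reindex_bij_betw[OF \<sigma>, symmetric])
      finally have hj: "real_of_int (h $ j) = (\<Sum>m<n. \<beta> (\<sigma> m) * ?E m)" .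
      have "real_of_int ((k *s h) $ j - (\<Sum>m<n. p m *s e (\<sigma> m)) $ j)
          = (\<Sum>m<n. (of_int k * \<beta> (\<sigma> m) - of_int (p m)) * ?E m)"
        by (simp add: hj sum_distrib_left left_diff_distrib sum_subtractf mult.assoc)
      also have "\<bar>\<dots>\<bar> \<le> (\<Sum>m<n. 1 / real N * \<bar>?E m\<bar>)"
      proof (rule order.trans[OF sum_abs sum_mono])
        fix m assume "m \<in> {..<n}"
        then show "\<bar>(of_int k * \<beta> (\<sigma> m) - of_int (p m)) * ?E m\<bar> \<le> 1 / real N * \<bar>?E m\<bar>"
          unfolding abs_mult by (intro mult_right_mono[OF less_imp_le[OF p] abs_ge_zero]) simp
      qed
      also have "\<dots> = (\<Sum>m<n. \<bar>?E m\<bar>) / real N" by (simp add: sum_divide_distrib)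
      also have "\<dots> < 1"
      proof -
        have "(\<Sum>m<n. \<bar>e (\<sigma> m) $ j\<bar>) \<le> (\<Sum>m<n. \<Sum>j\<in>UNIV. \<bar>e (\<sigma> m) $ j\<bar>)"
          by (intro sum_mono member_le_sum) auto
        then have "(\<Sum>m<n. \<bar>e (\<sigma> m) $ j\<bar>) < int N" by (simp add: N_def)
        then have "real_of_int (\<Sum>m<n. \<bar>e (\<sigma> m) $ j\<bar>) < real N" by linarith
        then show ?thesis using N by simp
      qed
      finally have "\<bar>(k *s h) $ j - (\<Sum>m<n. p m *s e (\<sigma> m)) $ j\<bar> < 1" by linarith
      then show ?thesis by linarith
    qed
    then show ?thesis by (intro iffD2[OF Finite_Cartesian_Product.vec_eq_iff] allI)
  qed
  also have "\<dots> \<in> \<Phi>"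
    by (rule submonoid_sum[OF \<Phi>]) (rule submonoid_scale[OF \<Phi> I(2)[OF \<sigma>I] p0], simp_all)
  finally show ?thesis using k by blast
qed

text \<open>\<open>h\<close> lies on the segment from 0 to \<open>k *s h\<close>.\<close>

lemma integrally_convexD:
  assumes \<Phi>: "additive_submonoid \<Phi>" "integrally_convex \<Phi>" and h: "h \<in> group_of \<Phi>" and k: "k > 0" "k *s h \<in> \<Phi>"
  shows "h \<in> \<Phi>"
proof -
  have "real_vec h = (1 - inverse (real_of_int k)) *\<^sub>R real_vec 0 + inverse (real_of_int k) *\<^sub>R real_vec (k *s h)"
    using k by (simp add: real_vec_scale real_vec_0)
  moreover have "0 \<le> inverse (real_of_int k)" "inverse (real_of_int k) \<le> 1"
    using k by (simp_all add: inverse_le_1_iff)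
  ultimately have "real_vec h \<in> closed_segment (real_vec 0) (real_vec (k *s h))"
    unfolding in_segment by blast
  moreover have "0 \<in> \<Phi>" using \<Phi>(1) by (simp add: additive_submonoid_def)
  ultimately show ?thesis using \<Phi>(2) h k(2) unfolding integrally_convex_def by blast
qed

lemma rays_iff: "x \<in> rays V \<longleftrightarrow> (\<exists>v\<in>V. v \<noteq> 0 \<and> x = sgn v)"
  by (auto simp: rays_def)

text \<open>The rays of \<open>u + n g\<close> converge to the ray of \<open>g\<close>, so
  closedness puts some \<open>f\<close> of \<open>\<Phi>\<close> on it. As \<open>g\<close> is a
  positive real multiple of \<open>f\<close>, an integral multiple of \<open>g\<close> is in
  \<open>\<Phi>\<close>, and convexity allows division.\<close>

lemma asymptotic_direction:
  fixes \<Phi> :: "(int ^ 'n::finite) set"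
  assumes \<Phi>: "additive_submonoid \<Phi>" "integrally_convex \<Phi>" "integrally_closed \<Phi>"
    and u: "\<And>n. u + int n *s g \<in> \<Phi>"
  shows "g \<in> \<Phi>"
proof (cases "g = 0")
  case True
  then show ?thesis using \<Phi>(1) by (simp add: additive_submonoid_def)
next
  case False
  then have g0: "real_vec g \<noteq> 0" using real_vec_inj[of g 0] by (simp add: real_vec_0)
  have "u + int 1 *s g \<in> \<Phi>" "u + int 0 *s g \<in> \<Phi>" by (rule u)+
  then have "u + g \<in> \<Phi>" "u \<in> \<Phi>" by simp_all
  moreover have "g = (u + g) - u" by simp
  ultimately have gG: "g \<in> group_of \<Phi>" unfolding group_of_def by blast
  \<comment> \<open>The vector \<open>u + (n + 1) g\<close> divided by \<open>n + 1\<close>: the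
    same ray, but a convergent sequence.\<close>
  define h where "h n = inverse (real (Suc n)) *\<^sub>R real_vec u + real_vec g" for n
  have hs: "sgn (h n) = sgn (real_vec (u + int (Suc n) *s g))" for n
  proof -
    have "real_vec (u + int (Suc n) *s g) = real (Suc n) *\<^sub>R h n"
      by (simp add: h_def real_vec_add real_vec_scale scaleR_add_right del: of_nat_Suc)
    moreover have "real (Suc n) > 0" by simp
    ultimately show ?thesis by (simp only: sgn_scaleR sgn_pos scaleR_one)
  qed
  have lim: "h \<longlonglongrightarrow> 0 *\<^sub>R real_vec u + real_vec g"
    unfolding h_def by (intro tendsto_add tendsto_scaleR LIMSEQ_inverse_real_of_nat tendsto_const)
  then have lim: "h \<longlonglongrightarrow> real_vec g" by simp
  obtain C where C: "closed C" "rays (real_vec ` \<Phi>) = rays (real_vec ` group_of \<Phi>) \<inter> C"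
    using \<Phi>(3) unfolding integrally_closed_def closedin_closed by blast
  have "sgn (real_vec g) \<in> C"
  proof (rule Lim_in_closed_set[OF C(1) _ _ tendsto_sgn[OF lim g0]])
    show "\<forall>\<^sub>F n in sequentially. sgn (h n) \<in> C"
      using tendsto_imp_eventually_ne[OF lim g0]
    proof eventually_elim
      case (elim n)
      then have "real_vec (u + int (Suc n) *s g) \<noteq> 0" using hs[of n] by (metis sgn_zero_iff)
      then have "sgn (h n) \<in> rays (real_vec ` \<Phi>)" unfolding rays_iff hs using u by blast
      then show ?case using C(2) by blast
    qed
  qed simp
  moreover have "sgn (real_vec g) \<in> rays (real_vec ` group_of \<Phi>)" unfolding rays_iff using gG g0 by blast
  ultimately have "sgn (real_vec g) \<in> rays (real_vec ` \<Phi>)" using C(2) by blast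
  then obtain f where f: "f \<in> \<Phi>" "real_vec f \<noteq> 0" "sgn (real_vec g) = sgn (real_vec f)"
    unfolding rays_iff by blast
  have "real_vec g = norm (real_vec g) *\<^sub>R sgn (real_vec g)" using g0 by (simp add: sgn_div_norm)
  also have "\<dots> = (norm (real_vec g) / norm (real_vec f)) *\<^sub>R real_vec f"
    unfolding f(3) by (simp add: sgn_div_norm divide_inverse)
  finally have "real_vec g = (\<Sum>i\<in>{()}. (norm (real_vec g) / norm (real_vec f)) *\<^sub>R real_vec f)" by simp
  from multiple_in_submonoid[OF \<Phi>(1) _ _ _ this]
  obtain k where "k > 0" "k *s g \<in> \<Phi>" using f(1) by auto
  then show ?thesis by (rule integrally_convexD[OF \<Phi>(1,2) gG])
qed

lemma group_of_add:
  fixes \<Phi> :: "(int ^ 'n) set"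
  assumes \<Phi>: "additive_submonoid \<Phi>" and u: "u \<in> \<Phi>" and h: "h \<in> group_of \<Phi>"
  shows "u + int n *s h \<in> group_of \<Phi>"
proof -
  obtain f g where fg: "f \<in> \<Phi>" "g \<in> \<Phi>" "h = f - g" using h by (auto simp: group_of_def)
  have "u + int n *s h = (u + int n *s f) - int n *s g"
    unfolding fg(3) by (simp add: Finite_Cartesian_Product.vec_eq_iff algebra_simps)
  moreover have "u + int n *s f \<in> \<Phi>" "int n *s g \<in> \<Phi>"
    using \<Phi> u submonoid_scale[OF \<Phi> fg(1), of "int n"] submonoid_scale[OF \<Phi> fg(2), of "int n"]
    by (simp_all add: additive_submonoid_def)
  ultimately show ?thesis unfolding group_of_def by blast
qed

text \<open>
  For \<open>u\<close> the sum of a basis of the span of \<open>\<Phi>\<close>, each vector of the span close enough to \<open>u\<close>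
  lies in the cone of \<open>\<Phi>\<close>.
\<close>

lemma closure_direction:
  fixes \<Phi> :: "(int ^ 'n::finite) set"
  assumes \<Phi>: "additive_submonoid \<Phi>"
  shows "\<exists>u\<in>\<Phi>. \<forall>h\<in>group_of \<Phi>. \<forall>n. h \<noteq> 0 \<longrightarrow> sgn (real_vec h) \<in> closure (rays (real_vec ` \<Phi>)) \<longrightarrow>
      (\<exists>k>0. k *s (u + int n *s h) \<in> \<Phi>)"
proof -
  obtain B where B: "B \<subseteq> real_vec ` \<Phi>" "independent B" "real_vec ` \<Phi> \<subseteq> span B"
    by (rule maximal_independent_subset)
  have finB: "finite B" by (rule independent_imp_finite[OF B(2)])
  have "\<forall>b\<in>B. \<exists>f\<in>\<Phi>. b = real_vec f" using B(1) by blast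
  from bchoice[OF this[unfolded Bex_def]] obtain v where v: "\<And>b. b \<in> B \<Longrightarrow> v b \<in> \<Phi> \<and> b = real_vec (v b)" by blast
  define u where "u = (\<Sum>b\<in>B. v b)"
  have u\<Phi>: "u \<in> \<Phi>" unfolding u_def by (rule submonoid_sum[OF \<Phi>]) (use v in blast)
  have ru: "real_vec u = (\<Sum>b\<in>B. b)" unfolding u_def real_vec_sum by (rule sum.cong) (use v in auto)
  have "\<exists>g. linear g \<and> (\<forall>x\<in>B. g x = (if x = b then 1 else (0::real)))" for b
    by (rule linear_independent_extend[OF B(2)])
  then obtain c where c: "\<And>b. linear (c b)" "\<And>b x. x \<in> B \<Longrightarrow> c b x = (if x = b then 1 else (0::real))"
    by metis
  have "\<exists>K>0. \<forall>x. norm (c b x) \<le> K * norm x" for b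
    using linear_bounded_pos[OF c(1)] by (metis mult.commute)
  then obtain K where K: "\<And>b. K b > 0" "\<And>b x. norm (c b x) \<le> K b * norm x" by metis
  define C where "C = 1 + (\<Sum>b\<in>B. K b)"
  have C0: "C > 0" unfolding C_def by (intro add_pos_nonneg sum_nonneg) (simp_all add: less_imp_le K(1))
  have cC: "\<bar>c b x\<bar> \<le> C * norm x" if "b \<in> B" for b x
  proof -
    have "K b \<le> C" unfolding C_def using member_le_sum[OF that _ finB, of K] K(1) by (simp add: less_imp_le add_increasing)
    then have "K b * norm x \<le> C * norm x" by (rule mult_right_mono) simp
    then show ?thesis using K(2)[of b x] by simp
  qed
  have expand: "x = (\<Sum>b\<in>B. c b x *\<^sub>R b)" if xB: "x \<in> span B" for x
  proof -
    obtain a where a: "x = (\<Sum>b\<in>B. a b *\<^sub>R b)" using xB unfolding span_finite[OF finB] by blast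
    have "c b x = a b" if b: "b \<in> B" for b
    proof -
      have "c b x = (\<Sum>b'\<in>B. a b' *\<^sub>R c b b')" unfolding a linear_sum[OF c(1)] linear_scale[OF c(1)] ..
      also have "\<dots> = (\<Sum>b'\<in>B. if b' = b then a b else 0)" by (intro sum.cong) (auto simp: c(2))
      also have "\<dots> = a b" using finB b by simp
      finally show ?thesis .
    qed
    then show ?thesis using a by simp
  qed
  have "\<exists>k>0. k *s (u + int n *s h) \<in> \<Phi>"
    if h: "h \<in> group_of \<Phi>" "h \<noteq> 0" "sgn (real_vec h) \<in> closure (rays (real_vec ` \<Phi>))" for h n
  proof -
    define x where "x = real_vec h"
    have x0: "x \<noteq> 0" using h(2) real_vec_inj[of h 0] by (simp add: x_def real_vec_0)
    \<comment> \<open>Small enough for \<open>C * norm w < 1\<close> below; the summand 1 avoids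
      division by 0 when \<open>n = 0\<close>.\<close>
    define \<epsilon> where "\<epsilon> = 1 / (C * (real n * norm x + 1))"
    have pos: "C * (real n * norm x + 1) > 0" using C0 by (intro mult_pos_pos add_nonneg_pos) auto
    then have "\<epsilon> > 0" by (simp add: \<epsilon>_def)
    then obtain y where y: "y \<in> rays (real_vec ` \<Phi>)" "dist y (sgn x) < \<epsilon>"
      using h(3) unfolding closure_approachable x_def by blast
    then obtain f where f: "f \<in> \<Phi>" "real_vec f \<noteq> 0" "y = sgn (real_vec f)" unfolding rays_iff by blast
    \<comment> \<open>Stretches \<open>f\<close>, which points nearly in the direction of
      \<open>h\<close>, to the length of \<open>n h\<close>. The remaining error \<open>w\<close> is
      absorbed by \<open>u\<close>, whose coordinates in the basis are all 1.\<close>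
    define s where "s = real n * norm x / norm (real_vec f)"
    define w where "w = real n *\<^sub>R x - s *\<^sub>R real_vec f"
    have "w = (real n * norm x) *\<^sub>R (sgn x - y)"
      using x0 f(2) by (simp add: w_def s_def f(3) sgn_div_norm scaleR_diff_right divide_inverse)
    then have "norm w = real n * norm x * dist y (sgn x)"
      by (simp add: dist_norm norm_minus_commute)
    also have "\<dots> \<le> real n * norm x * \<epsilon>" using y(2) by (intro mult_left_mono) auto
    finally have "C * norm w \<le> C * (real n * norm x * \<epsilon>)" using C0 by simp
    also have "\<dots> < 1" using pos C0 by (simp add: \<epsilon>_def field_simps)
    finally have Cw: "C * norm w < 1" .
    obtain f1 f2 where "f1 \<in> \<Phi>" "f2 \<in> \<Phi>" "h = f1 - f2" using h(1) by (auto simp: group_of_def)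
    then have "x \<in> span B" unfolding x_def using B(3) by (auto simp: real_vec_diff intro!: span_diff)
    moreover have "real_vec f \<in> span B" using B(3) f(1) by blast
    ultimately have wB: "w \<in> span B" unfolding w_def by (intro span_diff span_scale)
    define I where "I = insert None (Some ` B)"
    define \<beta> where "\<beta> i = (case i of None \<Rightarrow> s | Some b \<Rightarrow> 1 + c b w)" for i
    define e where "e i = (case i of None \<Rightarrow> f | Some b \<Rightarrow> v b)" for i
    have "real_vec (u + int n *s h) = (\<Sum>b\<in>B. b) + (w + s *\<^sub>R real_vec f)"
      by (simp add: real_vec_add real_vec_scale ru w_def x_def)
    also have "\<dots> = (\<Sum>b\<in>B. (1 + c b w) *\<^sub>R b) + s *\<^sub>R real_vec f"
      by (subst (1) expand[OF wB]) (simp add: sum.distrib scaleR_left_distrib)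
    also have "\<dots> = (\<Sum>b\<in>B. (1 + c b w) *\<^sub>R real_vec (v b)) + s *\<^sub>R real_vec f"
      using v by simp
    also have "\<dots> = (\<Sum>i\<in>I. \<beta> i *\<^sub>R real_vec (e i))"
      unfolding I_def using finB by (simp add: sum.reindex \<beta>_def e_def)
    finally have eq: "real_vec (u + int n *s h) = (\<Sum>i\<in>I. \<beta> i *\<^sub>R real_vec (e i))" .
    have \<beta>0: "\<beta> i \<ge> 0" if "i \<in> I" for i
    proof (cases i)
      case None
      then show ?thesis by (simp add: \<beta>_def s_def)
    next
      case (Some b)
      then have "b \<in> B" using that by (auto simp: I_def)
      then have "\<bar>c b w\<bar> < 1" using cC[of b w] Cw by linarith
      then show ?thesis using Some by (simp add: \<beta>_def)
    qed
    have e\<Phi>: "e i \<in> \<Phi>" if "i \<in> I" for i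
      using that v f(1) by (auto simp: I_def e_def)
    have finI: "finite I" using finB by (simp add: I_def)
    show ?thesis
      by (rule multiple_in_submonoid[OF \<Phi> finI e\<Phi> \<beta>0 eq])
  qed
  then show ?thesis using u\<Phi> by blast
qed

section \<open>Weights and leading terms\<close>

context quantum_torus
begin

text \<open>The ordered group is a parameter because two kinds of weights occur: integers for the
  coordinate directions, integer polynomials for a total order. The value at 0 is
  unspecified.\<close>

definition wdeg :: "(int ^ 'n \<Rightarrow> 'o::linordered_ab_group_add) \<Rightarrow> 'a \<Rightarrow> 'o" where
  "wdeg w x = Max (w ` {f. coef x f \<noteq> 0})"

lemma wdeg_ge: "x \<in> T \<Longrightarrow> coef x f \<noteq> 0 \<Longrightarrow> w f \<le> wdeg w x"
  unfolding wdeg_def by (rule Max_ge) (auto simp: finite_supp)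

lemma wdeg_attained:
  assumes "x \<in> T" "x \<noteq> 0"
  obtains f where "coef x f \<noteq> 0" "w f = wdeg w x"
proof -
  have "{f. coef x f \<noteq> 0} \<noteq> {}" using coef_eq_0_iff[OF assms(1)] assms(2) by blast
  then have "wdeg w x \<in> w ` {f. coef x f \<noteq> 0}"
    unfolding wdeg_def by (intro Max_in) (auto simp: finite_supp[OF assms(1)])
  then show ?thesis using that by auto
qed

lemma wdeg_eqI:
  assumes "x \<in> sp {f. w f \<le> D}" "coef x f0 \<noteq> 0" "w f0 = D"
  shows "wdeg w x = D"
  unfolding wdeg_def
proof (rule Max_eqI)
  show "finite (w ` {f. coef x f \<noteq> 0})" by (simp add: finite_supp[OF sp_T[OF assms(1)]])
  show "d \<le> D" if d: "d \<in> w ` {f. coef x f \<noteq> 0}" for d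
    using d assms(1) sp_iff[of x "{f. w f \<le> D}"] by blast
  show "D \<in> w ` {f. coef x f \<noteq> 0}" using assms(2,3) by blast
qed

definition top_part :: "(int ^ 'n \<Rightarrow> 'o::linordered_ab_group_add) \<Rightarrow> 'a \<Rightarrow> 'a" where
  "top_part w x = proj {f. w f = wdeg w x} x"

lemma top_part_in: "x \<in> T \<Longrightarrow> top_part w x \<in> sp {f. w f = wdeg w x}"
  unfolding top_part_def by (rule proj_in)

lemma top_part_nonzero: "x \<in> T \<Longrightarrow> x \<noteq> 0 \<Longrightarrow> top_part w x \<noteq> 0"
proof
  assume x: "x \<in> T" "x \<noteq> 0" and z: "top_part w x = 0"
  obtain f where f: "coef x f \<noteq> 0" "w f = wdeg w x" by (rule wdeg_attained[OF x])
  have "coef (top_part w x) f = coef x f" unfolding top_part_def by (simp add: coef_proj[OF x(1)] f(2))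
  with f(1) z show False by simp
qed

lemma low_part_in:
  assumes x: "x \<in> T"
  shows "x - top_part w x \<in> sp {f. w f < wdeg w x}"
proof -
  have "f \<in> {f. w f < wdeg w x}" if "coef (x - top_part w x) f \<noteq> 0" for f
    using that wdeg_ge[OF x, of f w] unfolding top_part_def
    by (auto simp: coef_diff[OF x proj_T[OF x]] coef_proj[OF x] split: if_splits)
  moreover have "x - top_part w x \<in> T" unfolding top_part_def by (rule sp_diff[OF x proj_T[OF x]])
  ultimately show ?thesis using sp_iff[of "x - top_part w x" "{f. w f < wdeg w x}"] by blast
qed

text \<open>The product of the top parts is nonzero in a division ring, and all other terms of the
  product have smaller weight.\<close>

lemma top_part_mult:
  assumes w: "\<And>f g. w (f + g) = w f + w g" and x: "x \<in> T" "x \<noteq> 0" and y: "y \<in> T" "y \<noteq> 0"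
  shows "wdeg w (x * y) = wdeg w x + wdeg w y" and "top_part w (x * y) = top_part w x * top_part w y"
proof -
  let ?D = "wdeg w x + wdeg w y"
  define lx where "lx = x - top_part w x"
  define ly where "ly = y - top_part w y"
  define r where "r = top_part w x * ly + lx * y"
  have yle: "y \<in> sp {f. w f \<le> wdeg w y}"
    using sp_iff[of y "{f. w f \<le> wdeg w y}"] y(1) wdeg_ge[OF y(1)] by blast
  have r: "r \<in> sp {f. w f < ?D}" unfolding r_def
  proof (rule sp_add)
    show "top_part w x * ly \<in> sp {f. w f < ?D}"
      unfolding ly_def by (rule sp_mult[OF top_part_in[OF x(1)] low_part_in[OF y(1)]]) (simp add: w)
    show "lx * y \<in> sp {f. w f < ?D}"
      unfolding lx_def by (rule sp_mult[OF low_part_in[OF x(1)] yle]) (simp add: w add_less_le_mono)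
  qed
  have t: "top_part w x * top_part w y \<in> sp {f. w f = ?D}"
    by (rule sp_mult[OF top_part_in[OF x(1)] top_part_in[OF y(1)]]) (simp add: w)
  have t0: "top_part w x * top_part w y \<noteq> 0" using top_part_nonzero[OF x, of w] top_part_nonzero[OF y, of w] by simp
  have xy: "x * y = top_part w x * top_part w y + r"
    by (simp add: r_def lx_def ly_def algebra_simps)
  have pr: "proj {f. w f = ?D} (x * y) = top_part w x * top_part w y"
    unfolding xy proj_add[OF sp_T[OF t] sp_T[OF r]] proj_id[OF t]
    by (subst proj_disjoint[OF r]) auto
  have le: "x * y \<in> sp {f. w f \<le> ?D}"
    unfolding xy by (rule sp_add[OF subsetD[OF sp_mono t] subsetD[OF sp_mono r]]) auto
  obtain f where f: "coef (top_part w x * top_part w y) f \<noteq> 0"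
    using coef_eq_0_iff[OF sp_T[OF t]] t0 by blast
  then have "coef (x * y) f \<noteq> 0" "w f = ?D"
    unfolding pr[symmetric] coef_proj[OF T_mult[OF x(1) y(1)]] by (auto split: if_splits)
  then show d: "wdeg w (x * y) = ?D" by (rule wdeg_eqI[OF le])
  show "top_part w (x * y) = top_part w x * top_part w y" unfolding top_part_def[of w "x * y"] d by (rule pr)
qed

lemma power_nonzero_T: "x \<in> T \<Longrightarrow> x \<noteq> 0 \<Longrightarrow> x ^ n \<in> T \<and> x ^ n \<noteq> 0"
  by (simp add: unital_subring_power[OF T_subring])

lemma wdeg_power:
  fixes w :: "int ^ 'n \<Rightarrow> int"
  assumes w: "\<And>f g. w (f + g) = w f + w g" and x: "x \<in> T" "x \<noteq> 0"
  shows "wdeg w (x ^ n) = int n * wdeg w x"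
proof (induction n)
  case 0
  have "w 0 = 0" using w[of 0 0] by simp
  then have "wdeg w (M 0) = 0"
    by (intro wdeg_eqI[of "M 0" w 0 0] M_in_sp) (simp_all add: coef_M)
  then show ?case by (simp add: M_0)
next
  case (Suc n)
  then show ?case using top_part_mult(1)[OF w x, of "x ^ n"] power_nonzero_T[OF x, of n]
    by (simp add: algebra_simps)
qed

definition idx :: "'n \<Rightarrow> nat" where "idx = (SOME f. inj f)"

lemma inj_idx: "inj idx"
proof -
  obtain f :: "'n \<Rightarrow> nat" where "inj f"
    using finite_imp_inj_to_nat_seg[OF finite_class.finite_UNIV] by blast
  then show ?thesis unfolding idx_def by (rule someI[of inj f])
qed

text \<open>An additive total order on the exponents: integer polynomials are ordered by their leading coefficients.\<close>

definition wt :: "int ^ 'n \<Rightarrow> int poly" where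
  "wt f = (\<Sum>i\<in>UNIV. Polynomial.monom (f $ i) (idx i))"

lemma wt_add: "wt (f + g) = wt f + wt g"
  by (simp add: wt_def Polynomial.add_monom[symmetric] sum.distrib)

lemma wt_inj: "wt f = wt g \<Longrightarrow> f = g"
proof -
  assume e: "wt f = wt g"
  have c: "poly.coeff (wt h) (idx i) = h $ i" for h :: "int ^ 'n" and i
  proof -
    have "poly.coeff (wt h) (idx i) = (\<Sum>j\<in>UNIV. if j = i then h $ i else 0)"
      unfolding wt_def coeff_sum using inj_idx by (intro sum.cong) (auto simp: inj_eq)
    then show ?thesis by simp
  qed
  have "f $ i = g $ i" for i using c[of f i] c[of g i] e by simp
  then show ?thesis by (simp add: Finite_Cartesian_Product.vec_eq_iff)
qed

lemma wt_diff: "wt (f - g) = wt f - wt g"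
  using wt_add[of "f - g" g] by simp

section \<open>Leading exponents and coefficients\<close>

definition le :: "'a \<Rightarrow> int ^ 'n" where "le x = (SOME f. coef x f \<noteq> 0 \<and> wt f = wdeg wt x)"

definition lc :: "'a \<Rightarrow> 'c" where "lc x = coef x (le x)"

lemma le:
  assumes "x \<in> T" "x \<noteq> 0"
  shows "coef x (le x) \<noteq> 0" and "wt (le x) = wdeg wt x"
proof -
  obtain f where "coef x f \<noteq> 0" "wt f = wdeg wt x" by (rule wdeg_attained[OF assms])
  then have "coef x (le x) \<noteq> 0 \<and> wt (le x) = wdeg wt x"
    unfolding le_def by (intro someI[of "\<lambda>f. coef x f \<noteq> 0 \<and> wt f = wdeg wt x" f]) simp
  then show "coef x (le x) \<noteq> 0" "wt (le x) = wdeg wt x" by auto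
qed

lemma lc_in: "x \<in> T \<Longrightarrow> lc x \<in> A"
  unfolding lc_def by (rule coef_in)

lemma lc_nonzero: "x \<in> T \<Longrightarrow> x \<noteq> 0 \<Longrightarrow> lc x \<noteq> 0"
  unfolding lc_def by (rule le)

lemma top_part_wt:
  assumes x: "x \<in> T" "x \<noteq> 0"
  shows "top_part wt x = \<iota> (lc x) * M (le x)"
proof (rule T_eqI)
  show "top_part wt x \<in> T" using top_part_in[OF x(1)] by (rule sp_T)
  show "\<iota> (lc x) * M (le x) \<in> T" by (rule mono_T[OF lc_in[OF x(1)]])
  have iff: "wt f = wdeg wt x \<longleftrightarrow> f = le x" for f using wt_inj[of f "le x"] le(2)[OF x] by auto
  show "coef (top_part wt x) f = coef (\<iota> (lc x) * M (le x)) f" for f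
    unfolding top_part_def coef_proj[OF x(1)] coef_mono[OF lc_in[OF x(1)]] by (simp add: iff lc_def)
qed

lemma lead_mult:
  assumes x: "x \<in> T" "x \<noteq> 0" and y: "y \<in> T" "y \<noteq> 0"
  shows "le (x * y) = le x + le y" and "lc (x * y) = lc x * lc y * q powi form L (le x) (le y)"
proof -
  have xy: "x * y \<in> T" "x * y \<noteq> 0" using T_mult x y by auto
  have "wt (le (x * y)) = wt (le x + le y)"
    unfolding wt_add le(2)[OF xy] le(2)[OF x] le(2)[OF y] by (rule top_part_mult(1)[OF wt_add x y])
  then show e: "le (x * y) = le x + le y" by (rule wt_inj)
  have "\<iota> (lc (x * y)) * M (le x + le y) = \<iota> (lc x * lc y * q powi form L (le x) (le y)) * M (le x + le y)"
    using top_part_mult(2)[OF wt_add x y]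
    unfolding top_part_wt[OF xy] top_part_wt[OF x] top_part_wt[OF y] mono_mult[OF lc_in[OF x(1)] lc_in[OF y(1)]] e .
  from arg_cong[OF this, of "\<lambda>z. coef z (le x + le y)"]
  show "lc (x * y) = lc x * lc y * q powi form L (le x) (le y)"
    by (simp add: coef_mono lc_in xy x y A_closed q_powi_in)
qed

text \<open>The power of \<open>q\<close> is left open: it is a unit of \<open>A\<close>, and only
  membership in \<open>A\<close> will matter.\<close>

lemma lead_power:
  assumes x: "x \<in> T" "x \<noteq> 0"
  shows "le (x ^ n) = int n *s le x" and "\<exists>k. lc (x ^ n) = lc x ^ n * q powi k"
proof -
  have "le (x ^ n) = int n *s le x \<and> (\<exists>k. lc (x ^ n) = lc x ^ n * q powi k)"
  proof (induction n)
    case 0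
    have "coef (M 0) (le (M 0)) \<noteq> 0" by (rule le(1)[OF M_in_sp[OF UNIV_I] M_nonzero])
    then have "le (M 0) = 0" "lc (M 0) = 1" unfolding lc_def coef_M by (simp_all split: if_splits)
    then have "le (x ^ 0) = int 0 *s le x" "lc (x ^ 0) = lc x ^ 0 * q powi 0" by (simp_all add: M_0)
    then show ?case by blast
  next
    case (Suc n)
    then obtain k where k: "lc (x ^ n) = lc x ^ n * q powi k" by blast
    note xn = power_nonzero_T[OF x, of n, THEN conjunct1] power_nonzero_T[OF x, of n, THEN conjunct2]
    have "le (x ^ Suc n) = le x + int n *s le x" using lead_mult(1)[OF x xn] Suc by simp
    also have "\<dots> = int (Suc n) *s le x" by (simp add: Finite_Cartesian_Product.vec_eq_iff algebra_simps)
    moreover have "lc (x ^ Suc n) = lc x ^ Suc n * q powi (k + form L (le x) (le (x ^ n)))"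
      using lead_mult(2)[OF x xn] k by (simp add: q_powi_add mult_ac)
    ultimately show ?case by metis
  qed
  then show "le (x ^ n) = int n *s le x" "\<exists>k. lc (x ^ n) = lc x ^ n * q powi k" by auto
qed

end

section \<open>Maximal orders\<close>

context monomial_subalgebra
begin

text \<open>Only central denominators are inverted, yet the result is a division ring, since every
  nonzero element of \<open>sp \<Phi>\<close> has a nonzero central multiple.\<close>

definition frac :: "'a set" where "frac = {x. \<exists>c\<in>Z. c \<noteq> 0 \<and> c * x \<in> sp \<Phi>}"

lemma frac_I: "c \<in> Z \<Longrightarrow> c \<noteq> 0 \<Longrightarrow> c * x \<in> sp \<Phi> \<Longrightarrow> x \<in> frac"
  by (auto simp: frac_def)

lemma frac_E:
  assumes "x \<in> frac" obtains c where "c \<in> Z" "c \<noteq> 0" "c * x \<in> sp \<Phi>"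
  using assms by (auto simp: frac_def)

lemma sp_frac: "x \<in> sp \<Phi> \<Longrightarrow> x \<in> frac"
  by (rule frac_I[of 1]) (simp_all add: unital_subring_1[OF Z_subring])

lemma frac_subring: "unital_subring frac"
  unfolding unital_subring_def
proof (intro conjI ballI)
  show "1 \<in> frac" by (rule sp_frac[OF unital_subring_1[OF sp\<Phi>]])
  fix x y assume "x \<in> frac" "y \<in> frac"
  then obtain c d where c: "c \<in> Z" "c \<noteq> 0" "c * x \<in> sp \<Phi>" and d: "d \<in> Z" "d \<noteq> 0" "d * y \<in> sp \<Phi>"
    by (metis frac_E)
  have cd: "c * d \<in> Z" "c * d \<noteq> 0" using c d unital_subring_mult[OF Z_subring] by auto
  have "(c * d) * (x - y) = d * (c * x) - c * (d * y)"
    using Z_central[OF c(1), of d] by (simp add: right_diff_distrib mult.assoc[symmetric])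
  moreover have "d * (c * x) - c * (d * y) \<in> sp \<Phi>"
    by (intro unital_subring_diff[OF sp\<Phi>] unital_subring_mult[OF sp\<Phi>] Z_sub c d)
  ultimately show "x - y \<in> frac" using frac_I[OF cd] by simp
  have "(c * d) * (x * y) = (c * x) * (d * y)"
    using Z_central[OF d(1), of x] by (metis mult.assoc)
  then show "x * y \<in> frac" using frac_I[OF cd] unital_subring_mult[OF sp\<Phi> c(3) d(3)] by simp
qed

lemma frac_inverse:
  assumes x: "x \<in> frac"
  shows "inverse x \<in> frac"
proof (cases "x = 0")
  case False
  obtain c where c: "c \<in> Z" "c \<noteq> 0" "c * x \<in> sp \<Phi>" by (rule frac_E[OF x])
  have "c * x \<noteq> 0" using c False by simp
  then obtain a where a: "a \<in> sp \<Phi>" "(c * x) * a \<in> Z" "(c * x) * a \<noteq> 0" "a * (c * x) = (c * x) * a"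
    by (rule central_multiple[OF c(3)])
  have "((c * x) * a) * inverse x = a * c * (x * inverse x)" unfolding a(4)[symmetric] by (simp only: mult.assoc)
  also have "\<dots> = a * c" using False by simp
  finally have "((c * x) * a) * inverse x \<in> sp \<Phi>" using unital_subring_mult[OF sp\<Phi> a(1) Z_sub[OF c(1)]] by simp
  then show ?thesis by (rule frac_I[OF a(2,3)])
qed (use unital_subring_0[OF frac_subring] in simp)

lemma units_frac: "units_in frac = frac - {0}"
  unfolding units_in_def using frac_inverse by blast

lemma has_fractions_frac:
  assumes "sp \<Phi> \<subseteq> R"
  shows "has_fractions R frac"
  unfolding has_fractions_def
proof
  fix x assume "x \<in> frac"
  then obtain c where c: "c \<in> Z" "c \<noteq> 0" "c * x \<in> sp \<Phi>" by (rule frac_E)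
  have cR: "c \<in> R \<inter> units_in frac" using c(1,2) Z_sub sp_frac assms by (auto simp: units_frac)
  have "x = inverse c * (c * x)" using c(2) by (simp add: mult.assoc[symmetric])
  moreover from this have "x = (c * x) * inverse c" using Z_inverse_central[OF c(1), of "c * x"] by simp
  ultimately show "(\<exists>a\<in>R. \<exists>b\<in>R \<inter> units_in frac. x = a * inverse b) \<and>
      (\<exists>c\<in>R \<inter> units_in frac. \<exists>d\<in>R. x = inverse c * d)"
    using cR c(3) assms by blast
qed

lemma D_frac: "D \<subseteq> center_of frac"
proof
  fix x assume x: "x \<in> D"
  then obtain c d where cd: "x = c * inverse d" "c \<in> Z" "d \<in> Z" "d \<noteq> 0" by (auto simp: D_def)
  have "d * x = c" using cd Z_central[OF cd(3), of x] by (simp add: mult.assoc)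
  then have "x \<in> frac" using cd Z_sub by (intro frac_I[of d]) auto
  then show "x \<in> center_of frac" using D_central[OF x] by (simp add: center_of_def)
qed

lemma central_simple_frac: "central_simple frac"
  unfolding central_simple_def
proof (intro conjI ballI impI allI)
  show "unital_subring frac" by (rule frac_subring)
  fix z assume "z \<in> center_of frac" "z \<noteq> 0"
  then show "inverse z \<in> center_of frac"
    unfolding center_of_def using frac_inverse commute_inverse[of _ z] by fastforce
next
  let ?E = "M ` rp ` \<Phi>"
  show "\<exists>E. finite E \<and> E \<subseteq> frac \<and> (\<forall>x\<in>frac. \<exists>c. c ` E \<subseteq> center_of frac \<and> x = (\<Sum>e\<in>E. c e * e))"
  proof (intro exI[of _ ?E] conjI ballI)
    show "finite ?E" using finite_rp by simp
    show "?E \<subseteq> frac" using rp(1) M_in_sp sp_frac by blast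
    fix x assume "x \<in> frac"
    then obtain z where z: "z \<in> Z" "z \<noteq> 0" "z * x \<in> sp \<Phi>" by (rule frac_E)
    have "x = inverse z * (z * x)" using z(2) by (simp add: mult.assoc[symmetric])
    then show "\<exists>c. c ` ?E \<subseteq> center_of frac \<and> x = (\<Sum>e\<in>?E. c e * e)"
      using D_span_scaled[OF z(3) D_subring order_refl D_inverse[OF Z_in_D[OF z(1)]]] D_frac by fastforce
  qed
next
  fix I assume I: "I \<subseteq> frac \<and> 0 \<in> I \<and> (\<forall>x\<in>I. \<forall>y\<in>I. x - y \<in> I) \<and> (\<forall>x\<in>I. \<forall>s\<in>frac. s * x \<in> I \<and> x * s \<in> I)"
  show "I = {0} \<or> I = frac"
  proof (cases "I = {0}")
    case False
    then obtain x where x: "x \<in> I" "x \<noteq> 0" using I by blast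
    then have "inverse x \<in> frac" using I frac_inverse by blast
    then have "inverse x * x \<in> I" using I x by blast
    then have "1 \<in> I" using x by simp
    then have "s * 1 \<in> I" if "s \<in> frac" for s using I that by blast
    then show ?thesis using I by auto
  qed simp
qed

lemma order_frac: "order_in (sp \<Phi>) frac"
  unfolding order_in_def using sp\<Phi> sp_frac has_fractions_frac[OF order_refl] by blast

text \<open>\<open>maximal_order\<close> leaves the central simple algebra open. Elements of
  \<open>S\<close> acquire central denominators from \<open>central_multiple\<close>; conversely,
  nonzero central elements are invertible in \<open>S\<close>.\<close>

lemma frac_unique:
  assumes S: "central_simple S" "order_in (sp \<Phi>) S"
  shows "S = frac"
proof (intro equalityI subsetI)
  have sub: "sp \<Phi> \<subseteq> S" and fr: "has_fractions (sp \<Phi>) S" using S(2) by (simp_all add: order_in_def)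
  have inv: "z \<in> center_of S \<Longrightarrow> z \<noteq> 0 \<Longrightarrow> inverse z \<in> center_of S" for z
    using S(1) unfolding central_simple_def by blast
  have Ssub: "unital_subring S" using S(1) unfolding central_simple_def by blast
  {
    fix x assume "x \<in> S"
    then obtain a b where ab: "a \<in> sp \<Phi>" "b \<in> sp \<Phi>" "b \<noteq> 0" "x = a * inverse b"
      using fr unfolding has_fractions_def units_in_def by blast
    obtain b' where b': "b' \<in> sp \<Phi>" "b * b' \<in> Z" "b * b' \<noteq> 0" by (rule central_multiple[OF ab(2,3)])
    have "(b * b') * x = a * (inverse b * (b * b'))"
      unfolding Z_central[OF b'(2)] ab(4) by (simp only: mult.assoc)
    also have "\<dots> = a * b'" using ab(3) by (simp add: mult.assoc[symmetric])
    finally show "x \<in> frac" using frac_I[OF b'(2,3)] unital_subring_mult[OF sp\<Phi> ab(1) b'(1)] by simp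
  }
  fix x assume "x \<in> frac"
  then obtain c where c: "c \<in> Z" "c \<noteq> 0" "c * x \<in> sp \<Phi>" by (rule frac_E)
  have "c \<in> center_of S" using sub Z_sub[OF c(1)] Z_central[OF c(1)] by (auto simp: center_of_def)
  then have "inverse c \<in> S" using inv[OF _ c(2)] by (simp add: center_of_def)
  then have "inverse c * (c * x) \<in> S" using sub c(3) unital_subring_mult[OF Ssub] by blast
  then show "x \<in> S" using c(2) by (simp add: mult.assoc[symmetric])
qed

lemma maximal_order_iff:
  "maximal_order (sp \<Phi>) \<longleftrightarrow>
     (\<forall>R'. order_in R' frac \<and> equivalent_orders frac (sp \<Phi>) R' \<and> sp \<Phi> \<subseteq> R' \<longrightarrow> R' = sp \<Phi>)"
proof
  assume "maximal_order (sp \<Phi>)"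
  then obtain S where S: "central_simple S" "order_in (sp \<Phi>) S"
    "\<forall>R'. order_in R' S \<and> equivalent_orders S (sp \<Phi>) R' \<and> sp \<Phi> \<subseteq> R' \<longrightarrow> R' = sp \<Phi>"
    unfolding maximal_order_def by (elim exE conjE)
  show "\<forall>R'. order_in R' frac \<and> equivalent_orders frac (sp \<Phi>) R' \<and> sp \<Phi> \<subseteq> R' \<longrightarrow> R' = sp \<Phi>"
    using S(3) unfolding frac_unique[OF S(1,2)] .
next
  assume "\<forall>R'. order_in R' frac \<and> equivalent_orders frac (sp \<Phi>) R' \<and> sp \<Phi> \<subseteq> R' \<longrightarrow> R' = sp \<Phi>"
  then show "maximal_order (sp \<Phi>)"
    unfolding maximal_order_def by (intro exI[of _ frac] conjI central_simple_frac order_frac)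
qed

section \<open>Convex and closed monoids give maximal orders\<close>

lemma power_mult_central:
  assumes "z \<in> sp K" shows "(z * x) ^ n = z ^ n * x ^ n"
proof (induction n)
  case (Suc n)
  have "(z * x) ^ Suc n = z * (x * z ^ n) * x ^ n" using Suc by (simp add: mult.assoc)
  also have "x * z ^ n = z ^ n * x"
    by (rule power_commuting_commutes[OF spK_central[OF assms], symmetric])
  finally show ?case by (simp add: mult.assoc)
qed simp

text \<open>
  The exponents \<open>le (v x\<^sup>n v') = u + n g\<close> all lie in \<open>\<Phi>\<close>, so \<open>g\<close>, the leading exponent of \<open>x\<close>, is in the
  closure of its cone; the leading coefficients \<open>b c\<^sup>n\<close>, up to roots of unity, all lie in \<open>A\<close>.
\<close>

lemma leading_term:
  assumes A: "completely_integrally_closed A" and conv: "integrally_convex \<Phi>" "integrally_closed \<Phi>"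
    and R: "unital_subring R" and v: "v \<in> sp \<Phi>" "v \<noteq> 0" "v' \<in> sp \<Phi>" "v' \<noteq> 0"
    and vRv: "\<forall>r\<in>R. v * r * v' \<in> sp \<Phi>"
    and x: "x \<in> R" "x \<noteq> 0" and z: "z \<in> sp K" "z \<noteq> 0" "z * x \<in> T"
  defines "g \<equiv> le (z * x) - le z"
  shows "g \<in> \<Phi>"
    and "\<exists>c\<in>A. lc (z * x) = lc z * c * q powi form L (le z) g"
    and "\<And>w :: int ^ 'n \<Rightarrow> int. (\<And>f g. w (f + g) = w f + w g) \<Longrightarrow> wdeg w z + w g \<le> wdeg w (z * x)"
proof -
  define t where "t = z * x"
  have t: "t \<in> T" "t \<noteq> 0" using z x by (simp_all add: t_def)
  have zT: "z \<in> T" by (rule sp_T[OF z(1)])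
  have vT: "v \<in> T" "v' \<in> T" using v sp_T by blast+
  define s where "s n = v * x ^ n * v'" for n
  have s\<Phi>: "s n \<in> sp \<Phi>" for n unfolding s_def by (rule bspec[OF vRv unital_subring_power[OF R x(1)]])
  have s: "s n \<in> T" "s n \<noteq> 0" for n using s\<Phi>[of n] sp_T v x by (auto simp: s_def)
  have zn: "z ^ n \<in> T" "z ^ n \<noteq> 0" and tn: "t ^ n \<in> T" "t ^ n \<noteq> 0" for n
    using power_nonzero_T[OF zT z(2)] power_nonzero_T[OF t] by blast+
  \<comment> \<open>\<open>x\<close> need not lie in the torus. Its leading data are those of
    \<open>z * x\<close> relative to \<open>z\<close>, and centrality of \<open>z\<close> extends
    this to powers.\<close>
  have rel: "z ^ n * s n = v * t ^ n * v'" for n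
  proof -
    have "z ^ n \<in> sp K"
      using z(1) subgrp_0[OF subgrp_K] subgrp_add[OF subgrp_K]
      by (intro unital_subring_power[OF sp_subring]) (simp_all add: additive_submonoid_def)
    then have "z ^ n * v = v * z ^ n" by (rule spK_central)
    then have "z ^ n * s n = v * (z ^ n * x ^ n) * v'" by (simp add: s_def mult.assoc[symmetric])
    then show ?thesis by (simp only: t_def power_mult_central[OF z(1)])
  qed
  have vt: "v * t ^ n \<in> T" "v * t ^ n \<noteq> 0" for n using T_mult[OF vT(1) tn(1)] v tn by auto
  have g: "g = le t - le z" by (simp add: g_def t_def)
  have le_s: "le (s n) = (le v + le v') + int n *s g" for n
  proof -
    have "int n *s le z + le (s n) = le v + int n *s le t + le v'"
      using arg_cong[OF rel[of n], of le]
      unfolding lead_mult(1)[OF zn s] lead_mult(1)[OF vt vT(2) v(4)] lead_mult(1)[OF vT(1) v(2) tn]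
        lead_power(1)[OF zT z(2)] lead_power(1)[OF t] .
    then have "le (s n) = (le v + int n *s le t + le v') - int n *s le z" by (simp add: algebra_simps)
    then show ?thesis unfolding g by (simp add: Finite_Cartesian_Product.vec_eq_iff algebra_simps)
  qed
  have "le (s n) \<in> \<Phi>" for n using s\<Phi>[of n] le(1)[OF s] sp_iff[of "s n" \<Phi>] by blast
  then show "g \<in> \<Phi>"
    unfolding le_s by (rule asymptotic_direction[OF \<Phi> conv])
  \<comment> \<open>The leading coefficient of \<open>x\<close>, up to a power of \<open>q\<close>.
    The fixed element \<open>lc v * lc v'\<close> multiplies all its powers into \<open>A\<close>,
    as complete integral closure asks.\<close>
  define c0 where "c0 = lc t / lc z"
  have lcz: "lc z \<in> A" "lc z \<noteq> 0" using lc_in[OF zT] lc_nonzero[OF zT z(2)] .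
  have lcv: "lc v * lc v' \<in> A - {0}"
    using lc_in[OF vT(1)] lc_in[OF vT(2)] lc_nonzero[OF vT(1) v(2)] lc_nonzero[OF vT(2) v(4)] A_closed(5) by simp
  have "lc v * lc v' * c0 ^ n \<in> A" for n
  proof -
    obtain k where k: "lc (z ^ n) = lc z ^ n * q powi k" using lead_power(2)[OF zT z(2)] by blast
    obtain k' where k': "lc (t ^ n) = lc t ^ n * q powi k'" using lead_power(2)[OF t] by blast
    obtain m m' where "lc z ^ n * lc (s n) * q powi m = lc v * lc v' * lc t ^ n * q powi m'"
    proof
      show "lc z ^ n * lc (s n) * q powi (k + form L (le (z ^ n)) (le (s n)))
          = lc v * lc v' * lc t ^ n * q powi (k' + form L (le v) (le (t ^ n)) + form L (le (v * t ^ n)) (le v'))"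
        using arg_cong[OF rel[of n], of lc]
        unfolding lead_mult(2)[OF zn s] lead_mult(2)[OF vt vT(2) v(4)] lead_mult(2)[OF vT(1) v(2) tn] k k' q_powi_add
        by (simp only: mult_ac)
    qed
    then have "lc v * lc v' * (lc t ^ n / lc z ^ n) * q powi m' = lc (s n) * q powi m"
      using lcz(2) by (simp add: field_simps)
    then have "(lc v * lc v' * c0 ^ n) * q powi m' = lc (s n) * q powi m" by (simp add: c0_def power_divide)
    then have "(lc v * lc v' * c0 ^ n) * (q powi m' * q powi (- m')) = lc (s n) * q powi m * q powi (- m')"
      by (simp only: mult.assoc[symmetric])
    then have "lc v * lc v' * c0 ^ n = lc (s n) * q powi m * q powi (- m')"
      by (simp flip: q_powi_add)
    then show ?thesis using A_closed(5) lc_in[OF s(1)] q_powi_in by simp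
  qed
  then have "c0 \<in> A"
    using A lc_in[OF t(1)] lcz lcv unfolding completely_integrally_closed_def c0_def by blast
  moreover have "lc t = lc z * (c0 * q powi (- form L (le z) g)) * q powi form L (le z) g"
    using lcz(2) by (simp add: c0_def mult.assoc flip: q_powi_add)
  ultimately show "\<exists>c\<in>A. lc (z * x) = lc z * c * q powi form L (le z) g"
    using A_closed(5) q_powi_in unfolding t_def by blast
  fix w :: "int ^ 'n \<Rightarrow> int" assume w: "\<And>f g. w (f + g) = w f + w g"
  have w_scale: "w (int n *s f) = int n * w f" for n f
  proof (induction n)
    case 0
    show ?case using w[of 0 0] by simp
  next
    case (Suc n)
    have "int (Suc n) *s f = f + int n *s f" by (simp add: Finite_Cartesian_Product.vec_eq_iff algebra_simps)
    then have "w (int (Suc n) *s f) = w f + int n * w f" by (simp only: w Suc)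
    then show ?case by (simp add: algebra_simps)
  qed
  define a where "a = w (le v + le v')"
  define b where "b = wdeg w v + wdeg w v'"
  \<comment> \<open>A positive excess of the weight of \<open>g\<close> over that of
    \<open>x\<close> would be multiplied by \<open>n\<close> and pass every bound.\<close>
  have bound: "a + int n * (wdeg w z + w g - wdeg w t) \<le> b" for n
  proof -
    have "a + int n * w g = w (le (s n))" by (simp add: le_s w w_scale a_def)
    also have "\<dots> \<le> wdeg w (s n)" by (rule wdeg_ge[OF s(1) le(1)[OF s]])
    finally have "a + int n * w g \<le> wdeg w (s n)" .
    moreover have "int n * wdeg w z + wdeg w (s n) = wdeg w v + int n * wdeg w t + wdeg w v'"
      using arg_cong[OF rel[of n], of "wdeg w"]
      unfolding top_part_mult(1)[of w, OF w zn s] top_part_mult(1)[of w, OF w vt vT(2) v(4)]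
        top_part_mult(1)[of w, OF w vT(1) v(2) tn] wdeg_power[of w, OF w zT z(2)] wdeg_power[of w, OF w t] .
    ultimately show ?thesis by (simp add: b_def algebra_simps)
  qed
  show "wdeg w z + w g \<le> wdeg w (z * x)"
  proof (rule ccontr)
    assume "\<not> ?thesis"
    then have "wdeg w z + w g - wdeg w t \<ge> 1" by (simp add: t_def)
    then have "int n \<le> int n * (wdeg w z + w g - wdeg w t)" for n
      using mult_left_mono[of 1 _ "int n"] by simp
    then have "a + int (nat (b - a + 1)) \<le> b" using bound[of "nat (b - a + 1)"] by (meson add_left_mono order_trans)
    then show False by linarith
  qed
qed

text \<open>The order given by \<open>wt\<close> is not well-founded on the lattice; the descent
  ends because bounds in all coordinate directions confine the leading exponents to a finite
  box.\<close>

lemma maximal_order_if: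
  assumes A: "completely_integrally_closed A" and conv: "integrally_convex \<Phi>" "integrally_closed \<Phi>"
  shows "maximal_order (sp \<Phi>)"
  unfolding maximal_order_iff
proof (intro allI impI, elim conjE)
  fix R assume ord: "order_in R frac" and eq: "equivalent_orders frac (sp \<Phi>) R" and sub: "sp \<Phi> \<subseteq> R"
  have R: "unital_subring R" using ord by (simp add: order_in_def)
  obtain a b where ab: "a \<in> frac" "a \<noteq> 0" "b \<in> frac" "b \<noteq> 0" "\<And>r. r \<in> R \<Longrightarrow> a * r * b \<in> sp \<Phi>"
    using eq unfolding equivalent_orders_def units_frac by blast
  obtain c where c: "c \<in> Z" "c \<noteq> 0" "c * a \<in> sp \<Phi>" by (rule frac_E[OF ab(1)])
  obtain d where d: "d \<in> Z" "d \<noteq> 0" "d * b \<in> sp \<Phi>" by (rule frac_E[OF ab(3)])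
  \<comment> \<open>Central denominators are cleared so that both multipliers lie in
    \<open>sp \<Phi>\<close>.\<close>
  define v where "v = c * a"
  define v' where "v' = d * b"
  have v: "v \<in> sp \<Phi>" "v \<noteq> 0" "v' \<in> sp \<Phi>" "v' \<noteq> 0" using c d ab by (simp_all add: v_def v'_def)
  have vRv: "\<forall>r\<in>R. v * r * v' \<in> sp \<Phi>"
  proof
    fix r assume r: "r \<in> R"
    have "v * r * v' = c * (d * (a * r * b))"
      unfolding v_def v'_def using Z_central[OF d(1), of "a * r"] by (simp add: mult.assoc) (metis mult.assoc)
    then show "v * r * v' \<in> sp \<Phi>" using Z_sub[OF c(1)] Z_sub[OF d(1)] ab(5)[OF r] unital_subring_mult[OF sp\<Phi>] by simp
  qed
  have "x0 \<in> sp \<Phi>" if x0: "x0 \<in> R" for x0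
  proof -
    obtain z where z: "z \<in> sp K" "z \<noteq> 0" "z * x0 \<in> T" by (rule central_fraction)
    have zT: "z \<in> T" by (rule sp_T[OF z(1)])
    define up where "up i f = f $ i" for i and f :: "int ^ 'n"
    define dn where "dn i f = - (f $ i)" for i and f :: "int ^ 'n"
    have up: "up i (f + g) = up i f + up i g" and dn: "dn i (f + g) = dn i f + dn i g" for i f g
      by (simp_all add: up_def dn_def)
    \<comment> \<open>\<open>Q\<close> confines the exponents of \<open>z * x\<close> throughout the
      descent; \<open>Bx\<close> holds the leading exponents of \<open>x\<close> that this leaves
      possible by \<open>leading_term\<close>.\<close>
    define Q where "Q = {f. \<forall>i. up i f \<le> wdeg (up i) (z * x0) \<and> dn i f \<le> wdeg (dn i) (z * x0)}"
    define Bx where "Bx = {g. \<forall>i. wdeg (up i) z + up i g \<le> wdeg (up i) (z * x0) \<and> wdeg (dn i) z + dn i g \<le> wdeg (dn i) (z * x0)}"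
    have finB: "finite Bx"
      by (rule finite_subset[OF _ finite_int_box[of "\<lambda>i. wdeg (dn i) z - wdeg (dn i) (z * x0)"
            "\<lambda>i. wdeg (up i) (z * x0) - wdeg (up i) z"]])
        (auto simp: Bx_def up_def dn_def algebra_simps)
    \<comment> \<open>Counts the box points not above the current leading exponent; the subtraction
      takes that exponent itself out of the count.\<close>
    define m where "m x = card {g \<in> Bx. wt g \<le> wt (le (z * x) - le z)}" for x
    have "x \<in> sp \<Phi>" if "x \<in> R" "z * x \<in> sp Q" for x
      using that
    proof (induction x rule: measure_induct_rule[of m])
      case (less x)
      show ?case
      proof (cases "x = 0")
        case True
        then show ?thesis by (simp add: sp_0)
      next
        case False
        have tT: "z * x \<in> T" by (rule sp_T[OF less.prems(2)])
        have t0: "z * x \<noteq> 0" using False z(2) by simp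
        define g where "g = le (z * x) - le z"
        note lead = leading_term[OF A conv R v vRv less.prems(1) False z(1,2) tT, folded g_def]
        obtain c where c: "c \<in> A" "lc (z * x) = lc z * c * q powi form L (le z) g" using lead(2) by blast
        let ?y = "\<iota> c * M g"
        have y\<Phi>: "?y \<in> sp \<Phi>" by (rule sp_mono_el[OF c(1) lead(1)])
        have yT: "?y \<in> T" by (rule sp_T[OF y\<Phi>])
        have wQ: "wdeg (up i) (z * x) \<le> wdeg (up i) (z * x0)" "wdeg (dn i) (z * x) \<le> wdeg (dn i) (z * x0)" for i
        proof -
          obtain f where f: "coef (z * x) f \<noteq> 0" "up i f = wdeg (up i) (z * x)" by (rule wdeg_attained[OF tT t0])
          then have "f \<in> Q" using less.prems(2) sp_iff[of "z * x" Q] by blast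
          then have "up i f \<le> wdeg (up i) (z * x0)" unfolding Q_def by blast
          then show "wdeg (up i) (z * x) \<le> wdeg (up i) (z * x0)" by (simp only: f(2))
          obtain f where f: "coef (z * x) f \<noteq> 0" "dn i f = wdeg (dn i) (z * x)" by (rule wdeg_attained[OF tT t0])
          then have "f \<in> Q" using less.prems(2) sp_iff[of "z * x" Q] by blast
          then have "dn i f \<le> wdeg (dn i) (z * x0)" unfolding Q_def by blast
          then show "wdeg (dn i) (z * x) \<le> wdeg (dn i) (z * x0)" by (simp only: f(2))
        qed
        have gB: "g \<in> Bx" unfolding Bx_def
          using order.trans[OF lead(3)[OF up] wQ(1)] order.trans[OF lead(3)[OF dn] wQ(2)] by blast
        have "z * ?y \<in> sp Q"
        proof (rule sp_mult[where Y = "{f. coef z f \<noteq> 0}" and Z = "{g}"])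
          show "z \<in> sp {f. coef z f \<noteq> 0}" using sp_iff[of z "{f. coef z f \<noteq> 0}"] zT by blast
          show "?y \<in> sp {g}" by (rule sp_mono_el[OF c(1)]) simp
          fix f h assume "f \<in> {f. coef z f \<noteq> 0}" "h \<in> {g}"
          then have fh: "up i f \<le> wdeg (up i) z" "dn i f \<le> wdeg (dn i) z" "h = g" for i
            using wdeg_ge[OF zT] by auto
          have "up i (f + g) \<le> wdeg (up i) (z * x0) \<and> dn i (f + g) \<le> wdeg (dn i) (z * x0)" for i
          proof -
            have "wdeg (up i) z + up i g \<le> wdeg (up i) (z * x0) \<and> wdeg (dn i) z + dn i g \<le> wdeg (dn i) (z * x0)"
              using gB unfolding Bx_def by blast
            then show ?thesis using fh(1,2)[of i] unfolding up dn by linarith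
          qed
          then show "f + h \<in> Q" unfolding Q_def fh(3) by blast
        qed
        then have Q': "z * (x - ?y) \<in> sp Q" using sp_diff[OF less.prems(2)] by (simp add: right_diff_distrib)
        have R': "x - ?y \<in> R" using unital_subring_diff[OF R less.prems(1)] sub y\<Phi> by blast
        have "x - ?y \<in> sp \<Phi>"
        proof (cases "x - ?y = 0")
          case True
          then show ?thesis by (simp only: sp_0)
        next
          case False
          have t': "z * (x - ?y) \<in> T" "z * (x - ?y) \<noteq> 0" using sp_T[OF Q'] False z(2) by simp_all
          have zy: "z * ?y = z * x - z * (x - ?y)" by (simp add: right_diff_distrib)
          have y0: "?y \<noteq> 0"
          proof
            assume "?y = 0"
            then have "c = 0" using \<iota>_eq_0_iff[OF c(1)] M_nonzero by simp
            then show False using c(2) lc_nonzero[OF tT t0] by simp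
          qed
          have ly: "le ?y = g"
            using le(1)[OF yT y0] by (simp add: coef_mono[OF c(1)] split: if_splits)
          then have lcy: "lc ?y = c" by (simp add: lc_def coef_mono[OF c(1)])
          have lzy: "le (z * ?y) = le (z * x)" "lc (z * ?y) = lc (z * x)"
          proof -
            have "le (z * ?y) = le z + g" using lead_mult(1)[OF zT z(2) yT y0] unfolding ly .
            then show "le (z * ?y) = le (z * x)" by (simp add: g_def)
            show "lc (z * ?y) = lc (z * x)" using lead_mult(2)[OF zT z(2) yT y0] unfolding ly lcy c(2) .
          qed
          have zyT: "z * ?y \<in> T" by (rule T_mult[OF zT yT])
          have zy0: "z * ?y \<noteq> 0" using z(2) y0 by simp
          \<comment> \<open>\<open>z * ?y\<close> has the same leading term as \<open>z * x\<close>,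
            so the leading exponent of the difference is smaller.\<close>
          have less_wt: "wt (le (z * (x - ?y))) < wt (le (z * x))"
          proof -
            let ?f = "le (z * (x - ?y))"
            have cf: "coef (z * (x - ?y)) f = coef (z * x) f - coef (z * ?y) f" for f
              unfolding right_diff_distrib by (rule coef_diff[OF tT zyT])
            have "coef (z * x) ?f \<noteq> 0 \<or> coef (z * ?y) ?f \<noteq> 0" using le(1)[OF t'] unfolding cf by auto
            then have "wt ?f \<le> wt (le (z * x))"
              using wdeg_ge[OF tT, of ?f wt] wdeg_ge[OF zyT, of ?f wt] le(2)[OF tT t0] le(2)[OF zyT zy0] lzy(1) by auto
            moreover have "?f \<noteq> le (z * x)"
            proof
              assume "?f = le (z * x)"
              then have "coef (z * (x - ?y)) ?f = lc (z * x) - lc (z * ?y)" unfolding cf lc_def lzy(1) by simp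
              then show False using le(1)[OF t'] lzy(2) by simp
            qed
            ultimately show ?thesis using wt_inj by (metis order_le_less)
          qed
          have "{h \<in> Bx. wt h \<le> wt (le (z * (x - ?y)) - le z)} \<subset> {h \<in> Bx. wt h \<le> wt (le (z * x) - le z)}"
          proof
            show "{h \<in> Bx. wt h \<le> wt (le (z * (x - ?y)) - le z)} \<subseteq> {h \<in> Bx. wt h \<le> wt (le (z * x) - le z)}"
              using less_wt unfolding wt_diff by auto
            have "g \<in> {h \<in> Bx. wt h \<le> wt (le (z * x) - le z)}" using gB by (simp add: g_def)
            moreover have "g \<notin> {h \<in> Bx. wt h \<le> wt (le (z * (x - ?y)) - le z)}"
              using less_wt by (simp add: g_def wt_diff)
            ultimately show "{h \<in> Bx. wt h \<le> wt (le (z * (x - ?y)) - le z)} \<noteq> {h \<in> Bx. wt h \<le> wt (le (z * x) - le z)}"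
              by blast
          qed
          then have "m (x - ?y) < m x" unfolding m_def by (rule psubset_card_mono[rotated]) (use finB in simp)
          then show ?thesis by (rule less.IH[OF _ R' Q'])
        qed
        then have "(x - ?y) + ?y \<in> sp \<Phi>" by (rule sp_add[OF _ y\<Phi>])
        then show ?thesis by simp
      qed
    qed
    moreover have "z * x0 \<in> sp Q"
      using sp_iff[of "z * x0" Q] z(3) wdeg_ge[OF z(3)] unfolding Q_def by blast
    ultimately show ?thesis using x0 by blast
  qed
  then show "R = sp \<Phi>" using sub by blast
qed

text \<open>Multiplication by \<open>M u\<close> takes \<open>sp \<Psi>\<close> back into
  \<open>sp \<Phi>\<close>, which makes the two orders equivalent. The multiple \<open>l u\<close>
  lies in \<open>K\<close> and provides a central denominator, so both have the same
  fractions.\<close>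

lemma maximal_order_adjoin:
  assumes max: "maximal_order (sp \<Phi>)" and h: "h \<in> group_of \<Phi>" and u: "u \<in> \<Phi>" "\<And>n. u + int n *s h \<in> \<Phi>"
  shows "h \<in> \<Phi>"
proof -
  define \<Psi> where "\<Psi> = {f + int n *s h | f n. f \<in> \<Phi>}"
  have \<Psi>: "additive_submonoid \<Psi>"
    unfolding additive_submonoid_def
  proof (intro conjI ballI)
    have "0 = 0 + int 0 *s h" by simp
    then show "0 \<in> \<Psi>" unfolding \<Psi>_def using \<Phi>_0 by blast
    fix a b assume "a \<in> \<Psi>" "b \<in> \<Psi>"
    then obtain f n g k where e: "a = f + int n *s h" "f \<in> \<Phi>" "b = g + int k *s h" "g \<in> \<Phi>" unfolding \<Psi>_def by blast
    have "a + b = (f + g) + int (n + k) *s h"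
      unfolding e by (simp add: Finite_Cartesian_Product.vec_eq_iff algebra_simps)
    then show "a + b \<in> \<Psi>" unfolding \<Psi>_def using \<Phi>_add[OF e(2,4)] by blast
  qed
  have sub: "\<Phi> \<subseteq> \<Psi>"
  proof
    fix f assume "f \<in> \<Phi>"
    moreover have "f = f + int 0 *s h" by simp
    ultimately show "f \<in> \<Psi>" unfolding \<Psi>_def by blast
  qed
  have h\<Psi>: "h \<in> \<Psi>"
  proof -
    have "h = 0 + int 1 *s h" by simp
    then show ?thesis unfolding \<Psi>_def using \<Phi>_0 by blast
  qed
  have u\<Psi>: "u + f \<in> \<Phi>" if f\<Psi>: "f \<in> \<Psi>" for f
  proof -
    obtain f' n where "f = f' + int n *s h" "f' \<in> \<Phi>" using f\<Psi> unfolding \<Psi>_def by blast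
    then show ?thesis using \<Phi>_add[OF _ u(2), of f' n] by (simp add: algebra_simps)
  qed
  have lu: "int l *s u \<in> \<Phi> \<inter> K" using \<Phi>_scale[OF u(1)] full_K by (auto simp: full_def)
  have lu\<Psi>: "int l *s u + f \<in> \<Phi>" if "f \<in> \<Psi>" for f
  proof -
    have eq: "int l *s u + f = int (l - 1) *s u + (u + f)"
      using l_pos by (simp add: Finite_Cartesian_Product.vec_eq_iff of_nat_diff algebra_simps)
    show ?thesis unfolding eq by (rule \<Phi>_add[OF \<Phi>_scale[OF u(1)] u\<Psi>[OF that]])
  qed
  have spsub: "sp \<Phi> \<subseteq> sp \<Psi>" by (rule sp_mono[OF sub])
  have "sp \<Psi> \<subseteq> frac"
  proof
    fix x assume x: "x \<in> sp \<Psi>"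
    have "M (int l *s u) * x \<in> sp \<Phi>"
      by (rule sp_mult[OF M_in_sp[of "int l *s u" "{int l *s u}"] x]) (use lu\<Psi> in auto)
    then show "x \<in> frac" by (rule frac_I[OF M_in_sp[OF lu] M_nonzero])
  qed
  then have "order_in (sp \<Psi>) frac"
    unfolding order_in_def using sp_subring[OF \<Psi>] has_fractions_frac[OF spsub] by blast
  moreover have "equivalent_orders frac (sp \<Phi>) (sp \<Psi>)"
    unfolding equivalent_orders_def
  proof
    have one: "1 \<in> units_in frac" using unital_subring_1[OF frac_subring] by (simp add: units_frac)
    then show "\<exists>a\<in>units_in frac. \<exists>b\<in>units_in frac. \<forall>r\<in>sp \<Phi>. a * r * b \<in> sp \<Psi>"
      using spsub by (intro bexI[of _ 1]) auto
    have "M u \<in> units_in frac" using sp_frac[OF M_in_sp[OF u(1)]] M_nonzero by (simp add: units_frac)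
    moreover have "M u * r * 1 \<in> sp \<Phi>" if "r \<in> sp \<Psi>" for r
      using sp_mult[OF M_in_sp[of u "{u}"] that, of \<Phi>] u\<Psi> by simp
    ultimately show "\<exists>a\<in>units_in frac. \<exists>b\<in>units_in frac. \<forall>r\<in>sp \<Psi>. a * r * b \<in> sp \<Phi>"
      using one by blast
  qed
  ultimately have "sp \<Psi> = sp \<Phi>" using max spsub unfolding maximal_order_iff by blast
  then have "M h \<in> sp \<Phi>" using M_in_sp[OF h\<Psi>] by simp
  then show ?thesis using sp_iff[of "M h" \<Phi>] coef_M[of h h] by simp
qed

text \<open>With \<open>h = f - g\<close> and \<open>n = a k + b\<close>, the multiples of
  \<open>k h\<close> are already in \<open>\<Phi>\<close>, and the shift by \<open>k g\<close>
  outweighs the at most \<open>k - 1\<close> remaining copies of \<open>- g\<close>.\<close>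

lemma maximal_order_divisible:
  assumes max: "maximal_order (sp \<Phi>)" and h: "h \<in> group_of \<Phi>" and k: "k > 0" "k *s h \<in> \<Phi>"
  shows "h \<in> \<Phi>"
proof -
  obtain f g where fg: "f \<in> \<Phi>" "g \<in> \<Phi>" "h = f - g" using h by (auto simp: group_of_def)
  note scale = submonoid_scale[OF \<Phi>]
  show ?thesis
  proof (rule maximal_order_adjoin[OF max h])
    show "k *s g \<in> \<Phi>" using scale[OF fg(2)] k by simp
    fix n
    let ?a = "int n div k" and ?b = "int n mod k"
    have n: "int n = ?a * k + ?b" by simp
    have eq: "k *s g + int n *s h = ?a *s (k *s h) + ((k - ?b) *s g + ?b *s f)"
    proof -
      have "k *s g + (a * k + b) *s h = a *s (k *s h) + ((k - b) *s g + b *s f)" for a b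
        unfolding fg(3) by (simp add: Finite_Cartesian_Product.vec_eq_iff algebra_simps)
      from this[of ?a ?b] show ?thesis by (simp only: n[symmetric])
    qed
    have "k - ?b \<ge> 0" "?b \<ge> 0" "?a \<ge> 0"
      using k(1) by (simp_all add: pos_imp_zdiv_nonneg_iff less_imp_le)
    then show "k *s g + int n *s h \<in> \<Phi>"
      unfolding eq by (intro \<Phi>_add scale[OF k(2)] scale[OF fg(2)] scale[OF fg(1)])
  qed
qed

text \<open>A lattice point on a segment has a multiple in \<open>\<Phi>\<close> and is reached by
  division. For a limit direction \<open>h\<close>, \<open>closure_direction\<close> yields
  \<open>u\<close> such that each \<open>u + n h\<close> has a multiple in \<open>\<Phi>\<close>;
  division and then adjoining \<open>h\<close> put \<open>h\<close> into
  \<open>\<Phi>\<close>.\<close>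

lemma maximal_order_only_if:
  assumes max: "maximal_order (sp \<Phi>)"
  shows "integrally_convex \<Phi>" and "integrally_closed \<Phi>"
proof -
  show "integrally_convex \<Phi>"
    unfolding integrally_convex_def
  proof (intro ballI impI)
    fix f g h assume f: "f \<in> \<Phi>" and g: "g \<in> \<Phi>" and h: "h \<in> group_of \<Phi>"
      and seg: "real_vec h \<in> closed_segment (real_vec f) (real_vec g)"
    obtain s where s: "0 \<le> s" "s \<le> 1" "real_vec h = (1 - s) *\<^sub>R real_vec f + s *\<^sub>R real_vec g"
      using seg unfolding in_segment by blast
    have "real_vec h = (\<Sum>i\<in>UNIV. (if i then s else 1 - s) *\<^sub>R real_vec (if i then g else f))"
      unfolding UNIV_bool using s(3) by simp
    then have "\<exists>k>0. k *s h \<in> \<Phi>"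
      by (rule multiple_in_submonoid[OF \<Phi>, rotated -1]) (use s f g in simp_all)
    then obtain k where "k > 0" "k *s h \<in> \<Phi>" by blast
    then show "h \<in> \<Phi>" by (rule maximal_order_divisible[OF max h])
  qed
  obtain u where u: "u \<in> \<Phi>"
    "\<And>h n. h \<in> group_of \<Phi> \<Longrightarrow> h \<noteq> 0 \<Longrightarrow> sgn (real_vec h) \<in> closure (rays (real_vec ` \<Phi>)) \<Longrightarrow>
      \<exists>k>0. k *s (u + int n *s h) \<in> \<Phi>"
    using closure_direction[OF \<Phi>] by blast
  have "\<Phi> \<subseteq> group_of \<Phi>"
  proof
    fix f assume "f \<in> \<Phi>"
    moreover have "f = f - 0" by simp
    ultimately show "f \<in> group_of \<Phi>" unfolding group_of_def using \<Phi>_0 by blast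
  qed
  then have sub: "rays (real_vec ` \<Phi>) \<subseteq> rays (real_vec ` group_of \<Phi>)" unfolding rays_def by blast
  have "rays (real_vec ` group_of \<Phi>) \<inter> closure (rays (real_vec ` \<Phi>)) \<subseteq> rays (real_vec ` \<Phi>)"
  proof
    fix x assume x: "x \<in> rays (real_vec ` group_of \<Phi>) \<inter> closure (rays (real_vec ` \<Phi>))"
    then have "x \<in> rays (real_vec ` group_of \<Phi>)" by blast
    then obtain h where h: "h \<in> group_of \<Phi>" "real_vec h \<noteq> 0" "x = sgn (real_vec h)" unfolding rays_iff by blast
    have h0: "h \<noteq> 0" using h(2) by (auto simp: real_vec_0)
    have "u + int n *s h \<in> \<Phi>" for n
    proof -
      obtain k where "k > 0" "k *s (u + int n *s h) \<in> \<Phi>" using u(2)[OF h(1) h0, of n] x h(3) by blast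
      then show ?thesis by (rule maximal_order_divisible[OF max group_of_add[OF \<Phi> u(1) h(1)]])
    qed
    then have "h \<in> \<Phi>" by (rule maximal_order_adjoin[OF max h(1) u(1)])
    then show "x \<in> rays (real_vec ` \<Phi>)" unfolding rays_iff using h(2,3) by blast
  qed
  then have "rays (real_vec ` \<Phi>) = rays (real_vec ` group_of \<Phi>) \<inter> closure (rays (real_vec ` \<Phi>))"
    using sub closure_subset by blast
  then show "integrally_closed \<Phi>" unfolding integrally_closed_def closedin_closed by blast
qed

end

section \<open>Intersections of monomial subalgebras\<close>

lemma unital_subring_INT: "(\<And>i. i \<in> I \<Longrightarrow> unital_subring (R i)) \<Longrightarrow> unital_subring (\<Inter>i\<in>I. R i)"
  unfolding unital_subring_def by blast

lemma unital_subring_Int: "unital_subring R \<Longrightarrow> unital_subring S \<Longrightarrow> unital_subring (R \<inter> S)"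
  unfolding unital_subring_def by blast

lemma unital_subring_center:
  assumes R: "unital_subring R"
  shows "unital_subring (center_of R)"
  unfolding unital_subring_def
proof (intro conjI ballI)
  show "1 \<in> center_of R" using unital_subring_1[OF R] by (simp add: center_of_def)
  fix x y assume "x \<in> center_of R" "y \<in> center_of R"
  then have x: "x \<in> R" "\<And>r. r \<in> R \<Longrightarrow> x * r = r * x" and y: "y \<in> R" "\<And>r. r \<in> R \<Longrightarrow> y * r = r * y"
    by (simp_all add: center_of_def)
  show "x - y \<in> center_of R"
    using unital_subring_diff[OF R x(1) y(1)] x(2) y(2) by (simp add: center_of_def left_diff_distrib right_diff_distrib)
  have "(x * y) * r = r * (x * y)" if "r \<in> R" for r
    using x(2)[OF that] y(2)[OF that] by (metis mult.assoc)
  then show "x * y \<in> center_of R" using unital_subring_mult[OF R x(1) y(1)] by (simp add: center_of_def)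
qed

context monomial_subalgebra
begin

lemma Z_eq: "Z = sp \<Phi> \<inter> center_of T"
  unfolding center_T sp_Int ..

lemma \<iota>_in_Z: "\<iota> ` A \<subseteq> Z"
  using \<iota>_in_sp \<Phi>_0 subgrp_0[OF subgrp_K] by blast

lemma trace_in_Z: "x \<in> sp \<Phi> \<Longrightarrow> of_nat d * proj K x \<in> Z"
  using proj_sp[of x \<Phi> K] by (intro unital_subring_mult[OF Z_subring] unital_subring_of_nat[OF Z_subring]) (simp add: Int_commute)

lemma Z_center: "Z \<subseteq> center_of (sp \<Phi>)"
  using Z_sub Z_central by (auto simp: center_of_def)

lemma cayley_hamilton_monomial:
  assumes "frame_kernel l (L + L) = frame_kernel l L" "d * d = index K"
  shows "cayley_hamilton d (\<iota> ` A) (sp \<Phi>) (sp \<Phi> \<inter> center_of T) (reduced_trace T)"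
  unfolding Z_eq[symmetric]
  by (rule cayley_hamilton_subring[OF assms sp\<Phi>])
    (use Z_subring Z_sub sp_mono[of "\<Phi> \<inter> K" K] \<iota>_in_Z trace_in_Z sp_mono[of \<Phi> UNIV] in blast)+

end

text \<open>The root is the index of a self-orthogonal subgroup; so \<open>frame_degree\<close> is a
  natural number.\<close>

lemma index_kernel_square:
  fixes B :: "int ^ 'n::finite ^ 'n" and q :: "'c::field"
  assumes "l > 0" "primitive_root_of_unity l q" "skew_symmetric_mod l B"
  obtains d where "d * d = index (frame_kernel l B)"
proof -
  interpret root_of_unity q l by unfold_locales fact+
  obtain P where "lagrangian l B P" using lagrangian_exists[OF assms(1,3)] .
  then show ?thesis using that index_lagrangian_aux(2)[OF assms(3)] by metis
qed

text \<open>\<open>d\<close> comes from the kernel of \<open>\<Lambda>\<close>, the degree of the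
  reduced trace from that of the doubled form; the Cayley-Hamilton claims concern the case in which
  the kernels coincide. Complete integral closure enters where leading coefficients of an overring
  have to return to the coefficient ring.\<close>

theorem theoremC:
  fixes q :: "'k::{idom, ring_char_0} fract alg_closure"
    and \<iota> :: "'k fract alg_closure \<Rightarrow> 'a::division_ring"
    and l :: nat
    and ex :: "'n::finite set"
    and \<Sigma> :: "('a, 'n) seed"
    and \<Lambda> :: "int ^ 'n ^ 'n"
  assumes "l > 0"
    and "primitive_root_of_unity l q"
    and "algebra_structure (base_ring q) \<iota>"
    and "quantum_seed q \<iota> l ex \<Sigma>"
    and "toric_frame q \<iota> l (fst \<Sigma>) \<Lambda>"
  shows "\<exists>d::nat. real d = frame_degree l \<Lambda> \<and>
    (\<forall>\<Phi>. additive_submonoid \<Phi> \<and> frame_kernel l (\<Lambda> + \<Lambda>) = frame_kernel l \<Lambda> \<longrightarrow>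
      cayley_hamilton d (\<iota> ` base_ring q)
        (monomial_algebra q \<iota> \<Sigma> \<Phi>)
        (monomial_algebra q \<iota> \<Sigma> \<Phi> \<inter> center_of (seed_torus q \<iota> \<Sigma>))
        (reduced_trace (seed_torus q \<iota> \<Sigma>))) \<and>
    (\<forall>\<Phi>. additive_submonoid \<Phi> \<longrightarrow>
      (completely_integrally_closed (base_ring q) \<longrightarrow>
        (maximal_order (monomial_algebra q \<iota> \<Sigma> \<Phi>) \<longleftrightarrow> integrally_convex \<Phi> \<and> integrally_closed \<Phi>)) \<and>
      (maximal_order (monomial_algebra q \<iota> \<Sigma> \<Phi>) \<longrightarrow> integrally_convex \<Phi> \<and> integrally_closed \<Phi>)) \<and>
    (\<forall>\<Sigma>' \<Lambda>'. mutation_equivalent q \<iota> l ex \<Sigma> \<Sigma>' \<and> toric_frame q \<iota> l (fst \<Sigma>') \<Lambda>' \<longrightarrow>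
      frame_degree l \<Lambda>' = frame_degree l \<Lambda>) \<and>
    (\<forall>\<Theta> \<Phi> \<AA>. \<Theta> \<noteq> {} \<and> (\<forall>\<Sigma>'\<in>\<Theta>. mutation_equivalent q \<iota> l ex \<Sigma> \<Sigma>' \<and> additive_submonoid (\<Phi> \<Sigma>')) \<and>
        \<AA> = (\<Inter>\<Sigma>'\<in>\<Theta>. monomial_algebra q \<iota> \<Sigma>' (\<Phi> \<Sigma>')) \<longrightarrow>
      (\<forall>\<Sigma>'\<in>\<Theta>. \<forall>\<Sigma>''\<in>\<Theta>. \<forall>x\<in>\<AA>.
        reduced_trace (seed_torus q \<iota> \<Sigma>') x = reduced_trace (seed_torus q \<iota> \<Sigma>'') x) \<and>
      (\<forall>\<Sigma>'\<in>\<Theta>. reduced_trace (seed_torus q \<iota> \<Sigma>') ` \<AA>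
        \<subseteq> (\<Inter>\<Sigma>''\<in>\<Theta>. center_of (monomial_algebra q \<iota> \<Sigma>'' (\<Phi> \<Sigma>'')))) \<and>
      (frame_kernel l (\<Lambda> + \<Lambda>) = frame_kernel l \<Lambda> \<longrightarrow>
        (\<forall>\<Sigma>'\<in>\<Theta>.
          cayley_hamilton d (\<iota> ` base_ring q) \<AA>
            (\<Inter>\<Sigma>''\<in>\<Theta>. monomial_algebra q \<iota> \<Sigma>'' (\<Phi> \<Sigma>'') \<inter> center_of (seed_torus q \<iota> \<Sigma>''))
            (reduced_trace (seed_torus q \<iota> \<Sigma>')) \<and>
          ((\<Inter>\<Sigma>''\<in>\<Theta>. center_of (monomial_algebra q \<iota> \<Sigma>'' (\<Phi> \<Sigma>''))) \<subseteq> center_of (seed_torus q \<iota> \<Sigma>') \<longrightarrow>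
            cayley_hamilton d (\<iota> ` base_ring q) \<AA>
              (\<Inter>\<Sigma>''\<in>\<Theta>. center_of (monomial_algebra q \<iota> \<Sigma>'' (\<Phi> \<Sigma>'')))
              (reduced_trace (seed_torus q \<iota> \<Sigma>'))))))"
proof -
  let ?A = "base_ring q"
  note q = assms(1-3)
  have sub: "monomial_subalgebra q l ?A \<iota> (fst \<Sigma>') L \<Phi>"
    if "toric_frame q \<iota> l (fst \<Sigma>') L" "additive_submonoid \<Phi>" for \<Sigma>' :: "('a, 'n) seed" and L \<Phi>
    by (intro monomial_subalgebra.intro monomial_subalgebra_axioms.intro toric_frame_quantum_torus[OF q] that)
  have alg: "monomial_algebra q \<iota> \<Sigma>' \<Phi> = quantum_torus.sp ?A \<iota> (fst \<Sigma>') \<Phi>"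
    if "toric_frame q \<iota> l (fst \<Sigma>') L" for \<Sigma>' :: "('a, 'n) seed" and L \<Phi>
    unfolding monomial_algebra_def monomial_span_def
    by (rule quantum_torus.sp_eq_span[OF toric_frame_quantum_torus[OF q that], symmetric])
  have torus: "seed_torus q \<iota> \<Sigma>' = quantum_torus.sp ?A \<iota> (fst \<Sigma>') UNIV"
    if "toric_frame q \<iota> l (fst \<Sigma>') L" for \<Sigma>' :: "('a, 'n) seed" and L
    using alg[OF that, of UNIV] by (simp add: seed_torus_def monomial_algebra_def)
  have skew: "skew_symmetric_mod l \<Lambda>" using assms(5) by (simp add: toric_frame_def)
  obtain d where d: "d * d = index (frame_kernel l \<Lambda>)" by (rule index_kernel_square[OF q(1,2) skew])
  \<comment> \<open>The degree of the splittings, as opposed to \<open>d\<close>; equal kernels make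
    the two agree.\<close>
  obtain e where e: "e * e = index (frame_kernel l (\<Lambda> + \<Lambda>))"
    by (rule index_kernel_square[OF q(1,2) skew_symmetric_mod_double[OF skew]])
  have ed: "e = d" if "frame_kernel l (\<Lambda> + \<Lambda>) = frame_kernel l \<Lambda>"
  proof -
    have "e * e = d * d" using d e that by simp
    then show ?thesis by (metis power2_eq_square power2_eq_iff_nonneg zero_le)
  qed
  have K: "quantum_torus.K l L = frame_kernel l (L + L)" if "quantum_torus q l ?A \<iota> M L" for M :: "int ^ 'n \<Rightarrow> 'a" and L
    using quantum_torus.K_def[OF that] quantum_torus.W_def[OF that] by simp
  have part1: "cayley_hamilton d (\<iota> ` ?A) (monomial_algebra q \<iota> \<Sigma> \<Phi>)
      (monomial_algebra q \<iota> \<Sigma> \<Phi> \<inter> center_of (seed_torus q \<iota> \<Sigma>)) (reduced_trace (seed_torus q \<iota> \<Sigma>))"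
    if \<Phi>: "additive_submonoid \<Phi>" and ker: "frame_kernel l (\<Lambda> + \<Lambda>) = frame_kernel l \<Lambda>" for \<Phi>
  proof -
    interpret s: monomial_subalgebra q l ?A \<iota> "fst \<Sigma>" \<Lambda> \<Phi> by (rule sub[OF assms(5) \<Phi>])
    have "d * d = index s.K" unfolding K[OF s.quantum_torus_axioms] ker by (rule d)
    then show ?thesis unfolding alg[OF assms(5)] torus[OF assms(5)] by (rule s.cayley_hamilton_monomial[OF ker])
  qed
  have part2: "(completely_integrally_closed ?A \<longrightarrow>
        (maximal_order (monomial_algebra q \<iota> \<Sigma> \<Phi>) \<longleftrightarrow> integrally_convex \<Phi> \<and> integrally_closed \<Phi>)) \<and>
      (maximal_order (monomial_algebra q \<iota> \<Sigma> \<Phi>) \<longrightarrow> integrally_convex \<Phi> \<and> integrally_closed \<Phi>)"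
    if \<Phi>: "additive_submonoid \<Phi>" for \<Phi>
  proof -
    interpret s: monomial_subalgebra q l ?A \<iota> "fst \<Sigma>" \<Lambda> \<Phi> by (rule sub[OF assms(5) \<Phi>])
    show ?thesis unfolding alg[OF assms(5)] using s.maximal_order_if s.maximal_order_only_if by blast
  qed
  have forms: "\<exists>L'. toric_frame q \<iota> l (fst \<Sigma>') L' \<and> equivalent_forms l \<Lambda> L'"
    if mu: "mutation_equivalent q \<iota> l ex \<Sigma> \<Sigma>'" for \<Sigma>'
    by (rule mutation_equivalent_invariant[OF q assms(4,5) mu]) blast
  have part3: "frame_degree l \<Lambda>' = frame_degree l \<Lambda>"
    if mu: "mutation_equivalent q \<iota> l ex \<Sigma> \<Sigma>'" and fr: "toric_frame q \<iota> l (fst \<Sigma>') \<Lambda>'" for \<Sigma>' \<Lambda>'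
  proof -
    obtain L' where L': "toric_frame q \<iota> l (fst \<Sigma>') L'" "equivalent_forms l \<Lambda> L'"
      using forms[OF mu] by blast
    have "equivalent_forms l \<Lambda> \<Lambda>'"
      by (rule equivalent_forms_trans[OF L'(2) toric_frame_unique[OF q L'(1) fr]])
    then show ?thesis unfolding frame_degree_index by (simp add: equivalent_forms_index)
  qed
  have part4: "(\<forall>\<Sigma>'\<in>\<Theta>. \<forall>\<Sigma>''\<in>\<Theta>. \<forall>x\<in>\<AA>.
        reduced_trace (seed_torus q \<iota> \<Sigma>') x = reduced_trace (seed_torus q \<iota> \<Sigma>'') x) \<and>
      (\<forall>\<Sigma>'\<in>\<Theta>. reduced_trace (seed_torus q \<iota> \<Sigma>') ` \<AA>
        \<subseteq> (\<Inter>\<Sigma>''\<in>\<Theta>. center_of (monomial_algebra q \<iota> \<Sigma>'' (\<Phi> \<Sigma>'')))) \<and>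
      (frame_kernel l (\<Lambda> + \<Lambda>) = frame_kernel l \<Lambda> \<longrightarrow>
        (\<forall>\<Sigma>'\<in>\<Theta>.
          cayley_hamilton d (\<iota> ` base_ring q) \<AA>
            (\<Inter>\<Sigma>''\<in>\<Theta>. monomial_algebra q \<iota> \<Sigma>'' (\<Phi> \<Sigma>'') \<inter> center_of (seed_torus q \<iota> \<Sigma>''))
            (reduced_trace (seed_torus q \<iota> \<Sigma>')) \<and>
          ((\<Inter>\<Sigma>''\<in>\<Theta>. center_of (monomial_algebra q \<iota> \<Sigma>'' (\<Phi> \<Sigma>''))) \<subseteq> center_of (seed_torus q \<iota> \<Sigma>') \<longrightarrow>
            cayley_hamilton d (\<iota> ` base_ring q) \<AA>
              (\<Inter>\<Sigma>''\<in>\<Theta>. center_of (monomial_algebra q \<iota> \<Sigma>'' (\<Phi> \<Sigma>'')))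
              (reduced_trace (seed_torus q \<iota> \<Sigma>')))))"
    if \<Theta>: "\<forall>\<Sigma>'\<in>\<Theta>. mutation_equivalent q \<iota> l ex \<Sigma> \<Sigma>' \<and> additive_submonoid (\<Phi> \<Sigma>')"
      and \<AA>: "\<AA> = (\<Inter>\<Sigma>'\<in>\<Theta>. monomial_algebra q \<iota> \<Sigma>' (\<Phi> \<Sigma>'))" for \<Theta> \<Phi> \<AA>
  proof -
    have "\<forall>\<Sigma>'\<in>\<Theta>. \<exists>L'. toric_frame q \<iota> l (fst \<Sigma>') L' \<and> equivalent_forms l \<Lambda> L'"
      using \<Theta> forms by blast
    \<comment> \<open>One matrix is fixed for each seed; the index and the condition on the kernels
      are transferred along its equivalence with \<open>\<Lambda>\<close>.\<close>
    from bchoice[OF this] obtain L where L: "\<forall>\<Sigma>'\<in>\<Theta>. toric_frame q \<iota> l (fst \<Sigma>') (L \<Sigma>') \<and> equivalent_forms l \<Lambda> (L \<Sigma>')" ..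
    note frame = bspec[OF L, THEN conjunct1] and equiv = bspec[OF L, THEN conjunct2]
    have mono: "monomial_subalgebra q l ?A \<iota> (fst \<Sigma>') (L \<Sigma>') (\<Phi> \<Sigma>')" if "\<Sigma>' \<in> \<Theta>" for \<Sigma>'
      by (rule sub[OF frame[OF that] conjunct2[OF bspec[OF \<Theta> that]]])
    have qt: "quantum_torus q l ?A \<iota> (fst \<Sigma>') (L \<Sigma>')" if "\<Sigma>' \<in> \<Theta>" for \<Sigma>'
      by (rule toric_frame_quantum_torus[OF q frame[OF that]])
    have ind: "e * e = index (quantum_torus.K l (L \<Sigma>'))" if "\<Sigma>' \<in> \<Theta>" for \<Sigma>'
      unfolding K[OF qt[OF that]] equivalent_forms_index[OF equivalent_forms_double[OF equiv[OF that]]] by (rule e)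
    define pr where "pr \<Sigma>' = quantum_torus.proj ?A \<iota> (fst \<Sigma>') (quantum_torus.K l (L \<Sigma>'))" for \<Sigma>'
    have mem: "x \<in> quantum_torus.sp ?A \<iota> (fst \<Sigma>') (\<Phi> \<Sigma>')" if "\<Sigma>' \<in> \<Theta>" "x \<in> \<AA>" for \<Sigma>' x
      using that(2) unfolding \<AA> alg[OF frame[OF that(1)], symmetric] using that(1) by blast
    have memT: "x \<in> quantum_torus.sp ?A \<iota> (fst \<Sigma>') UNIV" if "\<Sigma>' \<in> \<Theta>" "x \<in> \<AA>" for \<Sigma>' x
      by (rule quantum_torus.sp_T[OF qt[OF that(1)] mem[OF that]])
    have rt: "reduced_trace (seed_torus q \<iota> \<Sigma>') x = of_nat e * pr \<Sigma>' x" if "\<Sigma>' \<in> \<Theta>" "x \<in> \<AA>" for \<Sigma>' x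
      unfolding torus[OF frame[OF that(1)]] pr_def
      by (rule quantum_torus.reduced_trace_T[OF qt[OF that(1)] ind[OF that(1)] memT[OF that]])
    have agree: "pr \<Sigma>' x = pr \<Sigma>'' x" if "\<Sigma>' \<in> \<Theta>" "\<Sigma>'' \<in> \<Theta>" "x \<in> \<AA>" for \<Sigma>' \<Sigma>'' x
      unfolding pr_def by (rule projections_agree[OF qt[OF that(1)] qt[OF that(2)] memT[OF that(1,3)] memT[OF that(2,3)]])
    have in_Z: "of_nat e * pr \<Sigma>' x \<in> monomial_algebra q \<iota> \<Sigma>'' (\<Phi> \<Sigma>'') \<inter> center_of (seed_torus q \<iota> \<Sigma>'')"
      if "\<Sigma>' \<in> \<Theta>" "\<Sigma>'' \<in> \<Theta>" "x \<in> \<AA>" for \<Sigma>' \<Sigma>'' x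
      unfolding agree[OF that] unfolding alg[OF frame[OF that(2)]] torus[OF frame[OF that(2)]] pr_def
        monomial_subalgebra.Z_eq[OF mono[OF that(2)], symmetric]
      by (rule monomial_subalgebra.trace_in_Z[OF mono[OF that(2)] mem[OF that(2,3)]])
    have Z_center: "monomial_algebra q \<iota> \<Sigma>' (\<Phi> \<Sigma>') \<inter> center_of (seed_torus q \<iota> \<Sigma>')
        \<subseteq> center_of (monomial_algebra q \<iota> \<Sigma>' (\<Phi> \<Sigma>'))" if "\<Sigma>' \<in> \<Theta>" for \<Sigma>'
      unfolding alg[OF frame[OF that]] torus[OF frame[OF that]] monomial_subalgebra.Z_eq[OF mono[OF that], symmetric]
      by (rule monomial_subalgebra.Z_center[OF mono[OF that]])
    have \<iota>_Z: "\<iota> ` ?A \<subseteq> monomial_algebra q \<iota> \<Sigma>' (\<Phi> \<Sigma>') \<inter> center_of (seed_torus q \<iota> \<Sigma>')" if "\<Sigma>' \<in> \<Theta>" for \<Sigma>'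
      unfolding alg[OF frame[OF that]] torus[OF frame[OF that]] monomial_subalgebra.Z_eq[OF mono[OF that], symmetric]
      by (rule monomial_subalgebra.\<iota>_in_Z[OF mono[OF that]])
    have rings: "unital_subring (monomial_algebra q \<iota> \<Sigma>' (\<Phi> \<Sigma>'))" "unital_subring (seed_torus q \<iota> \<Sigma>')" if "\<Sigma>' \<in> \<Theta>" for \<Sigma>'
      unfolding alg[OF frame[OF that]] torus[OF frame[OF that]]
      by (rule monomial_subalgebra.sp\<Phi>[OF mono[OF that]] quantum_torus.T_subring[OF qt[OF that]])+
    \<comment> \<open>One argument for both choices of \<open>C\<close>: a ring between the common
      part central in all the tori and \<open>\<AA>\<close>, and central in the torus of
      \<open>\<Sigma>'\<close>.\<close>
    have ch: "cayley_hamilton d (\<iota> ` ?A) \<AA> C (reduced_trace (seed_torus q \<iota> \<Sigma>'))"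
      if ker: "frame_kernel l (\<Lambda> + \<Lambda>) = frame_kernel l \<Lambda>" and \<Sigma>': "\<Sigma>' \<in> \<Theta>"
        and C: "unital_subring C" "C \<subseteq> \<AA>" "C \<subseteq> center_of (seed_torus q \<iota> \<Sigma>')"
          "(\<Inter>\<Sigma>''\<in>\<Theta>. monomial_algebra q \<iota> \<Sigma>'' (\<Phi> \<Sigma>'') \<inter> center_of (seed_torus q \<iota> \<Sigma>'')) \<subseteq> C" for \<Sigma>' C
      unfolding torus[OF frame[OF \<Sigma>']]
    proof (rule quantum_torus.cayley_hamilton_subring[OF qt[OF \<Sigma>'] equivalent_forms_kernel_double[OF equiv[OF \<Sigma>'] ker]])
      show "d * d = index (quantum_torus.K l (L \<Sigma>'))" using ind[OF \<Sigma>'] ed[OF ker] by simp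
      show "unital_subring \<AA>" unfolding \<AA> by (rule unital_subring_INT[OF rings(1)])
      show "\<AA> \<subseteq> quantum_torus.sp ?A \<iota> (fst \<Sigma>') UNIV" using memT[OF \<Sigma>'] by blast
      show "unital_subring C" "C \<subseteq> \<AA>" by (rule C)+
      show "C \<subseteq> quantum_torus.sp ?A \<iota> (fst \<Sigma>') (quantum_torus.K l (L \<Sigma>'))"
        using C(3) unfolding torus[OF frame[OF \<Sigma>']] quantum_torus.center_T[OF qt[OF \<Sigma>']] .
      show "\<iota> ` ?A \<subseteq> C" using C(4) \<iota>_Z by blast
      show "of_nat d * quantum_torus.proj ?A \<iota> (fst \<Sigma>') (quantum_torus.K l (L \<Sigma>')) x \<in> C" if "x \<in> \<AA>" for x
        using in_Z[OF \<Sigma>' _ that] C(4) unfolding ed[OF ker] pr_def by blast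
    qed
    show ?thesis
    proof (intro conjI ballI impI subsetI)
      fix \<Sigma>' \<Sigma>'' x assume "\<Sigma>' \<in> \<Theta>" "\<Sigma>'' \<in> \<Theta>" "x \<in> \<AA>"
      then show "reduced_trace (seed_torus q \<iota> \<Sigma>') x = reduced_trace (seed_torus q \<iota> \<Sigma>'') x"
        by (simp only: rt agree[of \<Sigma>' \<Sigma>''])
    next
      fix \<Sigma>' y assume \<Sigma>': "\<Sigma>' \<in> \<Theta>" and "y \<in> reduced_trace (seed_torus q \<iota> \<Sigma>') ` \<AA>"
      then obtain x where x: "x \<in> \<AA>" "y = of_nat e * pr \<Sigma>' x" using rt[OF \<Sigma>'] by auto
      show "y \<in> (\<Inter>\<Sigma>''\<in>\<Theta>. center_of (monomial_algebra q \<iota> \<Sigma>'' (\<Phi> \<Sigma>'')))"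
        unfolding x(2) using in_Z[OF \<Sigma>' _ x(1)] Z_center by blast
    next
      fix \<Sigma>' assume ker: "frame_kernel l (\<Lambda> + \<Lambda>) = frame_kernel l \<Lambda>" and \<Sigma>': "\<Sigma>' \<in> \<Theta>"
      let ?C = "\<Inter>\<Sigma>''\<in>\<Theta>. monomial_algebra q \<iota> \<Sigma>'' (\<Phi> \<Sigma>'') \<inter> center_of (seed_torus q \<iota> \<Sigma>'')"
      let ?C' = "\<Inter>\<Sigma>''\<in>\<Theta>. center_of (monomial_algebra q \<iota> \<Sigma>'' (\<Phi> \<Sigma>''))"
      show "cayley_hamilton d (\<iota> ` ?A) \<AA> ?C (reduced_trace (seed_torus q \<iota> \<Sigma>'))"
      proof (rule ch[OF ker \<Sigma>'])
        show "unital_subring ?C"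
          by (intro unital_subring_INT unital_subring_Int unital_subring_center rings)
        show "?C \<subseteq> \<AA>" unfolding \<AA> by blast
        show "?C \<subseteq> center_of (seed_torus q \<iota> \<Sigma>')" using \<Sigma>' by blast
      qed (rule order_refl)
      assume C': "?C' \<subseteq> center_of (seed_torus q \<iota> \<Sigma>')"
      show "cayley_hamilton d (\<iota> ` ?A) \<AA> ?C' (reduced_trace (seed_torus q \<iota> \<Sigma>'))"
      proof (rule ch[OF ker \<Sigma>' _ _ C'])
        show "unital_subring ?C'" by (intro unital_subring_INT unital_subring_center rings)
        show "?C' \<subseteq> \<AA>" unfolding \<AA> center_of_def by blast
        show "?C \<subseteq> ?C'" using Z_center by blast
      qed
    qed
  qed
  have degree: "real d = frame_degree l \<Lambda>"
    unfolding frame_degree_index d[symmetric] by simp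
  show ?thesis
  proof (intro exI[of _ d] conjI[OF degree] conjI[OF _ conjI[OF _ conjI]] allI impI)
    fix \<Phi> :: "(int ^ 'n) set" assume "additive_submonoid \<Phi> \<and> frame_kernel l (\<Lambda> + \<Lambda>) = frame_kernel l \<Lambda>"
    then show "cayley_hamilton d (\<iota> ` ?A) (monomial_algebra q \<iota> \<Sigma> \<Phi>)
      (monomial_algebra q \<iota> \<Sigma> \<Phi> \<inter> center_of (seed_torus q \<iota> \<Sigma>)) (reduced_trace (seed_torus q \<iota> \<Sigma>))"
      by (elim conjE) (rule part1)
  next
    fix \<Phi> :: "(int ^ 'n) set" assume "additive_submonoid \<Phi>"
    from part2[OF this] show "(completely_integrally_closed ?A \<longrightarrow>
        (maximal_order (monomial_algebra q \<iota> \<Sigma> \<Phi>) \<longleftrightarrow> integrally_convex \<Phi> \<and> integrally_closed \<Phi>)) \<and>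
      (maximal_order (monomial_algebra q \<iota> \<Sigma> \<Phi>) \<longrightarrow> integrally_convex \<Phi> \<and> integrally_closed \<Phi>)" .
  next
    fix \<Sigma>' :: "('a, 'n) seed" and \<Lambda>' assume "mutation_equivalent q \<iota> l ex \<Sigma> \<Sigma>' \<and> toric_frame q \<iota> l (fst \<Sigma>') \<Lambda>'"
    then show "frame_degree l \<Lambda>' = frame_degree l \<Lambda>" by (elim conjE) (rule part3)
  qed (elim conjE, rule part4)
qed

end
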